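(* Let $\Lambda$ be a finitely generated principal ideal domain. Then any finitely generated $\Lambda$-module is $\Lambda$-profinitely rigid in the absolute sense.
   Context: Rings are commutative. A commutative ring $\Lambda$ is called finitely generated if it is finitely generated as a $\mathbb{Z}$-algebra. For a $\Lambda$-module $M$, $\widehat{M}$ denotes the $\Lambda$-profinite completion of $M$, i.e. the topological $\Lambda$-module given by the inverse limit of the finite (as sets) quotient $\Lambda$-modules of $M$, each taken with the discrete topology; isomorphisms of profinite completions are isomorphisms of profinite (topological) $\Lambda$-modules. A $\Lambda$-module $M$ is residually finite if the canonical map $M \to \widehat{M}$ is injective. A finitely generated residually finite $\Lambda$-module $M$ is $\Lambda$-profinitely rigid in the absolute sense if the equivalence $\widehat{M} \cong \widehat{N} \Longleftrightarrow M \cong N$ holds for every finitely generated residually finite $\Lambda$-module $N$. (Finitely generated modules over a finitely generated Noetherian domain are automatically residually finite.) *)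

theory Defs
  imports
    "HOL-Analysis.Function_Topology"
    "HOL-Algebra.Module"
    "HOL-Algebra.Generated_Rings"
    "HOL-Algebra.Ring_Divisibility"
begin

definition finitely_generated_ring :: "('a, 'r) ring_scheme \<Rightarrow> bool" where
  "finitely_generated_ring R \<longleftrightarrow>
     (\<exists>S. finite S \<and> S \<subseteq> carrier R \<and> generate_ring R S = carrier R)"

definition finitely_generated_module ::
  "('a, 'r) ring_scheme \<Rightarrow> ('a, 'm, 'x) module_scheme \<Rightarrow> bool" where
  "finitely_generated_module R M \<longleftrightarrow>
     (\<exists>S. finite S \<and> S \<subseteq> carrier M \<and> (\<lambda>U. submodule U R M) hull S = carrier M)"

definition module_isos ::
  "('a, 'r) ring_scheme \<Rightarrow> ('a, 'm, 'x) module_scheme \<Rightarrow> ('a, 'n, 'y) module_scheme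
     \<Rightarrow> ('m \<Rightarrow> 'n) set" where
  "module_isos R M N =
     {h \<in> iso (add_monoid M) (add_monoid N).
        \<forall>a \<in> carrier R. \<forall>x \<in> carrier M. h (a \<odot>\<^bsub>M\<^esub> x) = a \<odot>\<^bsub>N\<^esub> h x}"

definition module_isomorphic ::
  "('a, 'r) ring_scheme \<Rightarrow> ('a, 'm, 'x) module_scheme \<Rightarrow> ('a, 'n, 'y) module_scheme \<Rightarrow> bool" where
  "module_isomorphic R M N \<longleftrightarrow> module_isos R M N \<noteq> {}"

text \<open>Module records extend ring records, but the module axioms do not mention the fields
  \<open>mult\<close> and \<open>one\<close>; they are left unspecified below. Scalar multiplication on cosets follows the
  pattern of \<^const>\<open>rcoset_mult\<close>.\<close>

definition quotient_module :: "('a, 'm, 'x) module_scheme \<Rightarrow> 'm set \<Rightarrow> ('a, 'm set) module" where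
  "quotient_module M U =
     \<lparr>carrier = a_rcosets\<^bsub>M\<^esub> U, monoid.mult = undefined, one = undefined,
      zero = U, add = set_add M,
      smult = (\<lambda>a A. \<Union>x\<in>A. U +>\<^bsub>M\<^esub> (a \<odot>\<^bsub>M\<^esub> x))\<rparr>"

definition cofinite_submodules ::
  "('a, 'r) ring_scheme \<Rightarrow> ('a, 'm, 'x) module_scheme \<Rightarrow> 'm set set" where
  "cofinite_submodules R M = {U. submodule U R M \<and> finite (carrier (quotient_module M U))}"

text \<open>For \<open>U \<subseteq> V\<close>, the transition map from \<open>M/U\<close> to \<open>M/V\<close> sends a coset \<open>A\<close> to \<open>V + A\<close>.\<close>

definition profinite_completion ::
  "('a, 'r) ring_scheme \<Rightarrow> ('a, 'm, 'x) module_scheme \<Rightarrow> ('a, 'm set \<Rightarrow> 'm set) module" where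
  "profinite_completion R M =
     \<lparr>carrier =
        {x \<in> (\<Pi>\<^sub>E U \<in> cofinite_submodules R M. carrier (quotient_module M U)).
           \<forall>U \<in> cofinite_submodules R M. \<forall>V \<in> cofinite_submodules R M.
             U \<subseteq> V \<longrightarrow> V <+>\<^bsub>M\<^esub> x U = x V},
      monoid.mult = undefined, one = undefined,
      zero = (\<lambda>U \<in> cofinite_submodules R M. \<zero>\<^bsub>quotient_module M U\<^esub>),
      add = (\<lambda>x y. \<lambda>U \<in> cofinite_submodules R M. x U \<oplus>\<^bsub>quotient_module M U\<^esub> y U),
      smult = (\<lambda>a x. \<lambda>U \<in> cofinite_submodules R M. a \<odot>\<^bsub>quotient_module M U\<^esub> x U)\<rparr>"

definition profinite_topology ::
  "('a, 'r) ring_scheme \<Rightarrow> ('a, 'm, 'x) module_scheme \<Rightarrow> ('m set \<Rightarrow> 'm set) topology" where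
  "profinite_topology R M =
     subtopology
       (product_topology (\<lambda>U. discrete_topology (carrier (quotient_module M U)))
          (cofinite_submodules R M))
       (carrier (profinite_completion R M))"

definition profinite_completions_isomorphic ::
  "('a, 'r) ring_scheme \<Rightarrow> ('a, 'm, 'x) module_scheme \<Rightarrow> ('a, 'n, 'y) module_scheme \<Rightarrow> bool" where
  "profinite_completions_isomorphic R M N \<longleftrightarrow>
     (\<exists>h \<in> module_isos R (profinite_completion R M) (profinite_completion R N).
        homeomorphic_map (profinite_topology R M) (profinite_topology R N) h)"

definition completion_map ::
  "('a, 'r) ring_scheme \<Rightarrow> ('a, 'm, 'x) module_scheme \<Rightarrow> 'm \<Rightarrow> 'm set \<Rightarrow> 'm set" where
  "completion_map R M x = (\<lambda>U \<in> cofinite_submodules R M. U +>\<^bsub>M\<^esub> x)"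

definition residually_finite_module ::
  "('a, 'r) ring_scheme \<Rightarrow> ('a, 'm, 'x) module_scheme \<Rightarrow> bool" where
  "residually_finite_module R M \<longleftrightarrow> inj_on (completion_map R M) (carrier M)"

text \<open>A formula cannot quantify over types, so the type \<open>'n\<close> of the elements of the competing
  modules \<open>N\<close> is a parameter; a statement in which \<open>'n\<close> is a free type variable covers all
  of them. The name \<^const>\<open>Module.module\<close> is qualified because of the homonymous type-class
  based locale.\<close>

definition profinitely_rigid ::
  "'n itself \<Rightarrow> ('a, 'r) ring_scheme \<Rightarrow> ('a, 'm, 'x) module_scheme \<Rightarrow> bool" where
  "profinitely_rigid (_ :: 'n itself) R M \<longleftrightarrow>
     Module.module R M \<and> finitely_generated_module R M \<and> residually_finite_module R M \<and>
     (\<forall>N :: ('a, 'n) module.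
        Module.module R N \<and> finitely_generated_module R N \<and> residually_finite_module R N \<longrightarrow>
        (profinite_completions_isomorphic R M N \<longleftrightarrow> module_isomorphic R M N))"

end

theory Submission
  imports Defs "HOL-Algebra.Finite_Extensions"
begin

text \<open>
  Let \<open>M\<close> be a finitely generated module over a finitely generated principal ideal domain \<open>R\<close>. Then
  \<open>M = F \<oplus> T\<close> with \<open>F\<close> free of some finite rank \<open>r\<close> and \<open>T\<close> the torsion submodule, which is killed by a
  single \<open>t \<noteq> 0\<close>. The proof recovers both \<open>T\<close> and \<open>r\<close> from one finite quotient \<open>M/aM\<close>, and these
  quotients are determined by the profinite completion.

  \<^bold>\<open>Torsion and rank from \<open>M/aM\<close>.\<close> Let \<open>t\<close> be a nonzero nonunit that kills the torsion of both \<open>M\<close> and \<open>N\<close>,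
  let \<open>a = t\<^sup>2\<close>, and let \<open>M/aM\<close> and \<open>N/aN\<close> be isomorphic. A torsion element of \<open>M\<close> is sent to a class
  killed by \<open>t\<close>, and such a class is represented modulo \<open>tN\<close> by a torsion element of \<open>N\<close>, which is
  unique since a torsion element that is a multiple of \<open>t\<close> vanishes. This embeds the torsion of \<open>M\<close>
  linearly into that of \<open>N\<close> (\<open>torsion_embedding\<close>). Both torsion modules are finite and the situation
  is symmetric, so the embedding is an isomorphism. The ranks agree because
  \<open>|M/aM| = |R/aR|\<^sup>r |T|\<close> (\<open>card_cosets_multiples\<close>) and \<open>|R/aR| > 1\<close>, and
  \<open>module_iso_of_splittings\<close> puts the two summands together.

  \<^bold>\<open>From completions to \<open>M/aM\<close>.\<close> An isomorphism \<open>h\<close> of completions gives an additive map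
  \<open>M \<rightarrow> N/aN\<close> by sending \<open>m\<close> to the component of \<open>h(m)\<close> at \<open>aN\<close>. It is onto because \<open>M\<close> is dense in its
  completion (\<open>completion_iso_epi_mod\<close>). The inverse of \<open>h\<close> gives such a map in the other direction,
  so the finite quotients \<open>M/aM\<close> and \<open>N/aN\<close> have equally many elements and both maps have the
  least possible kernel (\<open>mutual_epi_mod\<close>). Conversely an isomorphism of modules induces one of the
  completions (\<open>module_iso_imp_completions_iso\<close>).

  \<^bold>\<open>Finiteness of \<open>R/aR\<close>.\<close> All this needs \<open>R/aR\<close> to be finite for \<open>a \<noteq> 0\<close>. By factoring \<open>a\<close> one may
  assume that \<open>R/aR\<close> is a field, and a field that is finitely generated as a ring is finite
  (\<open>finitely_generated_ring_finite\<close>): by Zariski's lemma it is finite over the fraction field of the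
  subring generated by \<open>1\<close>, by the argument of Artin and Tate that fraction field is obtained by
  inverting one element, and this is impossible for \<open>\<int>\<close>. The same quotients show that \<open>M\<close> is residually
  finite (\<open>residually_finite\<close>). If \<open>R\<close> is itself finite, \<open>a = 0\<close> can be used, and \<open>M/aM\<close> is \<open>M\<close>.
\<close>

section \<open>Finitely generated fields are finite\<close>

text \<open>The fraction field of a subring \<open>A\<close>, realised inside the ambient field.\<close>
definition (in field) fractions :: "'a set \<Rightarrow> 'a set"
  where "fractions A = {a \<otimes> inv b | a b. a \<in> A \<and> b \<in> A - {\<zero>}}"

lemma (in field) inv_nonzero:
  assumes "b \<in> carrier R - {\<zero>}"
  shows "inv b \<in> carrier R - {\<zero>}" "b \<otimes> inv b = \<one>" "inv b \<otimes> b = \<one>"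
proof -
  have u: "b \<in> Units R" using assms field_Units by simp
  show "inv b \<in> carrier R - {\<zero>}"
    using u Units_inv_Units field_Units by blast
  show "b \<otimes> inv b = \<one>" "inv b \<otimes> b = \<one>" using u by auto
qed

lemma (in field) fractions_iff:
  assumes "A \<subseteq> carrier R"
  shows "z \<in> fractions A \<longleftrightarrow> z \<in> carrier R \<and> (\<exists>b \<in> A - {\<zero>}. z \<otimes> b \<in> A)"
proof
  assume "z \<in> fractions A"
  then obtain a b where ab: "a \<in> A" "b \<in> A - {\<zero>}" "z = a \<otimes> inv b"
    unfolding fractions_def by blast
  then have c: "a \<in> carrier R" "b \<in> carrier R - {\<zero>}" using assms by auto
  note i = inv_nonzero[OF c(2)]
  have e: "a \<otimes> inv b \<otimes> b = a" using c i by (simp add: m_assoc)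
  then show "z \<in> carrier R \<and> (\<exists>b \<in> A - {\<zero>}. z \<otimes> b \<in> A)"
    using ab(1,2) c(1) i(1) e unfolding ab(3) by (intro conjI bexI[of _ b]) auto
next
  assume "z \<in> carrier R \<and> (\<exists>b \<in> A - {\<zero>}. z \<otimes> b \<in> A)"
  then obtain b where z: "z \<in> carrier R" "b \<in> A - {\<zero>}" "z \<otimes> b \<in> A" by blast
  then have c: "b \<in> carrier R - {\<zero>}" using assms by auto
  note i = inv_nonzero[OF c]
  have "z = (z \<otimes> b) \<otimes> inv b" using z c i by (simp add: m_assoc)
  then show "z \<in> fractions A" using z unfolding fractions_def by blast
qed

lemma (in field) fractions_incl:
  assumes "subring A R" shows "A \<subseteq> fractions A"
proof
  fix a assume a: "a \<in> A"
  have "a \<in> carrier R" "\<one> \<in> A - {\<zero>}" using a subringE(1,3)[OF assms] by auto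
  then show "a \<in> fractions A"
    using a fractions_iff[OF subringE(1)[OF assms], of a] by (metis r_one)
qed

lemma (in field) fractions_minimal:
  assumes "A \<subseteq> F" "subfield F R" shows "fractions A \<subseteq> F"
proof
  fix z assume "z \<in> fractions A"
  then obtain a b where ab: "a \<in> A" "b \<in> A - {\<zero>}" "z = a \<otimes> inv b"
    unfolding fractions_def by blast
  then have "inv b \<in> F" using subfield_m_inv(1)[OF assms(2), of b] assms(1) by auto
  then show "z \<in> F"
    using ab assms(1) subringE(6)[OF subfieldE(1)[OF assms(2)]] by blast
qed

lemma (in field) fractions_subfield:
  assumes A: "subring A R" shows "subfield (fractions A) R"
proof -
  have sub: "A \<subseteq> carrier R" using subringE(1)[OF A] .
  note iff = fractions_iff[OF sub]
  have nz: "b \<otimes> c \<in> A - {\<zero>}" if "b \<in> A - {\<zero>}" "c \<in> A - {\<zero>}" for b c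
    using that sub integral[of b c] subringE(6)[OF A] by auto
  show ?thesis
  proof (rule subfieldI'[OF subringI])
    show "fractions A \<subseteq> carrier R" using iff by blast
    show "\<one> \<in> fractions A" using fractions_incl[OF A] subringE(3)[OF A] by blast
  next
    fix h assume "h \<in> fractions A"
    then obtain b where h: "h \<in> carrier R" "b \<in> A - {\<zero>}" "h \<otimes> b \<in> A" using iff by blast
    have b: "b \<in> carrier R" using h sub by blast
    have "(\<ominus> h) \<otimes> b \<in> A" using h b subringE(5)[OF A, of "h \<otimes> b"] l_minus by simp
    then show "\<ominus> h \<in> fractions A" using iff h by blast
  next
    fix h k assume "h \<in> fractions A" "k \<in> fractions A"
    then obtain b c where h: "h \<in> carrier R" "b \<in> A - {\<zero>}" "h \<otimes> b \<in> A"
      and k: "k \<in> carrier R" "c \<in> A - {\<zero>}" "k \<otimes> c \<in> A" using iff by meson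
    have bc: "b \<in> carrier R" "c \<in> carrier R" using h k sub by blast+
    have bA: "b \<in> A" "c \<in> A" using h k by auto
    have "(h \<otimes> k) \<otimes> (b \<otimes> c) = (h \<otimes> b) \<otimes> (k \<otimes> c)" using h(1) k(1) bc by algebra
    then have "(h \<otimes> k) \<otimes> (b \<otimes> c) \<in> A" using h(3) k(3) subringE(6)[OF A] by simp
    then show "h \<otimes> k \<in> fractions A" using iff nz[OF h(2) k(2)] h(1) k(1) by blast
    have "(h \<oplus> k) \<otimes> (b \<otimes> c) = (h \<otimes> b) \<otimes> c \<oplus> (k \<otimes> c) \<otimes> b" using h(1) k(1) bc by algebra
    then have "(h \<oplus> k) \<otimes> (b \<otimes> c) \<in> A" using h(3) k(3) bA subringE(6,7)[OF A] by simp
    then show "h \<oplus> k \<in> fractions A" using iff nz[OF h(2) k(2)] h(1) k(1) by blast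
  next
    fix k assume k: "k \<in> fractions A - {\<zero>}"
    then obtain b where b: "k \<in> carrier R" "b \<in> A - {\<zero>}" "k \<otimes> b \<in> A" using iff by blast
    have bc: "b \<in> carrier R" using b sub by blast
    note i = inv_nonzero[of k]
    have ki: "inv k \<in> carrier R" "k \<otimes> inv k = \<one>" using i k b by auto
    have "k \<otimes> b \<in> A - {\<zero>}" using k b bc integral[of k b] by auto
    moreover have "inv k \<otimes> (k \<otimes> b) = b"
    proof -
      have "inv k \<otimes> (k \<otimes> b) = (k \<otimes> inv k) \<otimes> b" using ki(1) b(1) bc by algebra
      then show ?thesis using ki(2) bc by simp
    qed
    moreover have "b \<in> A" using b by blast
    ultimately show "inv k \<in> fractions A" unfolding iff using ki(1) by (metis (no_types))
  qed
qed

lemma (in field) fractions_common_denominator: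
  assumes A: "subring A R" and "finite Y" "Y \<subseteq> fractions A"
  shows "\<exists>e \<in> A - {\<zero>}. \<forall>y \<in> Y. e \<otimes> y \<in> A"
  using assms(2,3)
proof (induct Y)
  case empty
  have "\<one> \<in> A - {\<zero>}" using subringE(3)[OF A] by simp
  then show ?case by blast
next
  case (insert y Y)
  have sub: "A \<subseteq> carrier R" using subringE(1)[OF A] .
  obtain e where e: "e \<in> A - {\<zero>}" "\<forall>y \<in> Y. e \<otimes> y \<in> A" using insert by auto
  obtain b where b: "b \<in> A - {\<zero>}" "y \<otimes> b \<in> A" and y: "y \<in> carrier R"
    using insert fractions_iff[OF sub] by auto
  have c: "e \<in> carrier R" "b \<in> carrier R" using e b sub by auto
  have "e \<otimes> b \<in> A - {\<zero>}" using e(1) b(1) c integral[of e b] subringE(6)[OF A] by auto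
  moreover have "(e \<otimes> b) \<otimes> y \<in> A"
  proof -
    have "(e \<otimes> b) \<otimes> y = e \<otimes> (y \<otimes> b)" using c y by algebra
    then show ?thesis using e(1) b(2) subringE(6)[OF A] by simp
  qed
  moreover have "(e \<otimes> b) \<otimes> z \<in> A" if z: "z \<in> Y" for z
  proof -
    have "z \<in> carrier R" using z insert fractions_iff[OF sub] by auto
    then have "(e \<otimes> b) \<otimes> z = b \<otimes> (e \<otimes> z)" using c by algebra
    then show ?thesis using e(2) z b(1) subringE(6)[OF A] by simp
  qed
  ultimately show ?case by blast
qed

text \<open>The fraction field of \<open>A\<close> is \<open>A[1/e]\<close> for some \<open>e\<close>.\<close>
definition (in field) finite_localization :: "'a set \<Rightarrow> bool"
  where "finite_localization A \<longleftrightarrow>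
    (\<exists>e \<in> A - {\<zero>}. \<forall>a \<in> A - {\<zero>}. \<exists>b \<in> A. \<exists>n::nat. a \<otimes> b = e [^] n)"

text \<open>The argument of Artin and Tate. Let \<open>1\<close> belong to a basis of the field over \<open>Frac A\<close>. Only finitely many
  coefficients occur when the products of the generators with the basis elements are expanded, so one
  \<open>e \<in> A\<close> clears all their denominators, and then the \<open>A[1/e]\<close>-span of the basis is a subring. It contains
  all generators, hence is the whole field. So the inverse of \<open>a \<in> A\<close> lies in this span, and comparing
  its coordinates at the basis element \<open>1\<close> gives \<open>1/a \<in> A[1/e]\<close>.\<close>
lemma (in field) artin_tate_finite_localization:
  assumes A: "subring A R" and S: "finite S" "S \<subseteq> carrier R"
    and gen: "generate_ring R (A \<union> S) = carrier R"
    and fd: "finite_dimension (fractions A) (carrier R)"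
  shows "finite_localization A"
proof -
  let ?F = "fractions A"
  have sub: "A \<subseteq> carrier R" using subringE(1)[OF A] .
  have F: "subfield ?F R" using fractions_subfield[OF A] .
  have Fsub: "?F \<subseteq> carrier R" using subfieldE(3)[OF F] .
  have AF: "A \<subseteq> ?F" using fractions_incl[OF A] .
  obtain n where n: "dimension n ?F (carrier R)" using fd by blast
  have "independent ?F [\<one>]"
    by (rule li_Cons) auto
  then obtain Vs where Vs: "independent ?F (Vs @ [\<one>])" "Span ?F (Vs @ [\<one>]) = carrier R"
    using complete_base[OF F n, of "[\<one>]"] by auto
  define Us where "Us = Vs @ [\<one>]"
  have indep: "independent ?F Us" and span: "Span ?F Us = carrier R" using Vs Us_def by auto
  have Us: "set Us \<subseteq> carrier R" using independent_in_carrier[OF indep] .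
  define L where "L = {combine Ks Us | Ks. length Ks = length Us \<and> set Ks \<subseteq> A}"
  have L_carrier: "L \<subseteq> carrier R" unfolding L_def using combine_in_carrier Us sub by blast
  have L_add: "u \<oplus> v \<in> L" if uv: "u \<in> L" "v \<in> L" for u v
  proof -
    obtain Ks Ks' where K: "length Ks = length Us" "set Ks \<subseteq> A" "u = combine Ks Us"
      and K': "length Ks' = length Us" "set Ks' \<subseteq> A" "v = combine Ks' Us"
      using uv unfolding L_def by blast
    have "u \<oplus> v = combine (map2 (\<oplus>) Ks Ks') Us"
      using combine_add[OF K(1) K'(1)] K K' Us sub by blast
    moreover have "set (map2 (\<oplus>) Ks Ks') \<subseteq> A"
      using K(2) K'(2) subringE(7)[OF A] by (auto elim!: in_set_zipE)
    ultimately show ?thesis using K(1) K'(1) unfolding L_def by force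
  qed
  have L_smult: "a \<otimes> v \<in> L" if av: "a \<in> A" "v \<in> L" for a v
  proof -
    obtain Ks where K: "length Ks = length Us" "set Ks \<subseteq> A" "v = combine Ks Us"
      using av unfolding L_def by blast
    have "a \<otimes> v = combine (map ((\<otimes>) a) Ks) Us"
      using combine_r_distr K Us sub av by blast
    moreover have "set (map ((\<otimes>) a) Ks) \<subseteq> A"
      using K(2) av(1) subringE(6)[OF A] by auto
    ultimately show ?thesis using K(1) unfolding L_def by force
  qed
  have L_zero: "\<zero> \<in> L"
    unfolding L_def using combine_replicate[OF Us] subringE(2)[OF A]
    by (intro CollectI exI[of _ "replicate (length Us) \<zero>"]) auto
  have combine_last: "combine (replicate (length Vs) \<zero> @ [w]) Us = w" if w: "w \<in> carrier R" for w
  proof -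
    have z: "set (replicate (length Vs) \<zero>) \<subseteq> carrier R" by auto
    have V: "set Vs \<subseteq> carrier R" using Us Us_def by simp
    have "combine (replicate (length Vs) \<zero> @ [w]) Us =
        combine (replicate (length Vs) \<zero>) Vs \<oplus> combine [w] [\<one>]"
      unfolding Us_def using combine_append[OF _ z V, of "[w]" "[\<one>]"] w by simp
    then show ?thesis using combine_replicate[OF V] w by simp
  qed
  have L_one: "\<one> \<in> L"
  proof -
    have "combine (replicate (length Vs) \<zero> @ [\<one>]) Us = \<one>" using combine_last by simp
    then show ?thesis
      unfolding L_def using subringE(2,3)[OF A] Us_def
      by (intro CollectI exI[of _ "replicate (length Vs) \<zero> @ [\<one>]"]) auto
  qed
  have coeffs: "\<exists>Y. finite Y \<and> Y \<subseteq> ?F \<and> (\<forall>e\<in>carrier R. (\<forall>y\<in>Y. e \<otimes> y \<in> A) \<longrightarrow> e \<otimes> v \<in> L)"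
    if v: "v \<in> carrier R" for v
  proof -
    have "v \<in> Span ?F Us" using v span by simp
    then obtain Ks where K: "set Ks \<subseteq> ?F" "length Ks = length Us" "v = combine Ks Us"
      using Span_mem_iff_length_version[OF F Us] by blast
    have "e \<otimes> v \<in> L" if e: "e \<in> carrier R" "\<forall>y \<in> set Ks. e \<otimes> y \<in> A" for e
    proof -
      have "e \<otimes> v = combine (map ((\<otimes>) e) Ks) Us"
        using combine_r_distr[OF _ Us e(1), of Ks] K Fsub by blast
      then show ?thesis unfolding L_def using e(2) K(2) by force
    qed
    then show ?thesis using K(1) by (intro exI[of _ "set Ks"]) auto
  qed
  define P where "P = {s \<otimes> u | s u. s \<in> S \<and> u \<in> set Us}"
  have finP: "finite P"
  proof -
    have "P = (\<lambda>(s,u). s \<otimes> u) ` (S \<times> set Us)" unfolding P_def by auto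
    then show ?thesis using S by simp
  qed
  have P: "P \<subseteq> carrier R" unfolding P_def using S Us by auto
  have "\<forall>v\<in>P. \<exists>Y. finite Y \<and> Y \<subseteq> ?F \<and>
      (\<forall>e\<in>carrier R. (\<forall>y\<in>Y. e \<otimes> y \<in> A) \<longrightarrow> e \<otimes> v \<in> L)"
    using coeffs P by (meson subsetD)
  from bchoice[OF this] obtain Y where Y: "\<forall>v\<in>P. finite (Y v) \<and> Y v \<subseteq> ?F \<and>
      (\<forall>e\<in>carrier R. (\<forall>y\<in>Y v. e \<otimes> y \<in> A) \<longrightarrow> e \<otimes> v \<in> L)" ..
  have finY: "finite (\<Union>v\<in>P. Y v)" and YF: "(\<Union>v\<in>P. Y v) \<subseteq> ?F" using Y finP by auto
  from fractions_common_denominator[OF A finY YF]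
  obtain e where e: "e \<in> A - {\<zero>}" "\<forall>y \<in> (\<Union>v\<in>P. Y v). e \<otimes> y \<in> A" ..
  have eA: "e \<in> A" and ec: "e \<in> carrier R" using e sub by auto
  have en: "e [^] (n::nat) \<in> A" for n
    using eA subringE(3,6)[OF A] by (induct n) auto
  have enc: "e [^] (n::nat) \<in> carrier R" for n using ec by simp
  have eP: "e \<otimes> v \<in> L" if "v \<in> P" for v
  proof -
    have "\<forall>y\<in>Y v. e \<otimes> y \<in> A" using e(2) that by blast
    then show ?thesis using Y that ec by blast
  qed
  have sL: "e \<otimes> (s \<otimes> v) \<in> L" if s: "s \<in> S" and v: "v \<in> L" for s v
  proof -
    have sc: "s \<in> carrier R" using s S by auto
    obtain Ks where K: "length Ks = length Us" "set Ks \<subseteq> A" "v = combine Ks Us"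
      using v unfolding L_def by blast
    have gen: "e \<otimes> (s \<otimes> combine Ks Vs) \<in> L" if "set Ks \<subseteq> A" "set Vs \<subseteq> set Us" for Ks Vs
      using that
    proof (induct Ks Vs rule: combine.induct)
      case (1 k Ks u Us')
      have c: "k \<in> carrier R" "u \<in> carrier R" "combine Ks Us' \<in> carrier R"
        using 1 sub Us combine_in_carrier by auto
      have "e \<otimes> (s \<otimes> u) \<in> L" using eP[of "s \<otimes> u"] s 1 unfolding P_def by auto
      then have "k \<otimes> (e \<otimes> (s \<otimes> u)) \<in> L" using L_smult 1 by auto
      then have "k \<otimes> (e \<otimes> (s \<otimes> u)) \<oplus> e \<otimes> (s \<otimes> combine Ks Us') \<in> L"
        using L_add 1 by auto
      moreover have "e \<otimes> (s \<otimes> combine (k # Ks) (u # Us')) =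
          k \<otimes> (e \<otimes> (s \<otimes> u)) \<oplus> e \<otimes> (s \<otimes> combine Ks Us')"
        unfolding combine.simps using c ec sc by algebra
      ultimately show ?case by simp
    qed (use ec sc L_zero in auto)
    show ?thesis unfolding K(3) using gen K(2) by blast
  qed
  \<comment> \<open>\<open>V\<close> is the \<open>A[1/e]\<close>-span of the basis, \<open>W\<close> the ring of multipliers that preserve it.\<close>
  define V where "V = {v \<in> carrier R. \<exists>n::nat. e [^] n \<otimes> v \<in> L}"
  define W where "W = {z \<in> carrier R. \<forall>v \<in> V. z \<otimes> v \<in> V}"
  have LV: "L \<subseteq> V" unfolding V_def using L_carrier by (auto intro!: exI[of _ "0::nat"])
  have V_add: "u \<oplus> v \<in> V" if uv: "u \<in> V" "v \<in> V" for u v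
  proof -
    obtain n m :: nat where nm: "e [^] n \<otimes> u \<in> L" "e [^] m \<otimes> v \<in> L"
      using uv unfolding V_def by blast
    have c: "u \<in> carrier R" "v \<in> carrier R" using uv unfolding V_def by auto
    have "e [^] m \<otimes> (e [^] n \<otimes> u) \<oplus> e [^] n \<otimes> (e [^] m \<otimes> v) \<in> L"
      using L_add L_smult nm en by blast
    moreover have "e [^] m \<otimes> (e [^] n \<otimes> u) \<oplus> e [^] n \<otimes> (e [^] m \<otimes> v) =
        (e [^] m \<otimes> e [^] n) \<otimes> (u \<oplus> v)"
      using c enc[of n] enc[of m] by algebra
    ultimately have "e [^] (m + n) \<otimes> (u \<oplus> v) \<in> L"
      using nat_pow_mult[OF ec] by simp
    then show ?thesis using c unfolding V_def by blast
  qed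
  have V_A: "a \<otimes> v \<in> V" if av: "a \<in> A" "v \<in> V" for a v
  proof -
    obtain n :: nat where n: "e [^] n \<otimes> v \<in> L" using av unfolding V_def by blast
    have c: "a \<in> carrier R" "v \<in> carrier R" using av sub unfolding V_def by auto
    have "a \<otimes> (e [^] n \<otimes> v) \<in> L" using n av L_smult by simp
    moreover have "a \<otimes> (e [^] n \<otimes> v) = e [^] n \<otimes> (a \<otimes> v)" using c enc[of n] by algebra
    ultimately have "e [^] n \<otimes> (a \<otimes> v) \<in> L" by simp
    then show ?thesis using c unfolding V_def by blast
  qed
  have "subring W R"
  proof (rule subringI)
    show "W \<subseteq> carrier R" "\<one> \<in> W" unfolding W_def V_def by auto
    fix h assume h: "h \<in> W"
    show "\<ominus> h \<in> W"
    proof -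
      have "\<ominus> h \<otimes> v \<in> V" if v: "v \<in> V" for v
      proof -
        have c: "h \<in> carrier R" "v \<in> carrier R" using h v unfolding W_def V_def by auto
        have "\<ominus> \<one> \<otimes> (h \<otimes> v) \<in> V" using V_A[of "\<ominus> \<one>" "h \<otimes> v"] subringE(3,5)[OF A] h v
          unfolding W_def by auto
        moreover have "\<ominus> \<one> \<otimes> (h \<otimes> v) = \<ominus> h \<otimes> v" using c by algebra
        ultimately show ?thesis by simp
      qed
      then show ?thesis using h unfolding W_def by auto
    qed
    fix k assume k: "k \<in> W"
    show "h \<otimes> k \<in> W" "h \<oplus> k \<in> W"
      using h k V_add unfolding W_def V_def by (auto simp: m_assoc l_distr)
  qed
  moreover have "A \<subseteq> W" unfolding W_def using V_A sub by auto
  moreover have "S \<subseteq> W"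
  proof
    fix s assume s: "s \<in> S"
    have sc: "s \<in> carrier R" using s S by auto
    have "s \<otimes> v \<in> V" if v: "v \<in> V" for v
    proof -
      obtain n :: nat where n: "e [^] n \<otimes> v \<in> L" using v unfolding V_def by blast
      have c: "v \<in> carrier R" using v unfolding V_def by auto
      have "e \<otimes> (s \<otimes> (e [^] n \<otimes> v)) \<in> L" using sL[OF s n] .
      moreover have "e \<otimes> (s \<otimes> (e [^] n \<otimes> v)) = (e [^] n \<otimes> e) \<otimes> (s \<otimes> v)"
        using c sc ec enc[of n] by algebra
      ultimately have "e [^] (Suc n) \<otimes> (s \<otimes> v) \<in> L" by simp
      then show ?thesis using c sc unfolding V_def by blast
    qed
    then show "s \<in> W" using sc unfolding W_def by auto
  qed
  ultimately have "carrier R \<subseteq> W"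
    using generate_ring_min_subring1[of "A \<union> S" W] gen sub S(2) by blast
  then have VR: "v \<in> V" if "v \<in> carrier R" for v
    using that LV L_one unfolding W_def by force
  have "\<exists>b \<in> A. \<exists>n::nat. a \<otimes> b = e [^] n" if a: "a \<in> A - {\<zero>}" for a
  proof -
    have ac: "a \<in> carrier R - {\<zero>}" using a sub by auto
    note i = inv_nonzero[OF ac]
    obtain n :: nat where n: "e [^] n \<otimes> inv a \<in> L" using VR[of "inv a"] i unfolding V_def by blast
    then obtain Ks where K: "length Ks = length Us" "set Ks \<subseteq> A" "e [^] n \<otimes> inv a = combine Ks Us"
      unfolding L_def by blast
    let ?w = "e [^] n \<otimes> inv a"
    \<comment> \<open>The coordinates of \<open>e\<^sup>n/a\<close> are unique, and one choice has \<open>e\<^sup>n/a\<close> at the basis element \<open>1\<close> and \<open>0\<close> elsewhere.\<close>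
    let ?Ks' = "replicate (length Vs) \<zero> @ [?w]"
    have w: "?w \<in> carrier R" using i enc by auto
    have wF: "?w \<in> ?F" using en a unfolding fractions_def by blast
    have "combine ?Ks' Us = ?w" using combine_last w .
    moreover have "set ?Ks' \<subseteq> ?F" using wF subringE(2)[OF A] AF by auto
    moreover have "length ?Ks' = length Us" using Us_def by simp
    moreover have "set Ks \<subseteq> ?F" using K AF by blast
    ultimately have "Ks = ?Ks'"
      using unique_decomposition[OF F indep, of ?w] K w span by auto
    then have "?w \<in> A" using K(2) by auto
    moreover have "a \<otimes> ?w = e [^] n"
    proof -
      have c: "a \<in> carrier R" "inv a \<in> carrier R" using ac i by auto
      have "a \<otimes> ?w = e [^] n \<otimes> (a \<otimes> inv a)" using c enc[of n] by algebra
      then show ?thesis using i enc by simp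
    qed
    ultimately show ?thesis by blast
  qed
  then show ?thesis unfolding finite_localization_def using e(1) by blast
qed

text \<open>A polynomial ring \<open>A[x]\<close> does not become a field by inverting one element \<open>d\<close>: the element \<open>1 + xd\<close> is
  coprime to \<open>xd\<close>, so if it divided a power of \<open>d\<close> it would divide \<open>1\<close>, but it has positive degree.\<close>
lemma (in field) transcendental_not_finite_localization:
  assumes A: "subring A R" and x: "x \<in> carrier R" and tr: "(transcendental over A) x"
  shows "\<not> finite_localization (simple_extension A x)"
proof
  let ?B = "simple_extension A x"
  have sub: "A \<subseteq> carrier R" using subringE(1)[OF A] .
  have B: "subring ?B R" using simple_extension_is_subring[OF A x] .
  have B_eval: "?B = (\<lambda>p. eval p x) ` carrier (A[X])"
    using simple_extension_as_eval_img[OF sub x] .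
  have Bc: "?B \<subseteq> carrier R" using subringE(1)[OF B] .
  interpret UP: domain "A[X]" using univ_poly_is_domain[OF A] .
  interpret ev: ring_hom_ring "A[X]" R "\<lambda>p. eval p x" using eval_ring_hom[OF A x] .
  assume "finite_localization ?B"
  then obtain d where d: "d \<in> ?B - {\<zero>}"
    and div: "\<And>a. a \<in> ?B - {\<zero>} \<Longrightarrow> \<exists>b \<in> ?B. \<exists>n::nat. a \<otimes> b = d [^] n"
    unfolding finite_localization_def by blast
  obtain p where p: "p \<in> carrier (A[X])" "d = eval p x" using d B_eval by blast
  have pne: "p \<noteq> []" using p(2) d by auto
  have pA: "set p \<subseteq> A" "lead_coeff p \<noteq> \<zero>"
    using p(1) pne unfolding univ_poly_def polynomial_def by auto
  \<comment> \<open>Coefficient lists start at the leading coefficient, so \<open>p @ [\<one>]\<close> is the polynomial \<open>X p + 1\<close>.\<close>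
  let ?q = "p @ [\<one>]"
  have q: "?q \<in> carrier (A[X])"
    using pA pne subringE(3)[OF A] unfolding univ_poly_def polynomial_def by auto
  define u where "u = d \<otimes> x \<oplus> \<one>"
  have dc: "d \<in> carrier R" using d Bc by blast
  have "set p \<subseteq> carrier R" using pA(1) sub by blast
  then have qu: "eval ?q x = u"
    unfolding u_def p(2) by (rule eval_append_aux[OF _ one_closed x])
  have uc: "u \<in> carrier R" using dc x unfolding u_def by simp
  have "u \<noteq> \<zero>" using eval_transcendental[OF tr q] unfolding qu by blast
  moreover have "u \<in> ?B" using qu q B_eval by blast
  ultimately obtain b n where b: "b \<in> ?B" "u \<otimes> b = d [^] (n::nat)" using div by blast
  have bc: "b \<in> carrier R" using b Bc by blast
  have mx: "\<ominus> x \<in> ?B" using simple_extension_mem[OF A x] subringE(5)[OF B] by simp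
  have pw: "(\<ominus> x) [^] (m::nat) \<in> ?B" for m
    using mx subringE(3,6)[OF B] by (induct m) auto
  \<comment> \<open>Modulo \<open>u = 1 + xd\<close> the element \<open>-xd\<close> is \<open>1\<close>, hence so are its powers.\<close>
  have ex: "\<exists>k \<in> ?B. (\<ominus> x \<otimes> d) [^] (m::nat) \<oplus> u \<otimes> k = \<one>" for m
  proof (induct m)
    case 0
    then show ?case using subringE(2)[OF B] uc by (intro bexI[of _ \<zero>]) auto
  next
    case (Suc m)
    then obtain k where k: "k \<in> ?B" "(\<ominus> x \<otimes> d) [^] m \<oplus> u \<otimes> k = \<one>" by blast
    let ?v = "\<ominus> x \<otimes> d" and ?w = "(\<ominus> x \<otimes> d) [^] m"
    have c: "k \<in> carrier R" "?w \<in> carrier R" and vc: "?v \<in> carrier R" using k Bc x dc by auto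
    have "?v \<in> ?B" using mx d subringE(6)[OF B] by simp
    then have "\<one> \<oplus> k \<otimes> ?v \<in> ?B"
      using subringE(7)[OF B subringE(3)[OF B] subringE(6)[OF B k(1)]] by simp
    moreover have "?w \<otimes> ?v \<oplus> u \<otimes> (\<one> \<oplus> k \<otimes> ?v) = (?w \<oplus> u \<otimes> k) \<otimes> ?v \<oplus> u"
      using c uc vc by algebra
    moreover have "\<one> \<otimes> ?v \<oplus> u = \<one>" unfolding u_def using x dc by algebra
    ultimately have "\<one> \<oplus> k \<otimes> ?v \<in> ?B" "?w \<otimes> ?v \<oplus> u \<otimes> (\<one> \<oplus> k \<otimes> ?v) = \<one>"
      using k(2) by simp_all
    then show ?case by auto
  qed
  then obtain k where k: "k \<in> ?B" "(\<ominus> x \<otimes> d) [^] n \<oplus> u \<otimes> k = \<one>" by blast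
  have kc: "k \<in> carrier R" using k Bc by blast
  have xn: "(\<ominus> x) [^] n \<in> carrier R" using x by simp
  have "(\<ominus> x \<otimes> d) [^] n = (\<ominus> x) [^] n \<otimes> (u \<otimes> b)"
    using nat_pow_distrib[of "\<ominus> x" d n] x dc b(2) by simp
  then have "u \<otimes> ((\<ominus> x) [^] n \<otimes> b \<oplus> k) = (\<ominus> x \<otimes> d) [^] n \<oplus> u \<otimes> k"
    using uc kc xn bc by algebra
  then have "u \<otimes> ((\<ominus> x) [^] n \<otimes> b \<oplus> k) = \<one>" using k(2) by simp
  moreover have "(\<ominus> x) [^] n \<otimes> b \<oplus> k \<in> ?B"
    using subringE(7)[OF B subringE(6)[OF B pw b(1)] k(1)] .
  ultimately obtain y where y: "y \<in> ?B" "u \<otimes> y = \<one>" by blast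
  then obtain r where r: "r \<in> carrier (A[X])" "u \<otimes> eval r x = \<one>"
    unfolding B_eval by blast
  have "eval (?q \<otimes>\<^bsub>A[X]\<^esub> r) x = eval \<one>\<^bsub>A[X]\<^esub> x"
    using ev.hom_mult[OF q r(1)] ev.hom_one qu r(2) by simp
  then have "?q \<otimes>\<^bsub>A[X]\<^esub> r = \<one>\<^bsub>A[X]\<^esub>"
    using tr q r(1) unfolding transcendental_def over_def inj_on_def by blast
  moreover have "r \<otimes>\<^bsub>A[X]\<^esub> ?q = ?q \<otimes>\<^bsub>A[X]\<^esub> r"
    using UP.m_comm[OF r(1) q] .
  ultimately have "?q \<in> Units (A[X])" unfolding Units_def using q r(1) by auto
  then obtain c where "?q = [c]" using univ_poly_units_incl[OF A] by blast
  then show False using pne by simp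
qed

text \<open>Zariski's lemma, relative to an arbitrary subring. Adjoin one generator \<open>x\<close> to \<open>A\<close>. By induction the field is
  finite over \<open>Frac A[x]\<close>, and by Artin and Tate that fraction field is a localization of \<open>A[x]\<close> at one
  element. So \<open>x\<close> is algebraic over \<open>Frac A\<close>, which makes \<open>Frac A[x]\<close> finite over \<open>Frac A\<close>.\<close>
lemma (in field) zariski_finite_dimension:
  assumes "finite S" "S \<subseteq> carrier R" "subring A R" "generate_ring R (A \<union> S) = carrier R"
  shows "finite_dimension (fractions A) (carrier R)"
  using assms
proof (induct S arbitrary: A)
  case empty
  have Ac: "A \<subseteq> carrier R" using subringE(1)[OF empty(2)] .
  have "carrier R \<subseteq> A"
    using generate_ring_min_subring1[OF Ac empty(2) subset_refl] empty(3) by simp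
  then have "fractions A = carrier R"
    using fractions_incl[OF empty(2)] fractions_minimal[OF Ac carrier_is_subfield] by blast
  then show ?case
    using finite_dimensionI[OF dimension_one[OF carrier_is_subfield]] by simp
next
  case (insert x S)
  have A: "subring A R" and x: "x \<in> carrier R" and S: "S \<subseteq> carrier R" using insert by auto
  have sub: "A \<subseteq> carrier R" using subringE(1)[OF A] .
  let ?B = "simple_extension A x" and ?F = "fractions A"
  have B: "subring ?B R" using simple_extension_is_subring[OF A x] .
  have Bc: "?B \<subseteq> carrier R" using subringE(1)[OF B] .
  have AB: "A \<subseteq> ?B" "x \<in> ?B" using simple_extension_incl[OF sub x] simple_extension_mem[OF A x] by simp_all
  have "generate_ring R (A \<union> insert x S) \<subseteq> generate_ring R (?B \<union> S)"
    using AB Bc S by (intro mono_generate_ring) auto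
  moreover have "generate_ring R (?B \<union> S) \<subseteq> carrier R"
    using Bc S by (intro generate_ring_incl) auto
  ultimately have gen: "generate_ring R (?B \<union> S) = carrier R" using insert(6) by auto
  have fdB: "finite_dimension (fractions ?B) (carrier R)" using insert(3)[OF S B gen] .
  have F: "subfield ?F R" using fractions_subfield[OF A] .
  have alg: "(algebraic over ?F) x"
  proof (rule ccontr)
    assume "\<not> (algebraic over ?F) x"
    then have "(transcendental over A) x"
      using transcendental_mono[OF fractions_incl[OF A]] unfolding over_def by blast
    then show False
      using transcendental_not_finite_localization[OF A x]
        artin_tate_finite_localization[OF B insert(1) S gen fdB] by blast
  qed
  let ?E = "simple_extension ?F x"
  have E: "subfield ?E R" using simple_extension_is_subfield[OF F x] alg by simp
  have FE: "finite_dimension ?F ?E" using finite_dimension_simple_extension[OF F x] alg by simp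
  have "fractions ?B = ?E"
  proof
    show "fractions ?B \<subseteq> ?E"
      using fractions_minimal[OF mono_simple_extension[OF fractions_incl[OF A]] E] .
    have fB: "subfield (fractions ?B) R" using fractions_subfield[OF B] .
    have BfB: "?B \<subseteq> fractions ?B" using fractions_incl[OF B] .
    have "?F \<subseteq> fractions ?B" using fractions_minimal[OF _ fB, of A] AB BfB by blast
    then show "?E \<subseteq> fractions ?B"
      using simple_extension_subring_incl[OF subfieldE(1)[OF fB]] AB BfB by blast
  qed
  then show ?case
    using fdB FE telescopic_base[OF F E] unfolding finite_dimension_def by fastforce
qed

text \<open>The subring generated by \<open>1\<close> is a quotient of \<open>\<int>\<close>. If it were \<open>\<int>\<close>, then for every \<open>e = k \<noteq> 0\<close> the integer
  \<open>|k| + 1\<close>, being coprime to \<open>k\<close>, would divide no power of \<open>k\<close>.\<close>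
lemma (in field) prime_subring_finite:
  assumes loc: "finite_localization (generate_ring R {})"
  shows "finite (generate_ring R {})"
proof -
  define f where "f k = [k] \<cdot> \<one>" for k :: int
  have fc: "f k \<in> carrier R" for k unfolding f_def by simp
  have f_add: "f (k + l) = f k \<oplus> f l" for k l
    unfolding f_def by (simp add: add.int_pow_mult)
  have f_neg: "f (- k) = \<ominus> f k" for k
    unfolding f_def by (simp add: add.int_pow_neg)
  have f_mult: "f (k * l) = f k \<otimes> f l" for k l
    using add_pow_ldistr_int[of "\<one>" "f l" k] fc add.int_pow_pow[of "\<one>" k l]
    unfolding f_def by (simp add: mult.commute)
  have f01: "f 0 = \<zero>" "f 1 = \<one>" unfolding f_def by (simp_all add: add_pow_int_ge)
  have f_pow: "f (k ^ n) = f k [^] n" for k and n :: nat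
  proof (induct n)
    case 0
    then show ?case using f01 by simp
  next
    case (Suc n)
    have "f (k ^ Suc n) = f (k ^ n * k)" by (simp add: mult.commute)
    then show ?case using Suc f_mult by simp
  qed
  have Z: "generate_ring R {} = range f"
  proof
    show "generate_ring R {} \<subseteq> range f"
    proof
      fix h assume "h \<in> generate_ring R {}"
      then show "h \<in> range f"
      proof induct
        case one
        show ?case using f01(2) by (intro range_eqI[of _ _ 1]) simp
      next
        case (a_inv h)
        then obtain k where "h = f k" by blast
        then show ?case using f_neg by (intro range_eqI[of _ _ "- k"]) simp
      next
        case (eng_add h1 h2)
        then obtain k l where "h1 = f k" "h2 = f l" by blast
        then show ?case using f_add by (intro range_eqI[of _ _ "k + l"]) simp
      next
        case (eng_mult h1 h2)
        then obtain k l where "h1 = f k" "h2 = f l" by blast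
        then show ?case using f_mult by (intro range_eqI[of _ _ "k * l"]) simp
      qed simp
    qed
    have nat: "f (int n) \<in> generate_ring R {}" for n
    proof (induct n)
      case 0
      then show ?case using f01 zero_in_generate by simp
    next
      case (Suc n)
      have "f (int (Suc n)) = f (int n) \<oplus> \<one>" using f_add[of "int n" 1] f01 by (simp add: add.commute)
      then show ?case using generate_ring.eng_add[OF Suc generate_ring.one] by simp
    qed
    have "f k \<in> generate_ring R {}" for k
    proof (cases k rule: int_cases2)
      case (nonneg n)
      then show ?thesis using nat by simp
    next
      case (nonpos n)
      then show ?thesis using generate_ring.a_inv[OF nat[of n]] f_neg[of "int n"] by simp
    qed
    then show "range f \<subseteq> generate_ring R {}" by blast
  qed
  have "\<exists>m > 0. f m = \<zero>"
  proof (rule ccontr)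
    assume "\<not> (\<exists>m > 0. f m = \<zero>)"
    then have pos: "f m \<noteq> \<zero>" if "m > 0" for m using that by blast
    have inj: "k = l" if "f k = f l" for k l
    proof (rule ccontr)
      have z: "f (k - l) = \<zero>" "f (l - k) = \<zero>"
        using that f_add[of k "- l"] f_add[of l "- k"] f_neg fc by (auto simp: r_neg)
      assume "k \<noteq> l"
      then show False using z pos[of "k - l"] pos[of "l - k"] by linarith
    qed
    obtain e where e: "e \<in> range f - {\<zero>}"
      and div: "\<And>a. a \<in> range f - {\<zero>} \<Longrightarrow> \<exists>b \<in> range f. \<exists>n::nat. a \<otimes> b = e [^] n"
      using loc unfolding finite_localization_def Z by blast
    then obtain k where k: "e = f k" "k \<noteq> 0" using f01 by force
    have "f (\<bar>k\<bar> + 1) \<in> range f - {\<zero>}" using pos[of "\<bar>k\<bar> + 1"] by simp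
    then obtain l n where "f (\<bar>k\<bar> + 1) \<otimes> f l = e [^] (n::nat)" using div by blast
    then have "f ((\<bar>k\<bar> + 1) * l) = f (k ^ n)" unfolding f_mult f_pow k(1) .
    then have "(\<bar>k\<bar> + 1) * l = k ^ n" by (rule inj)
    then have "\<bar>k\<bar> + 1 dvd k ^ n" by (rule dvdI[OF sym])
    moreover have "coprime (\<bar>k\<bar> + 1) (k ^ n)"
    proof -
      have "coprime (\<bar>k\<bar> + 1) \<bar>k\<bar>" using coprime_add_one_left by blast
      then show ?thesis by simp
    qed
    ultimately have "is_unit (\<bar>k\<bar> + 1)" by (metis coprime_common_divisor dvd_refl)
    then show False using k(2) by auto
  qed
  then obtain m where m: "m > 0" "f m = \<zero>" by blast
  have "f k = f (k mod m)" for k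
  proof -
    have "f k = f (m * (k div m) + k mod m)" by simp
    then show ?thesis unfolding f_add f_mult m(2) using fc by simp
  qed
  moreover have "k mod m \<in> {0..<m}" for k using m(1) by simp
  ultimately have "range f \<subseteq> f ` {0..<m}" by blast
  then show ?thesis unfolding Z by (rule finite_subset) simp
qed

theorem (in field) finitely_generated_ring_finite:
  assumes S: "finite S" "S \<subseteq> carrier R" and gen: "generate_ring R S = carrier R"
  shows "finite (carrier R)"
proof -
  let ?A = "generate_ring R {}"
  have A: "subring ?A R" using generate_ring_is_subring[of "{}"] by simp
  have "generate_ring R S \<subseteq> generate_ring R (?A \<union> S)"
    using S subringE(1)[OF A] by (intro mono_generate_ring) auto
  then have gen': "generate_ring R (?A \<union> S) = carrier R"
    using gen generate_ring_incl[of "?A \<union> S"] S subringE(1)[OF A] by auto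
  have fd: "finite_dimension (fractions ?A) (carrier R)" using zariski_finite_dimension[OF S A gen'] .
  have finA: "finite ?A" using prime_subring_finite[OF artin_tate_finite_localization[OF A S gen' fd]] .
  have "fractions ?A \<subseteq> (\<lambda>(a, b). a \<otimes> inv b) ` (?A \<times> ?A)" unfolding fractions_def by auto
  then have finF: "finite (fractions ?A)" by (rule finite_subset) (simp add: finA)
  have F: "subfield (fractions ?A) R" using fractions_subfield[OF A] .
  obtain n where "dimension n (fractions ?A) (carrier R)" using fd by blast
  then obtain Us where Us: "set Us \<subseteq> carrier R" "Span (fractions ?A) Us = carrier R"
    using exists_base[OF F] by blast
  have "carrier R = (\<lambda>Ks. combine Ks Us) ` {Ks. set Ks \<subseteq> fractions ?A \<and> length Ks = length Us}"
    using Span_eq_combine_set_length_version[OF F Us(1)] Us(2) by auto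
  then show ?thesis using finite_imageI[OF finite_lists_length_eq[OF finF]] by simp
qed

section \<open>Residue rings of finitely generated principal ideal domains\<close>

text \<open>Induction along proper divisors, which is well founded in a principal ideal domain.\<close>
lemma (in principal_domain) factor_induct [consumes 1, case_names factor]:
  assumes "a \<in> carrier R - {\<zero>}"
    and step: "\<And>a. \<lbrakk>a \<in> carrier R - {\<zero>};
      \<And>q c. \<lbrakk>q \<in> carrier R - Units R; c \<in> carrier R - {\<zero>}; a = q \<otimes> c\<rbrakk> \<Longrightarrow> P c\<rbrakk> \<Longrightarrow> P a"
  shows "P a"
  using mult_of.division_wellfounded assms(1)
proof (induct a rule: wf_induct_rule)
  case (less a)
  show ?case
  proof (rule step[OF less(2)])
    fix q c assume q: "q \<in> carrier R - Units R" and c: "c \<in> carrier R - {\<zero>}" and a: "a = q \<otimes> c"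
    have cc: "c \<in> carrier R" and qc: "q \<in> carrier R" using c q by auto
    have "\<not> a divides c"
    proof
      assume "a divides c"
      then obtain y where y: "y \<in> carrier R" "c = a \<otimes> y" unfolding factor_def by blast
      have "(q \<otimes> y) \<otimes> c = a \<otimes> y" unfolding a using cc qc y(1) by algebra
      also have "\<dots> = \<one> \<otimes> c" unfolding l_one[OF cc] by (rule y(2)[symmetric])
      finally have e: "(q \<otimes> y) \<otimes> c = \<one> \<otimes> c" .
      have "q \<otimes> y = \<one>"
        using m_rcancel[of c "q \<otimes> y" \<one>, THEN iffD1, OF _ cc _ _ e] c qc y(1) by simp
      then have "q divides \<one>" unfolding factor_def using y(1) by (intro bexI[of _ y]) simp_all
      then show False using q divides_one[OF qc] by blast
    qed
    moreover have "c divides\<^bsub>mult_of R\<^esub> a"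
    proof -
      have "a = c \<otimes> q" unfolding a using m_comm[OF qc cc] .
      moreover have "q \<in> carrier (mult_of R)"
      proof -
        have "q \<noteq> \<zero>"
        proof
          assume "q = \<zero>"
          then have "a = \<zero>" using a l_null[OF cc] by (simp only:)
          then show False using less(2) by blast
        qed
        then show ?thesis using qc by simp
      qed
      ultimately show ?thesis unfolding factor_def mult_mult_of by blast
    qed
    ultimately have "properfactor (mult_of R) c a"
      using divides_mult_imp_divides[of R a c] unfolding properfactor_def by blast
    then have "(c, a) \<in> {(x, y). x \<in> carrier (mult_of R) \<and> y \<in> carrier (mult_of R) \<and>
        properfactor (mult_of R) x y}" using less(2) c by (simp only: carrier_mult_of) blast
    then show "P c" using less(1) c by blast
  qed
qed

lemma (in principal_domain) power_not_divides:
  assumes q: "q \<in> carrier R - Units R" and a: "a \<in> carrier R - {\<zero>}"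
  shows "\<exists>k::nat. \<not> q [^] k divides a"
  using a
proof (induct rule: factor_induct)
  case (factor a)
  show ?case
  proof (cases "q divides a")
    case False
    then show ?thesis using q by (intro exI[of _ 1]) simp
  next
    case True
    then obtain c where c: "c \<in> carrier R" "a = q \<otimes> c" unfolding factor_def by blast
    have qc: "q \<in> carrier R" using q by simp
    have "c \<noteq> \<zero>" using c(2) factor(1) qc by (metis Diff_iff r_null singletonI)
    then obtain k :: nat where k: "\<not> q [^] k divides c" using factor(2)[OF q _ c(2)] c by blast
    have "q \<noteq> \<zero>" using c factor(1) by (metis Diff_iff l_null singletonI)
    moreover have "q [^] Suc k = q \<otimes> q [^] k" using qc by (simp add: m_comm)
    ultimately have "\<not> q [^] Suc k divides a"
      using k mult_divides[OF _ c(1), of "q [^] k" q] qc unfolding c(2)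
      by (metis Diff_iff nat_pow_closed singletonD)
    then show ?thesis by blast
  qed
qed

lemma (in ring_hom_ring) generate_ring_img:
  assumes "A \<subseteq> carrier R" and "generate_ring R A = carrier R"
  shows "generate_ring S (h ` A) = h ` carrier R"
proof
  have hA: "h ` A \<subseteq> carrier S" using assms(1) by auto
  show "generate_ring S (h ` A) \<subseteq> h ` carrier R"
    using S.generate_ring_min_subring1[OF hA img_is_subring[OF R.carrier_is_subring]
        image_mono[OF assms(1)]] .
  have "h x \<in> generate_ring S (h ` A)" if "x \<in> generate_ring R A" for x
    using that
  proof induct
    case one
    then show ?case by (simp add: generate_ring.one)
  next
    case (incl x)
    then show ?case by (simp add: generate_ring.incl)
  next
    case (a_inv x)
    then show ?case
      using assms(2) generate_ring.a_inv[of "h x" S] by simp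
  next
    case (eng_add x y)
    then show ?case
      using assms(2) generate_ring.eng_add[of "h x" S _ "h y"] by simp
  next
    case (eng_mult x y)
    then show ?case
      using assms(2) generate_ring.eng_mult[of "h x" S _ "h y"] by simp
  qed
  then show "h ` carrier R \<subseteq> generate_ring S (h ` A)" using assms(2) by blast
qed

text \<open>Finiteness of \<open>R/aR\<close> is expressed by a finite set of representatives because it is used to reduce the
  coefficients of linear combinations.\<close>
definition finite_residues :: "('a, 'r) ring_scheme \<Rightarrow> 'a \<Rightarrow> bool"
  where "finite_residues R a \<longleftrightarrow>
    (\<exists>D. finite D \<and> D \<subseteq> carrier R \<and> (\<forall>x \<in> carrier R. \<exists>d \<in> D. \<exists>y \<in> carrier R. x = d \<oplus>\<^bsub>R\<^esub> a \<otimes>\<^bsub>R\<^esub> y))"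

text \<open>\<open>aR/abR\<close> is a quotient of \<open>R/bR\<close>: with \<open>d\<close> and \<open>e\<close> running through representatives modulo \<open>a\<close> and \<open>b\<close>, the
  elements \<open>d + ae\<close> represent \<open>R/abR\<close>.\<close>
lemma (in cring) finite_residues_mult:
  assumes "a \<in> carrier R" "b \<in> carrier R" "finite_residues R a" "finite_residues R b"
  shows "finite_residues R (a \<otimes> b)"
proof -
  obtain D where D: "finite D" "D \<subseteq> carrier R" 
    "\<And>x. x \<in> carrier R \<Longrightarrow> \<exists>d \<in> D. \<exists>y \<in> carrier R. x = d \<oplus> a \<otimes> y"
    using assms(3) unfolding finite_residues_def by blast
  obtain E where E: "finite E" "E \<subseteq> carrier R" 
    "\<And>x. x \<in> carrier R \<Longrightarrow> \<exists>e \<in> E. \<exists>y \<in> carrier R. x = e \<oplus> b \<otimes> y"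
    using assms(4) unfolding finite_residues_def by blast
  let ?F = "(\<lambda>(d, e). d \<oplus> a \<otimes> e) ` (D \<times> E)"
  have "\<exists>f \<in> ?F. \<exists>y \<in> carrier R. x = f \<oplus> (a \<otimes> b) \<otimes> y" if x: "x \<in> carrier R" for x
  proof -
    obtain d y where d: "d \<in> D" "y \<in> carrier R" "x = d \<oplus> a \<otimes> y" using D(3)[OF x] by blast
    obtain e z where e: "e \<in> E" "z \<in> carrier R" "y = e \<oplus> b \<otimes> z" using E(3)[OF d(2)] by blast
    have c: "d \<in> carrier R" "e \<in> carrier R" using d e D E by auto
    have "x = (d \<oplus> a \<otimes> e) \<oplus> (a \<otimes> b) \<otimes> z"
      unfolding d(3) e(3) using c e(2) assms(1,2) by algebra
    moreover have "d \<oplus> a \<otimes> e \<in> ?F" using d(1) e(1) by force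
    ultimately show ?thesis using e(2) by blast
  qed
  moreover have "finite ?F" using D(1) E(1) by simp
  moreover have "?F \<subseteq> carrier R" using D(2) E(2) assms(1) by auto
  ultimately show ?thesis unfolding finite_residues_def by blast
qed

lemma (in principal_domain) finite_residues_irreducible:
  assumes fg: "finitely_generated_ring R" and a: "a \<in> carrier R" "ring_irreducible a"
  shows "finite_residues R a"
proof -
  have a0: "a \<in> carrier R - {\<zero>}" using a ring_irreducibleE(1) by blast
  let ?I = "PIdl a"
  interpret I: ideal ?I R using cgenideal_ideal[OF a(1)] .
  interpret h: ring_hom_ring R "R Quot ?I" "(+>) ?I" using I.rcos_ring_hom_ring .
  interpret K: field "R Quot ?I"
    using field_iff_prime[OF a0] primeness_condition[OF a(1)] a(2) by simp
  obtain S where S: "finite S" "S \<subseteq> carrier R" "generate_ring R S = carrier R"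
    using fg unfolding finitely_generated_ring_def by blast
  have img: "((+>) ?I) ` carrier R = carrier (R Quot ?I)"
    unfolding FactRing_def A_RCOSETS_def' by auto
  have "finite (carrier (R Quot ?I))"
    using K.finitely_generated_ring_finite[of "((+>) ?I) ` S"] S(1)
      h.generate_ring_img[OF S(2,3)] image_mono[OF S(2), of "(+>) ?I"] img by auto
  then have "finite (((+>) ?I) ` carrier R)" using img by simp
  then obtain D where D: "D \<subseteq> carrier R" "finite D" "((+>) ?I) ` carrier R = ((+>) ?I) ` D"
    by (meson finite_subset_image subset_refl)
  have "\<exists>d \<in> D. \<exists>y \<in> carrier R. x = d \<oplus> a \<otimes> y" if x: "x \<in> carrier R" for x
  proof -
    obtain d where d: "d \<in> D" "?I +> x = ?I +> d" using D(3) x by blast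
    have dc: "d \<in> carrier R" using d D by blast
    have "x \<in> ?I +> d" using I.a_rcos_self[OF x] d(2) by simp
    then obtain i where i: "i \<in> ?I" "x = i \<oplus> d" unfolding a_r_coset_def' by blast
    then obtain y where y: "y \<in> carrier R" "i = y \<otimes> a" unfolding cgenideal_def by blast
    have "x = d \<oplus> a \<otimes> y" unfolding i(2) y(2) using y(1) a(1) dc by algebra
    then show ?thesis using d(1) y(1) by blast
  qed
  then show ?thesis unfolding finite_residues_def using D(1,2) by blast
qed

theorem (in principal_domain) finite_residues_nonzero:
  assumes fg: "finitely_generated_ring R" and a: "a \<in> carrier R - {\<zero>}"
  shows "finite_residues R a"
  using a
proof (induct rule: factor_induct)
  case (factor a)
  have ac: "a \<in> carrier R" using factor by simp
  show ?case
  proof (cases "a \<in> Units R")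
    case True
    have "x = \<zero> \<oplus> a \<otimes> (inv a \<otimes> x)" if "x \<in> carrier R" for x
      using that True by (simp add: m_assoc[symmetric] Units_closed)
    then show ?thesis
      unfolding finite_residues_def using True by (intro exI[of _ "{\<zero>}"]) (auto intro!: bexI)
  next
    case False
    obtain b where b: "b \<in> carrier R" "ring_irreducible b" "b divides a"
      using exists_irreducible_divisor[OF factor(1) False] by blast
    then obtain c where c: "c \<in> carrier R" "a = b \<otimes> c" unfolding factor_def by blast
    have "c \<noteq> \<zero>" using c(2) factor(1) b(1) by (metis Diff_iff r_null singletonI)
    moreover have "b \<in> carrier R - Units R" using b ring_irreducibleE(4)[OF b(1,2)] by blast
    ultimately have "finite_residues R c" using factor(2) c by blast
    then show ?thesis
      unfolding c(2) using finite_residues_mult finite_residues_irreducible[OF fg b(1,2)] b c by blast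
  qed
qed

lemma (in principal_domain) nonzero_nonunit_exists:
  assumes fg: "finitely_generated_ring R" and inf: "infinite (carrier R)"
  shows "\<exists>q \<in> carrier R - Units R. q \<noteq> \<zero>"
proof (rule ccontr)
  assume "\<not> ?thesis"
  moreover have "\<zero> \<notin> Units R" unfolding Units_def by auto
  ultimately have "Units R = carrier R - {\<zero>}" using Units_closed by blast
  then interpret field R by (rule cring_fieldI)
  show False using finitely_generated_ring_finite fg inf unfolding finitely_generated_ring_def by blast
qed

section \<open>Linear combinations and torsion\<close>

definition (in module) comb
  where "comb I x a = (\<Oplus>\<^bsub>M\<^esub>i\<in>I. a i \<odot>\<^bsub>M\<^esub> x i)"

lemma (in module) comb_closed [simp, intro]:
  assumes "x \<in> I \<rightarrow> carrier M" "a \<in> I \<rightarrow> carrier R"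
  shows "comb I x a \<in> carrier M"
  unfolding comb_def using assms by (intro M.finsum_closed) auto

lemma (in module) comb_cong:
  assumes "y \<in> I \<rightarrow> carrier M" "b \<in> I \<rightarrow> carrier R" "\<And>i. i \<in> I \<Longrightarrow> a i = b i" "\<And>i. i \<in> I \<Longrightarrow> x i = y i"
  shows "comb I x a = comb I y b"
  unfolding comb_def using assms by (intro M.finsum_cong') auto

lemma (in module) comb_add:
  assumes "x \<in> I \<rightarrow> carrier M" "a \<in> I \<rightarrow> carrier R" "b \<in> I \<rightarrow> carrier R"
  shows "comb I x a \<oplus>\<^bsub>M\<^esub> comb I x b = comb I x (\<lambda>i. a i \<oplus> b i)"
proof -
  have "comb I x (\<lambda>i. a i \<oplus> b i) = (\<Oplus>\<^bsub>M\<^esub>i\<in>I. a i \<odot>\<^bsub>M\<^esub> x i \<oplus>\<^bsub>M\<^esub> b i \<odot>\<^bsub>M\<^esub> x i)"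
    unfolding comb_def using assms by (intro M.finsum_cong') (auto simp: smult_l_distr Pi_def)
  also have "\<dots> = comb I x a \<oplus>\<^bsub>M\<^esub> comb I x b"
    unfolding comb_def using assms by (intro M.finsum_addf) auto
  finally show ?thesis ..
qed

lemma (in module) comb_smult:
  assumes "finite I" "x \<in> I \<rightarrow> carrier M" "a \<in> I \<rightarrow> carrier R" "r \<in> carrier R"
  shows "r \<odot>\<^bsub>M\<^esub> comb I x a = comb I x (\<lambda>i. r \<otimes> a i)"
proof -
  have "r \<odot>\<^bsub>M\<^esub> comb I x a = (\<Oplus>\<^bsub>M\<^esub>i\<in>I. r \<odot>\<^bsub>M\<^esub> (a i \<odot>\<^bsub>M\<^esub> x i))"
    unfolding comb_def using assms by (intro finsum_smult_ldistr) auto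
  also have "\<dots> = comb I x (\<lambda>i. r \<otimes> a i)"
    unfolding comb_def using assms by (intro M.finsum_cong') (auto simp: smult_assoc1 Pi_def)
  finally show ?thesis .
qed

lemma (in module) comb_zero:
  assumes "x \<in> I \<rightarrow> carrier M" shows "comb I x (\<lambda>i. \<zero>) = \<zero>\<^bsub>M\<^esub>"
  unfolding comb_def by (rule M.add.finprod_one_eqI) (rule smult_l_null[OF funcset_mem[OF assms]])

lemma (in module) comb_minus:
  assumes "finite I" "x \<in> I \<rightarrow> carrier M" "a \<in> I \<rightarrow> carrier R" "b \<in> I \<rightarrow> carrier R"
  shows "comb I x a \<ominus>\<^bsub>M\<^esub> comb I x b = comb I x (\<lambda>i. a i \<ominus> b i)"
proof -
  have 1: "\<ominus>\<^bsub>M\<^esub> comb I x b = (\<ominus> \<one>) \<odot>\<^bsub>M\<^esub> comb I x b"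
    using smult_l_minus[of \<one> "comb I x b"] assms by simp
  have "\<ominus>\<^bsub>M\<^esub> comb I x b = comb I x (\<lambda>i. \<ominus> b i)"
    unfolding 1 comb_smult[OF assms(1,2,4) R.a_inv_closed[OF R.one_closed]]
    using assms by (intro comb_cong) (auto simp: l_minus Pi_def)
  then show ?thesis
    unfolding a_minus_def using comb_add[of x I a "\<lambda>i. \<ominus> b i"] assms by auto
qed

lemma (in module) comb_split:
  assumes "finite I" "i \<in> I" "x \<in> I \<rightarrow> carrier M" "a \<in> I \<rightarrow> carrier R"
  shows "comb I x a = a i \<odot>\<^bsub>M\<^esub> x i \<oplus>\<^bsub>M\<^esub> comb (I - {i}) x a"
proof -
  have "comb (insert i (I - {i})) x a = a i \<odot>\<^bsub>M\<^esub> x i \<oplus>\<^bsub>M\<^esub> comb (I - {i}) x a"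
    unfolding comb_def using assms by (intro M.finsum_insert) auto
  then show ?thesis using assms(2) by (simp add: insert_absorb)
qed

lemma (in module) comb_unit:
  assumes "finite I" "i \<in> I" "x \<in> I \<rightarrow> carrier M"
  shows "comb I x (\<lambda>k. if k = i then \<one> else \<zero>) = x i"
proof -
  let ?e = "\<lambda>k. if k = i then \<one> else \<zero>"
  have "comb (I - {i}) x ?e = comb (I - {i}) x (\<lambda>k. \<zero>)"
    using assms by (intro comb_cong) auto
  also have "\<dots> = \<zero>\<^bsub>M\<^esub>" using assms by (intro comb_zero) auto
  finally show ?thesis
    using comb_split[OF assms, of ?e] assms by (auto simp: Pi_def)
qed

lemma (in module) submodule_zero:
  assumes "submodule U R M" shows "\<zero>\<^bsub>M\<^esub> \<in> U"
  using submoduleE(1,2,4)[OF assms] smult_l_null by force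

lemma (in module) submodule_comb:
  assumes U: "submodule U R M" and "finite I" "x \<in> I \<rightarrow> U" "a \<in> I \<rightarrow> carrier R"
  shows "comb I x a \<in> U"
  using assms(2-)
proof (induct I)
  case empty
  then show ?case unfolding comb_def using submodule_zero[OF U] by simp
next
  case (insert i I)
  have "U \<subseteq> carrier M" using submoduleE(1)[OF U] .
  then have "comb (insert i I) x a = a i \<odot>\<^bsub>M\<^esub> x i \<oplus>\<^bsub>M\<^esub> comb I x a"
    unfolding comb_def using insert by (intro M.finsum_insert) auto
  then show ?case using insert submoduleE(4,5)[OF U] by auto
qed

definition (in module) torsion
  where "torsion = {x \<in> carrier M. \<exists>a \<in> carrier R - {\<zero>}. a \<odot>\<^bsub>M\<^esub> x = \<zero>\<^bsub>M\<^esub>}"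

text \<open>The preimage in \<open>M\<close> of the span of the family in \<open>M/T\<close>. With \<open>T = 0\<close> this is the span itself; with \<open>T\<close> the
  torsion it allows a basis of \<open>M\<close> modulo torsion to be constructed without forming the quotient.\<close>
definition (in module) span_over
  where "span_over T I x = {comb I x a \<oplus>\<^bsub>M\<^esub> \<tau> | a \<tau>. a \<in> I \<rightarrow> carrier R \<and> \<tau> \<in> T}"

lemma (in module) span_over_submodule:
  assumes T: "submodule T R M" and fam: "finite I" "x \<in> I \<rightarrow> carrier M" shows "submodule (span_over T I x) R M"
proof (rule submoduleI)
  note tc = subsetD[OF submoduleE(1)[OF T]]
  show "span_over T I x \<subseteq> carrier M" unfolding span_over_def using fam tc by auto
  have "\<zero>\<^bsub>M\<^esub> = comb I x (\<lambda>i. \<zero>) \<oplus>\<^bsub>M\<^esub> \<zero>\<^bsub>M\<^esub>"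
    using comb_zero[OF fam(2)] by simp
  then show "\<zero>\<^bsub>M\<^esub> \<in> span_over T I x" unfolding span_over_def using submodule_zero[OF T] by blast
  have sm: "r \<odot>\<^bsub>M\<^esub> u \<in> span_over T I x" if u: "u \<in> span_over T I x" and r: "r \<in> carrier R" for u r
  proof -
    obtain a \<tau> where a: "a \<in> I \<rightarrow> carrier R" "\<tau> \<in> T" "u = comb I x a \<oplus>\<^bsub>M\<^esub> \<tau>"
      using u unfolding span_over_def by blast
    have "r \<odot>\<^bsub>M\<^esub> u = comb I x (\<lambda>i. r \<otimes> a i) \<oplus>\<^bsub>M\<^esub> r \<odot>\<^bsub>M\<^esub> \<tau>"
      unfolding a(3) comb_smult[OF fam a(1) r, symmetric]
      using smult_r_distr[OF r comb_closed[OF fam(2) a(1)]] tc[OF a(2)] by simp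
    moreover have "r \<odot>\<^bsub>M\<^esub> \<tau> \<in> T" using submoduleE(4)[OF T] r a(2) .
    moreover have "(\<lambda>i. r \<otimes> a i) \<in> I \<rightarrow> carrier R" using a(1) r by auto
    ultimately show ?thesis unfolding span_over_def by blast
  qed
  show "r \<odot>\<^bsub>M\<^esub> u \<in> span_over T I x" if "r \<in> carrier R" "u \<in> span_over T I x" for r u
    using sm[OF that(2,1)] .
  fix u assume u: "u \<in> span_over T I x"
  then have uc: "u \<in> carrier M" using \<open>span_over T I x \<subseteq> carrier M\<close> by blast
  show "\<ominus>\<^bsub>M\<^esub> u \<in> span_over T I x"
    using sm[OF u, of "\<ominus> \<one>"] smult_l_minus[OF one_closed uc] uc by simp
  fix v assume v: "v \<in> span_over T I x"
  obtain a \<tau> where a: "a \<in> I \<rightarrow> carrier R" "\<tau> \<in> T" "u = comb I x a \<oplus>\<^bsub>M\<^esub> \<tau>"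
    using u unfolding span_over_def by blast
  obtain b \<sigma> where b: "b \<in> I \<rightarrow> carrier R" "\<sigma> \<in> T" "v = comb I x b \<oplus>\<^bsub>M\<^esub> \<sigma>"
    using v unfolding span_over_def by blast
  have "u \<oplus>\<^bsub>M\<^esub> v = comb I x (\<lambda>i. a i \<oplus> b i) \<oplus>\<^bsub>M\<^esub> (\<tau> \<oplus>\<^bsub>M\<^esub> \<sigma>)"
    unfolding a(3) b(3) comb_add[OF fam(2) a(1) b(1), symmetric]
    using comb_closed[OF fam(2) a(1)] comb_closed[OF fam(2) b(1)] tc[OF a(2)] tc[OF b(2)]
    by (simp add: M.a_ac)
  moreover have "(\<lambda>i. a i \<oplus> b i) \<in> I \<rightarrow> carrier R" using a(1) b(1) by auto
  ultimately show "u \<oplus>\<^bsub>M\<^esub> v \<in> span_over T I x"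
    unfolding span_over_def using submoduleE(5)[OF T a(2) b(2)] by blast
qed

lemma (in module) span_over_incl:
  assumes T: "submodule T R M" and fam: "finite I" "x \<in> I \<rightarrow> carrier M"
  shows "x ` I \<subseteq> span_over T I x" "T \<subseteq> span_over T I x"
proof -
  have "x i \<in> span_over T I x" if i: "i \<in> I" for i
  proof -
    have "x i = comb I x (\<lambda>k. if k = i then \<one> else \<zero>) \<oplus>\<^bsub>M\<^esub> \<zero>\<^bsub>M\<^esub>"
      using comb_unit[OF fam(1) i fam(2)] funcset_mem[OF fam(2) i] by simp
    moreover have "(\<lambda>k. if k = i then \<one> else \<zero>) \<in> I \<rightarrow> carrier R" by auto
    ultimately show ?thesis unfolding span_over_def using submodule_zero[OF T] by blast
  qed
  then show "x ` I \<subseteq> span_over T I x" by blast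
  show "T \<subseteq> span_over T I x"
  proof
    fix \<tau> assume t: "\<tau> \<in> T"
    have "\<tau> = comb I x (\<lambda>i. \<zero>) \<oplus>\<^bsub>M\<^esub> \<tau>"
      using comb_zero[OF fam(2)] t submoduleE(1)[OF T] by auto
    moreover have "(\<lambda>i. \<zero>) \<in> I \<rightarrow> carrier R" by auto
    ultimately show "\<tau> \<in> span_over T I x" unfolding span_over_def using t by blast
  qed
qed

lemma (in module) span_over_minimal:
  assumes "submodule U R M" "finite I" "x ` I \<subseteq> U" "T \<subseteq> U"
  shows "span_over T I x \<subseteq> U"
proof
  fix u assume "u \<in> span_over T I x"
  then obtain a \<tau> where a: "a \<in> I \<rightarrow> carrier R" "\<tau> \<in> T" "u = comb I x a \<oplus>\<^bsub>M\<^esub> \<tau>"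
    unfolding span_over_def by blast
  have "comb I x a \<in> U" using submodule_comb[OF assms(1,2) _ a(1)] assms(3) by auto
  then show "u \<in> U" unfolding a(3) using submoduleE(5)[OF assms(1)] a(2) assms(4) by blast
qed


locale pid_module = principal_domain R + module R M for R (structure) and M (structure)

context pid_module
begin

lemma torsion_carrier: "torsion \<subseteq> carrier M" unfolding torsion_def by blast

lemma torsion_cancel:
  assumes "a \<in> carrier R - {\<zero>}" "x \<in> carrier M" "a \<odot>\<^bsub>M\<^esub> x \<in> torsion"
  shows "x \<in> torsion"
proof -
  obtain b where b: "b \<in> carrier R - {\<zero>}" "b \<odot>\<^bsub>M\<^esub> (a \<odot>\<^bsub>M\<^esub> x) = \<zero>\<^bsub>M\<^esub>"
    using assms(3) unfolding torsion_def by blast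
  have "b \<otimes> a \<in> carrier R - {\<zero>}" using b assms(1) integral[of b a] by auto
  moreover have "(b \<otimes> a) \<odot>\<^bsub>M\<^esub> x = \<zero>\<^bsub>M\<^esub>" using b assms smult_assoc1 by simp
  ultimately show ?thesis using assms(2) unfolding torsion_def by blast
qed

lemma torsion_submodule: "submodule torsion R M"
proof (rule submoduleI)
  show "torsion \<subseteq> carrier M" using torsion_carrier .
  have "\<one> \<in> carrier R - {\<zero>}" by simp
  then show "\<zero>\<^bsub>M\<^esub> \<in> torsion" unfolding torsion_def by force
  fix x assume "x \<in> torsion"
  then obtain a where x: "x \<in> carrier M" "a \<in> carrier R - {\<zero>}" "a \<odot>\<^bsub>M\<^esub> x = \<zero>\<^bsub>M\<^esub>"
    unfolding torsion_def by blast
  then have "a \<odot>\<^bsub>M\<^esub> (\<ominus>\<^bsub>M\<^esub> x) = \<zero>\<^bsub>M\<^esub>" by (simp add: smult_r_minus)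
  then show "\<ominus>\<^bsub>M\<^esub> x \<in> torsion" using x unfolding torsion_def by blast
  show "r \<odot>\<^bsub>M\<^esub> x \<in> torsion" if r: "r \<in> carrier R" for r
  proof -
    have "a \<odot>\<^bsub>M\<^esub> (r \<odot>\<^bsub>M\<^esub> x) = r \<odot>\<^bsub>M\<^esub> (a \<odot>\<^bsub>M\<^esub> x)"
      using x(1,2) r by (simp add: smult_assoc1[symmetric] m_comm)
    also have "\<dots> = \<zero>\<^bsub>M\<^esub>" using x(3) r by simp
    finally show ?thesis using x r unfolding torsion_def by auto
  qed
  fix y assume "y \<in> torsion"
  then obtain b where y: "y \<in> carrier M" "b \<in> carrier R - {\<zero>}" "b \<odot>\<^bsub>M\<^esub> y = \<zero>\<^bsub>M\<^esub>"
    unfolding torsion_def by blast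
  have nz: "b \<otimes> a \<in> carrier R - {\<zero>}" using x y integral[of b a] by auto
  have "(b \<otimes> a) \<odot>\<^bsub>M\<^esub> (x \<oplus>\<^bsub>M\<^esub> y) = b \<odot>\<^bsub>M\<^esub> (a \<odot>\<^bsub>M\<^esub> x) \<oplus>\<^bsub>M\<^esub> a \<odot>\<^bsub>M\<^esub> (b \<odot>\<^bsub>M\<^esub> y)"
    using x(1,2) y(1,2) by (simp add: smult_r_distr smult_assoc1[symmetric] m_comm)
  also have "\<dots> = \<zero>\<^bsub>M\<^esub>" using x y by simp
  finally show "x \<oplus>\<^bsub>M\<^esub> y \<in> torsion" using nz x y unfolding torsion_def by blast
qed

lemmas torsionE = submoduleE[OF torsion_submodule]

lemma smult_pair:
  assumes "{a, b, c, d, p, q} \<subseteq> carrier R" "x \<in> carrier M" "y \<in> carrier M"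
  shows "p \<odot>\<^bsub>M\<^esub> (a \<odot>\<^bsub>M\<^esub> x \<oplus>\<^bsub>M\<^esub> b \<odot>\<^bsub>M\<^esub> y) \<oplus>\<^bsub>M\<^esub> q \<odot>\<^bsub>M\<^esub> (c \<odot>\<^bsub>M\<^esub> x \<oplus>\<^bsub>M\<^esub> d \<odot>\<^bsub>M\<^esub> y) =
    (p \<otimes> a \<oplus> q \<otimes> c) \<odot>\<^bsub>M\<^esub> x \<oplus>\<^bsub>M\<^esub> (p \<otimes> b \<oplus> q \<otimes> d) \<odot>\<^bsub>M\<^esub> y"
  using assms by (simp add: smult_r_distr smult_l_distr smult_assoc1 M.a_ac)

text \<open>Two coefficients are divided by their greatest common divisor; the resulting coprime pair is the first row
  of a matrix of determinant \<open>1\<close>.\<close>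
lemma bezout_coprime:
  assumes a: "a \<in> carrier R - {\<zero>}" and b: "b \<in> carrier R"
  obtains g a' b' u v where "g \<in> carrier R - {\<zero>}" "{a', b', u, v} \<subseteq> carrier R"
    "a = g \<otimes> a'" "b = g \<otimes> b'" "u \<otimes> a' \<oplus> v \<otimes> b' = \<one>"
proof -
  have ac: "a \<in> carrier R" using a by simp
  obtain g where g: "g \<in> carrier R" "PIdl g = PIdl a <+>\<^bsub>R\<^esub> PIdl b"
    using exists_gen[OF add_ideals[OF cgenideal_ideal[OF ac] cgenideal_ideal[OF b]]] by metis
  have gcd: "g gcdof a b" using ideal_sum_iff_gcd[OF ac b g(1)] g(2) by simp
  then obtain a' b' where a': "a' \<in> carrier R" "a = g \<otimes> a'" and b': "b' \<in> carrier R" "b = g \<otimes> b'"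
    unfolding isgcd_def factor_def by blast
  have gnz: "g \<noteq> \<zero>" using a a' by auto
  have "g \<in> PIdl a <+>\<^bsub>R\<^esub> PIdl b" using cgenideal_self[OF g(1)] g(2) by simp
  then obtain u v where uv: "u \<in> carrier R" "v \<in> carrier R" "g = u \<otimes> a \<oplus> v \<otimes> b"
    unfolding set_add_def' cgenideal_def by blast
  have "g \<otimes> (u \<otimes> a' \<oplus> v \<otimes> b') = u \<otimes> (g \<otimes> a') \<oplus> v \<otimes> (g \<otimes> b')"
    using g(1) uv(1,2) a'(1) b'(1) by algebra
  also have "\<dots> = g" unfolding a'(2)[symmetric] b'(2)[symmetric] by (rule uv(3)[symmetric])
  also have "\<dots> = g \<otimes> \<one>" using g(1) by simp
  finally have "u \<otimes> a' \<oplus> v \<otimes> b' = \<one>"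
    using m_lcancel[OF gnz g(1)] uv(1,2) a'(1) b'(1) by auto
  then show thesis using that[of g a' b' u v] g(1) gnz a' b' uv(1,2) by simp
qed

text \<open>The pair \<open>(x\<^sub>i, x\<^sub>j)\<close> is transformed by the matrix with rows \<open>(b, c)\<close> and \<open>(-v, u)\<close>, whose determinant
  is \<open>1\<close>, so the inverse matrix recovers the old pair.\<close>
lemma span_over_torsion_transvection:
  assumes I: "finite I" "i \<in> I" "j \<in> I" "i \<noteq> j" and x: "x \<in> I \<rightarrow> carrier M"
    and R: "{b, c, u, v} \<subseteq> carrier R" and unit: "u \<otimes> b \<oplus> v \<otimes> c = \<one>"
    and gen: "span_over torsion I x = carrier M"
    and y_def: "y = x(i := b \<odot>\<^bsub>M\<^esub> x i \<oplus>\<^bsub>M\<^esub> c \<odot>\<^bsub>M\<^esub> x j, j := (\<ominus> v) \<odot>\<^bsub>M\<^esub> x i \<oplus>\<^bsub>M\<^esub> u \<odot>\<^bsub>M\<^esub> x j)"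
  shows "y \<in> I \<rightarrow> carrier M" "span_over torsion I y = carrier M"
proof -
  have xc: "x i \<in> carrier M" "x j \<in> carrier M" using x I by auto
  have c: "b \<in> carrier R" "c \<in> carrier R" "u \<in> carrier R" "v \<in> carrier R" using R by auto
  show y: "y \<in> I \<rightarrow> carrier M" unfolding y_def using x xc c by (auto simp: Pi_def)
  let ?W = "span_over torsion I y"
  have W: "submodule ?W R M" using span_over_submodule[OF torsion_submodule I(1) y] .
  note inc = span_over_incl[OF torsion_submodule I(1) y]
  have yW: "y i \<in> ?W" "y j \<in> ?W" using inc I by auto
  have yij: "y i = b \<odot>\<^bsub>M\<^esub> x i \<oplus>\<^bsub>M\<^esub> c \<odot>\<^bsub>M\<^esub> x j" "y j = (\<ominus> v) \<odot>\<^bsub>M\<^esub> x i \<oplus>\<^bsub>M\<^esub> u \<odot>\<^bsub>M\<^esub> x j"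
    unfolding y_def using I(4) by auto
  have "u \<odot>\<^bsub>M\<^esub> y i \<oplus>\<^bsub>M\<^esub> (\<ominus> c) \<odot>\<^bsub>M\<^esub> y j = x i"
  proof -
    have e: "u \<otimes> b \<oplus> (\<ominus> c) \<otimes> (\<ominus> v) = \<one>" "u \<otimes> c \<oplus> (\<ominus> c) \<otimes> u = \<zero>"
      using unit c by (algebra, algebra)
    show ?thesis unfolding yij
      using smult_pair[of b c "\<ominus> v" u u "\<ominus> c" "x i" "x j"] c xc e by simp
  qed
  then have xi: "x i \<in> ?W" using submoduleE(5)[OF W submoduleE(4)[OF W _ yW(1), of u] submoduleE(4)[OF W _ yW(2), of "\<ominus> c"]] c
    by simp
  have "v \<odot>\<^bsub>M\<^esub> y i \<oplus>\<^bsub>M\<^esub> b \<odot>\<^bsub>M\<^esub> y j = x j"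
  proof -
    have e: "v \<otimes> b \<oplus> b \<otimes> (\<ominus> v) = \<zero>" "v \<otimes> c \<oplus> b \<otimes> u = \<one>"
      using unit c by (algebra, algebra)
    show ?thesis unfolding yij
      using smult_pair[of b c "\<ominus> v" u v b "x i" "x j"] c xc e by simp
  qed
  then have xj: "x j \<in> ?W"
    using submoduleE(5)[OF W submoduleE(4)[OF W _ yW(1)] submoduleE(4)[OF W _ yW(2)]] c by metis
  have "x k \<in> ?W" if k: "k \<in> I" for k
  proof (cases "k = i \<or> k = j")
    case True
    then show ?thesis using xi xj by auto
  next
    case False
    then have "y k = x k" unfolding y_def by simp
    then show ?thesis using inc(1) k by (metis imageI subsetD)
  qed
  then have "carrier M \<subseteq> ?W" using span_over_minimal[OF W I(1), of x] inc(2) gen by blast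
  then show "?W = carrier M" using submoduleE(1)[OF W] by blast
qed

lemma span_over_torsion_drop:
  assumes I: "finite I" "i \<in> I" and x: "x \<in> I \<rightarrow> carrier M" and t: "x i \<in> torsion"
    and gen: "span_over torsion I x = carrier M"
  shows "span_over torsion (I - {i}) x = carrier M"
proof -
  have x': "x \<in> I - {i} \<rightarrow> carrier M" using x by auto
  have f: "finite (I - {i})" using I by simp
  let ?W = "span_over torsion (I - {i}) x"
  have W: "submodule ?W R M" using span_over_submodule[OF torsion_submodule f x'] .
  note inc = span_over_incl[OF torsion_submodule f x']
  have "x ` I \<subseteq> ?W" using inc t by blast
  then show ?thesis using span_over_minimal[OF W I(1)] inc(2) gen submoduleE(1)[OF W] by blast
qed

text \<open>A family of least size that generates \<open>M\<close> modulo torsion is independent modulo torsion. In a nontrivial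
  relation two nonzero coefficients can be replaced by their greatest common divisor and \<open>0\<close> after a
  change of generators. Repeating this leaves a relation with one nonzero coefficient; its generator is
  torsion and can be dropped, against minimality.\<close>
lemma minimal_family_independent:
  fixes I :: "nat set"
  assumes I: "finite I"
    and min: "\<And>J y. \<lbrakk>finite J; y \<in> J \<rightarrow> carrier M; span_over torsion J y = carrier M\<rbrakk> \<Longrightarrow> card I \<le> card (J :: nat set)"
    and "x \<in> I \<rightarrow> carrier M" "span_over torsion I x = carrier M"
    and "a \<in> I \<rightarrow> carrier R" "comb I x a \<in> torsion"
  shows "\<forall>i \<in> I. a i = \<zero>"
  using assms(3-)
proof (induct "card {i \<in> I. a i \<noteq> \<zero>}" arbitrary: x a rule: less_induct)
  case less
  note x = less(2) and gen = less(3) and a = less(4) and tor = less(5)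
  show ?case
  proof (rule ccontr)
    assume "\<not> (\<forall>i\<in>I. a i = \<zero>)"
    then obtain i where i: "i \<in> I" "a i \<noteq> \<zero>" by blast
    have ai: "a i \<in> carrier R - {\<zero>}" using i a by auto
    have xi: "x i \<in> carrier M" using i x by auto
    show False
    proof (cases "\<forall>j \<in> I - {i}. a j = \<zero>")
      case True
      have "comb (I - {i}) x a = comb (I - {i}) x (\<lambda>k. \<zero>)"
        using x True by (intro comb_cong) auto
      also have "\<dots> = \<zero>\<^bsub>M\<^esub>" using x by (intro comb_zero) auto
      finally have "comb I x a = a i \<odot>\<^bsub>M\<^esub> x i"
        using comb_split[OF I i(1) x a] ai xi by simp
      then have "x i \<in> torsion" using torsion_cancel[OF ai xi] tor by simp
      then have "span_over torsion (I - {i}) x = carrier M" using span_over_torsion_drop[OF I i(1) x _ gen] by blast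
      moreover have "x \<in> I - {i} \<rightarrow> carrier M" using x by auto
      ultimately have "card I \<le> card (I - {i})" using min I by blast
      then show False using card_Diff1_less[OF I i(1)] by simp
    next
      case False
      then obtain j where j: "j \<in> I" "j \<noteq> i" "a j \<noteq> \<zero>" by blast
      have aj: "a j \<in> carrier R" and xj: "x j \<in> carrier M" using j a x by auto
      obtain g b c u v where g: "g \<in> carrier R - {\<zero>}" and R: "{b, c, u, v} \<subseteq> carrier R"
        and e: "a i = g \<otimes> b" "a j = g \<otimes> c" "u \<otimes> b \<oplus> v \<otimes> c = \<one>"
        using bezout_coprime[OF ai aj] .
      define y where "y = x(i := b \<odot>\<^bsub>M\<^esub> x i \<oplus>\<^bsub>M\<^esub> c \<odot>\<^bsub>M\<^esub> x j, j := (\<ominus> v) \<odot>\<^bsub>M\<^esub> x i \<oplus>\<^bsub>M\<^esub> u \<odot>\<^bsub>M\<^esub> x j)"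
      note y = span_over_torsion_transvection[OF I i(1) j(1) not_sym[OF j(2)] x R e(3) gen y_def]
      define a' where "a' = a(i := g, j := \<zero>)"
      have a': "a' \<in> I \<rightarrow> carrier R" unfolding a'_def using a g by (auto simp: Pi_def)
      have "{k \<in> I. a' k \<noteq> \<zero>} \<subset> {k \<in> I. a k \<noteq> \<zero>}"
        unfolding a'_def using i j by auto
      then have less': "card {k \<in> I. a' k \<noteq> \<zero>} < card {k \<in> I. a k \<noteq> \<zero>}"
        using I by (intro psubset_card_mono) auto
      have Ij: "finite (I - {i})" "j \<in> I - {i}" using I j by auto
      have restr: "a \<in> I - {i} \<rightarrow> carrier R" "x \<in> I - {i} \<rightarrow> carrier M" "a' \<in> I - {i} \<rightarrow> carrier R" "y \<in> I - {i} \<rightarrow> carrier M"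
        using a x a' y(1) by auto
      let ?J = "I - {i} - {j}"
      have J: "comb ?J x a \<in> carrier M" using a x by (intro comb_closed) auto
      have same: "comb ?J y a' = comb ?J x a"
        using x a unfolding y_def a'_def by (intro comb_cong) auto
      have bc: "b \<in> carrier R" "c \<in> carrier R" "g \<in> carrier R" using R g by auto
      have yj: "y j \<in> carrier M" using y(1) j by auto
      have "comb I y a' = g \<odot>\<^bsub>M\<^esub> y i \<oplus>\<^bsub>M\<^esub> (\<zero> \<odot>\<^bsub>M\<^esub> y j \<oplus>\<^bsub>M\<^esub> comb ?J x a)"
        unfolding comb_split[OF I i(1) y(1) a'] comb_split[OF Ij restr(4,3)] same
        using j(2) unfolding a'_def by simp
      also have "\<dots> = g \<odot>\<^bsub>M\<^esub> (b \<odot>\<^bsub>M\<^esub> x i \<oplus>\<^bsub>M\<^esub> c \<odot>\<^bsub>M\<^esub> x j) \<oplus>\<^bsub>M\<^esub> comb ?J x a"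
        using yj J j(2) unfolding y_def by simp
      also have "\<dots> = a i \<odot>\<^bsub>M\<^esub> x i \<oplus>\<^bsub>M\<^esub> (a j \<odot>\<^bsub>M\<^esub> x j \<oplus>\<^bsub>M\<^esub> comb ?J x a)"
        unfolding e(1,2) using bc xi xj J by (simp add: smult_r_distr smult_assoc1 M.a_assoc)
      also have "\<dots> = comb I x a"
        unfolding comb_split[OF I i(1) x a] comb_split[OF Ij restr(2,1)] ..
      finally have "comb I y a' \<in> torsion" using tor by simp
      then have "\<forall>k\<in>I. a' k = \<zero>" using less(1)[OF less' y a'] by blast
      then show False using i(1) j(2) g unfolding a'_def by auto
    qed
  qed
qed

end

section \<open>Cosets and the profinite completion\<close>

context module
begin

lemma submodule_abelian_subgroup:
  assumes "submodule U R M" shows "abelian_subgroup U M"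
  using assms M.abelian_group_axioms
  by (intro abelian_subgroupI3 additive_subgroup.intro) (auto simp: submodule_def)

lemma coset_eq_iff:
  assumes U: "submodule U R M" and x: "x \<in> carrier M" and y: "y \<in> carrier M"
  shows "U +>\<^bsub>M\<^esub> x = U +>\<^bsub>M\<^esub> y \<longleftrightarrow> x \<ominus>\<^bsub>M\<^esub> y \<in> U"
proof -
  interpret U: abelian_subgroup U M using submodule_abelian_subgroup[OF U] .
  have "U +>\<^bsub>M\<^esub> x = U +>\<^bsub>M\<^esub> y \<longleftrightarrow> x \<in> U +>\<^bsub>M\<^esub> y"
    using U.a_repr_independence'[OF _ y] U.a_rcos_self[OF x] by blast
  also have "\<dots> \<longleftrightarrow> x \<ominus>\<^bsub>M\<^esub> y \<in> U" using U.a_rcos_module[OF y x] unfolding a_minus_def .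
  finally show ?thesis .
qed

lemma coset_zero:
  assumes U: "submodule U R M" shows "U +>\<^bsub>M\<^esub> \<zero>\<^bsub>M\<^esub> = U"
  using abelian_subgroup.a_rcos_const[OF submodule_abelian_subgroup[OF U]]
    M.a_coset_add_zero submoduleE(1)[OF U] by metis

lemma coset_self:
  assumes U: "submodule U R M" and x: "x \<in> carrier M" shows "x \<in> U +>\<^bsub>M\<^esub> x"
  using abelian_subgroup.a_rcos_self[OF submodule_abelian_subgroup[OF U] x] .

lemma coset_sum:
  assumes U: "submodule U R M" and x: "x \<in> carrier M" and y: "y \<in> carrier M"
  shows "(U +>\<^bsub>M\<^esub> x) <+>\<^bsub>M\<^esub> (U +>\<^bsub>M\<^esub> y) = U +>\<^bsub>M\<^esub> (x \<oplus>\<^bsub>M\<^esub> y)"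
  using abelian_subgroup.a_rcos_sum[OF submodule_abelian_subgroup[OF U] x y] .

lemma coset_elem:
  assumes U: "submodule U R M" and x: "x \<in> carrier M" and z: "z \<in> U +>\<^bsub>M\<^esub> x"
  shows "z \<in> carrier M" "U +>\<^bsub>M\<^esub> z = U +>\<^bsub>M\<^esub> x"
proof -
  interpret U: abelian_subgroup U M using submodule_abelian_subgroup[OF U] .
  show "z \<in> carrier M" using U.a_elemrcos_carrier[OF x z] .
  show "U +>\<^bsub>M\<^esub> z = U +>\<^bsub>M\<^esub> x" using U.a_repr_independence'[OF z x] ..
qed

lemma smult_minus:
  assumes "a \<in> carrier R" "x \<in> carrier M" "y \<in> carrier M"
  shows "a \<odot>\<^bsub>M\<^esub> (x \<ominus>\<^bsub>M\<^esub> y) = a \<odot>\<^bsub>M\<^esub> x \<ominus>\<^bsub>M\<^esub> a \<odot>\<^bsub>M\<^esub> y"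
  unfolding a_minus_def using assms by (simp add: smult_r_distr smult_r_minus)

lemma coset_smult:
  assumes U: "submodule U R M" and x: "x \<in> carrier M" and a: "a \<in> carrier R"
  shows "(\<Union>z\<in>U +>\<^bsub>M\<^esub> x. U +>\<^bsub>M\<^esub> (a \<odot>\<^bsub>M\<^esub> z)) = U +>\<^bsub>M\<^esub> (a \<odot>\<^bsub>M\<^esub> x)"
proof -
  have "U +>\<^bsub>M\<^esub> (a \<odot>\<^bsub>M\<^esub> z) = U +>\<^bsub>M\<^esub> (a \<odot>\<^bsub>M\<^esub> x)" if z: "z \<in> U +>\<^bsub>M\<^esub> x" for z
  proof -
    note zc = coset_elem[OF U x z]
    have "z \<ominus>\<^bsub>M\<^esub> x \<in> U" using zc coset_eq_iff[OF U zc(1) x] by simp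
    then have "a \<odot>\<^bsub>M\<^esub> z \<ominus>\<^bsub>M\<^esub> a \<odot>\<^bsub>M\<^esub> x \<in> U"
      using submoduleE(4)[OF U a] smult_minus[OF a zc(1) x] by metis
    then show ?thesis using coset_eq_iff[OF U] zc(1) x a by simp
  qed
  then show ?thesis using coset_self[OF U x] by blast
qed

lemma quotient_carrier: "carrier (quotient_module M U) = (\<lambda>x. U +>\<^bsub>M\<^esub> x) ` carrier M"
  unfolding quotient_module_def using A_RCOSETS_def'[of M U] by auto

lemma quotient_smult:
  assumes U: "submodule U R M" and x: "x \<in> carrier M" and a: "a \<in> carrier R"
  shows "a \<odot>\<^bsub>quotient_module M U\<^esub> (U +>\<^bsub>M\<^esub> x) = U +>\<^bsub>M\<^esub> (a \<odot>\<^bsub>M\<^esub> x)"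
  using coset_smult[OF assms] unfolding quotient_module_def by simp

lemma coset_enlarge:
  assumes U: "submodule U R M" and V: "submodule V R M" and UV: "U \<subseteq> V" and x: "x \<in> carrier M"
  shows "V <+>\<^bsub>M\<^esub> (U +>\<^bsub>M\<^esub> x) = V +>\<^bsub>M\<^esub> x"
proof
  interpret V: abelian_subgroup V M using submodule_abelian_subgroup[OF V] .
  note VE = submoduleE[OF V]
  have Vc: "v \<in> carrier M" if "v \<in> V" for v using that VE(1) by blast
  show "V <+>\<^bsub>M\<^esub> (U +>\<^bsub>M\<^esub> x) \<subseteq> V +>\<^bsub>M\<^esub> x"
  proof
    fix z assume "z \<in> V <+>\<^bsub>M\<^esub> (U +>\<^bsub>M\<^esub> x)"
    then obtain v u where z: "v \<in> V" "u \<in> U" "z = v \<oplus>\<^bsub>M\<^esub> (u \<oplus>\<^bsub>M\<^esub> x)"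
      unfolding set_add_def' a_r_coset_def' by blast
    then have "z = (v \<oplus>\<^bsub>M\<^esub> u) \<oplus>\<^bsub>M\<^esub> x" using Vc UV x by (simp add: M.a_assoc subset_eq)
    moreover have "v \<oplus>\<^bsub>M\<^esub> u \<in> V" using VE(5) z UV by blast
    ultimately show "z \<in> V +>\<^bsub>M\<^esub> x" unfolding a_r_coset_def' by blast
  qed
  show "V +>\<^bsub>M\<^esub> x \<subseteq> V <+>\<^bsub>M\<^esub> (U +>\<^bsub>M\<^esub> x)"
    using coset_self[OF U x] unfolding set_add_def' a_r_coset_def' by blast
qed

lemma cofinite_iff:
  "U \<in> cofinite_submodules R M \<longleftrightarrow> submodule U R M \<and> finite ((\<lambda>x. U +>\<^bsub>M\<^esub> x) ` carrier M)"
  unfolding cofinite_submodules_def quotient_carrier by simp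

lemma cofinite_inter:
  assumes "U \<in> cofinite_submodules R M" "V \<in> cofinite_submodules R M"
  shows "U \<inter> V \<in> cofinite_submodules R M"
proof -
  have U: "submodule U R M" and V: "submodule V R M" using assms cofinite_iff by auto
  have UV: "submodule (U \<inter> V) R M"
    using submoduleE[OF U] submoduleE[OF V] submodule.axioms(1)[OF U] submodule.axioms(1)[OF V]
    by (intro submoduleI) (auto dest: subgroup.one_closed)
  let ?f = "\<lambda>x. (U +>\<^bsub>M\<^esub> x, V +>\<^bsub>M\<^esub> x)"
  have "finite (?f ` carrier M)"
    by (rule finite_subset[of _ "((\<lambda>x. U +>\<^bsub>M\<^esub> x) ` carrier M) \<times> ((\<lambda>x. V +>\<^bsub>M\<^esub> x) ` carrier M)"])
      (use assms cofinite_iff in auto)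
  then obtain D where D: "D \<subseteq> carrier M" "finite D" "?f ` carrier M = ?f ` D"
    by (meson finite_subset_image subset_refl)
  have "(U \<inter> V) +>\<^bsub>M\<^esub> x \<in> (\<lambda>x. (U \<inter> V) +>\<^bsub>M\<^esub> x) ` D" if x: "x \<in> carrier M" for x
  proof -
    have "?f x \<in> ?f ` D" using x D(3) by blast
    then obtain d where d: "d \<in> D" "U +>\<^bsub>M\<^esub> x = U +>\<^bsub>M\<^esub> d" "V +>\<^bsub>M\<^esub> x = V +>\<^bsub>M\<^esub> d" by auto
    then have "(U \<inter> V) +>\<^bsub>M\<^esub> x = (U \<inter> V) +>\<^bsub>M\<^esub> d"
    proof -
      have dc: "d \<in> carrier M" using d(1) D(1) by blast
      show ?thesis
        using d(2,3) unfolding coset_eq_iff[OF U x dc] coset_eq_iff[OF V x dc] coset_eq_iff[OF UV x dc]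
        by blast
    qed
    then show ?thesis using d(1) by blast
  qed
  then have "(\<lambda>x. (U \<inter> V) +>\<^bsub>M\<^esub> x) ` carrier M \<subseteq> (\<lambda>x. (U \<inter> V) +>\<^bsub>M\<^esub> x) ` D"
    by (rule image_subsetI)
  then have "finite ((\<lambda>x. (U \<inter> V) +>\<^bsub>M\<^esub> x) ` carrier M)"
    using finite_imageI[OF D(2)] by (rule finite_subset)
  then show ?thesis using UV unfolding cofinite_iff by simp
qed

lemma cofinite_carrier: "carrier M \<in> cofinite_submodules R M"
proof -
  have "(\<lambda>x. carrier M +>\<^bsub>M\<^esub> x) ` carrier M \<subseteq> {carrier M +>\<^bsub>M\<^esub> \<zero>\<^bsub>M\<^esub>}"
    using coset_eq_iff[OF carrier_is_submodule _ M.zero_closed] by (blast intro: M.minus_closed)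
  then have "finite ((\<lambda>x. carrier M +>\<^bsub>M\<^esub> x) ` carrier M)" by (rule finite_subset) simp
  then show ?thesis using carrier_is_submodule unfolding cofinite_iff by simp
qed

lemma cofinite_Inter:
  assumes "finite F" "F \<subseteq> cofinite_submodules R M"
  shows "\<exists>V \<in> cofinite_submodules R M. \<forall>U \<in> F. V \<subseteq> U"
  using assms
proof (induct F)
  case empty
  then show ?case using cofinite_carrier by blast
next
  case (insert U F)
  then obtain V where "V \<in> cofinite_submodules R M" "\<forall>U \<in> F. V \<subseteq> U" by auto
  then have "V \<inter> U \<in> cofinite_submodules R M" "\<forall>W \<in> insert U F. V \<inter> U \<subseteq> W"
    using cofinite_inter insert by auto
  then show ?case by blast
qed

abbreviation "completion \<equiv> profinite_completion R M"
abbreviation "cofinites \<equiv> cofinite_submodules R M"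

lemma cofinite_submodule: "U \<in> cofinites \<Longrightarrow> submodule U R M" using cofinite_iff by blast

text \<open>Elements of the completion are given by representatives \<open>f U\<close> of their components; compatibility is then a
  condition on cosets in \<open>M\<close>.\<close>
lemma completion_memI:
  assumes "\<And>U. U \<in> cofinites \<Longrightarrow> f U \<in> carrier M"
    and "\<And>U V. \<lbrakk>U \<in> cofinites; V \<in> cofinites; U \<subseteq> V\<rbrakk> \<Longrightarrow> V +>\<^bsub>M\<^esub> f U = V +>\<^bsub>M\<^esub> f V"
  shows "(\<lambda>U\<in>cofinites. U +>\<^bsub>M\<^esub> f U) \<in> carrier completion"
proof -
  let ?z = "\<lambda>U\<in>cofinites. U +>\<^bsub>M\<^esub> f U"
  have "?z \<in> (\<Pi>\<^sub>E U \<in> cofinites. carrier (quotient_module M U))"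
    unfolding quotient_carrier using assms(1) by auto
  moreover have "V <+>\<^bsub>M\<^esub> ?z U = ?z V" if UV: "U \<in> cofinites" "V \<in> cofinites" "U \<subseteq> V" for U V
  proof -
    have "V <+>\<^bsub>M\<^esub> ?z U = V <+>\<^bsub>M\<^esub> (U +>\<^bsub>M\<^esub> f U)" using UV(1) by simp
    also have "\<dots> = V +>\<^bsub>M\<^esub> f U"
      using coset_enlarge[OF cofinite_submodule[OF UV(1)] cofinite_submodule[OF UV(2)] UV(3)]
        assms(1)[OF UV(1)] by blast
    also have "\<dots> = ?z V" unfolding assms(2)[OF UV] using UV(2) by simp
    finally show ?thesis .
  qed
  ultimately show ?thesis unfolding profinite_completion_def by simp
qed

lemma completion_rep:
  assumes z: "z \<in> carrier completion" and U: "U \<in> cofinites"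
  obtains m where "m \<in> carrier M"
    "\<And>V. \<lbrakk>V \<in> cofinites; U \<subseteq> V\<rbrakk> \<Longrightarrow> z V = V +>\<^bsub>M\<^esub> m"
proof -
  have z1: "z U \<in> (\<lambda>x. U +>\<^bsub>M\<^esub> x) ` carrier M"
    using z U unfolding profinite_completion_def quotient_carrier by auto
  have z2: "V <+>\<^bsub>M\<^esub> z U = z V" if "V \<in> cofinites" "U \<subseteq> V" for V
    using z U that unfolding profinite_completion_def by auto
  obtain m where m: "m \<in> carrier M" "z U = U +>\<^bsub>M\<^esub> m" using z1 by blast
  have "z V = V +>\<^bsub>M\<^esub> m" if V: "V \<in> cofinites" "U \<subseteq> V" for V
    using z2[OF V] m coset_enlarge[OF cofinite_submodule[OF U] cofinite_submodule[OF V(1)] V(2)]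
    by simp
  then show thesis using that m(1) by blast
qed

lemma completion_reps:
  assumes z: "z \<in> carrier completion"
  obtains f where "\<And>U. U \<in> cofinites \<Longrightarrow> f U \<in> carrier M"
    "\<And>U V. \<lbrakk>U \<in> cofinites; V \<in> cofinites; U \<subseteq> V\<rbrakk> \<Longrightarrow> z V = V +>\<^bsub>M\<^esub> f U"
proof -
  have "\<forall>U\<in>cofinites. \<exists>m. m \<in> carrier M \<and> (\<forall>V\<in>cofinites. U \<subseteq> V \<longrightarrow> z V = V +>\<^bsub>M\<^esub> m)"
    using completion_rep[OF z] by metis
  from bchoice[OF this] obtain f where
    f: "\<And>U. U \<in> cofinites \<Longrightarrow> f U \<in> carrier M"
      "\<And>U V. \<lbrakk>U \<in> cofinites; V \<in> cofinites; U \<subseteq> V\<rbrakk> \<Longrightarrow> z V = V +>\<^bsub>M\<^esub> f U" by blast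
  show thesis by (rule that[OF f])
qed

lemma completion_undefined:
  assumes "z \<in> carrier completion" "U \<notin> cofinites" shows "z U = undefined"
  using assms unfolding profinite_completion_def by auto

lemma completion_eqI:
  assumes "z \<in> carrier completion" "w \<in> carrier completion" "\<And>U. U \<in> cofinites \<Longrightarrow> z U = w U"
  shows "z = w"
proof
  fix U
  show "z U = w U"
    using assms(3) completion_undefined[OF assms(1)] completion_undefined[OF assms(2)]
    by (cases "U \<in> cofinites") auto
qed

lemma completion_add: "z \<oplus>\<^bsub>completion\<^esub> w = (\<lambda>U\<in>cofinites. z U <+>\<^bsub>M\<^esub> w U)"
  unfolding profinite_completion_def quotient_module_def by simp

lemma completion_smult:
  "a \<odot>\<^bsub>completion\<^esub> z = (\<lambda>U\<in>cofinites. a \<odot>\<^bsub>quotient_module M U\<^esub> z U)"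
  unfolding profinite_completion_def by simp

lemma completion_add_closed:
  assumes z: "z \<in> carrier completion" and w: "w \<in> carrier completion"
  shows "z \<oplus>\<^bsub>completion\<^esub> w \<in> carrier completion"
proof -
  obtain f where f: "\<And>U. U \<in> cofinites \<Longrightarrow> f U \<in> carrier M"
      "\<And>U V. \<lbrakk>U \<in> cofinites; V \<in> cofinites; U \<subseteq> V\<rbrakk> \<Longrightarrow> z V = V +>\<^bsub>M\<^esub> f U"
    using completion_reps[OF z] by blast
  obtain g where g: "\<And>U. U \<in> cofinites \<Longrightarrow> g U \<in> carrier M"
      "\<And>U V. \<lbrakk>U \<in> cofinites; V \<in> cofinites; U \<subseteq> V\<rbrakk> \<Longrightarrow> w V = V +>\<^bsub>M\<^esub> g U"
    using completion_reps[OF w] by blast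
  have s: "V +>\<^bsub>M\<^esub> (f U \<oplus>\<^bsub>M\<^esub> g U) = z V <+>\<^bsub>M\<^esub> w V"
    if "U \<in> cofinites" "V \<in> cofinites" "U \<subseteq> V" for U V
    unfolding f(2)[OF that] g(2)[OF that]
    using coset_sum[OF cofinite_submodule[OF that(2)] f(1)[OF that(1)] g(1)[OF that(1)]] by simp
  have "(\<lambda>U\<in>cofinites. U +>\<^bsub>M\<^esub> (f U \<oplus>\<^bsub>M\<^esub> g U)) \<in> carrier completion"
  proof (rule completion_memI)
    fix U V assume UV: "U \<in> cofinites" "V \<in> cofinites" "U \<subseteq> V"
    show "V +>\<^bsub>M\<^esub> (f U \<oplus>\<^bsub>M\<^esub> g U) = V +>\<^bsub>M\<^esub> (f V \<oplus>\<^bsub>M\<^esub> g V)"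
      using s[OF UV] s[OF UV(2,2) subset_refl] by simp
  qed (use f g in auto)
  moreover have "(\<lambda>U\<in>cofinites. U +>\<^bsub>M\<^esub> (f U \<oplus>\<^bsub>M\<^esub> g U)) = z \<oplus>\<^bsub>completion\<^esub> w"
    unfolding completion_add by (rule restrict_ext) (rule s[OF _ _ subset_refl])
  ultimately show ?thesis by simp
qed

lemma completion_smult_closed:
  assumes z: "z \<in> carrier completion" and a: "a \<in> carrier R"
  shows "a \<odot>\<^bsub>completion\<^esub> z \<in> carrier completion"
proof -
  obtain f where f: "\<And>U. U \<in> cofinites \<Longrightarrow> f U \<in> carrier M"
      "\<And>U V. \<lbrakk>U \<in> cofinites; V \<in> cofinites; U \<subseteq> V\<rbrakk> \<Longrightarrow> z V = V +>\<^bsub>M\<^esub> f U"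
    using completion_reps[OF z] by blast
  have s: "V +>\<^bsub>M\<^esub> (a \<odot>\<^bsub>M\<^esub> f U) = a \<odot>\<^bsub>quotient_module M V\<^esub> z V"
    if "U \<in> cofinites" "V \<in> cofinites" "U \<subseteq> V" for U V
    unfolding f(2)[OF that]
    using quotient_smult[OF cofinite_submodule[OF that(2)] f(1)[OF that(1)] a] by simp
  have "(\<lambda>U\<in>cofinites. U +>\<^bsub>M\<^esub> (a \<odot>\<^bsub>M\<^esub> f U)) \<in> carrier completion"
  proof (rule completion_memI)
    fix U V assume UV: "U \<in> cofinites" "V \<in> cofinites" "U \<subseteq> V"
    show "V +>\<^bsub>M\<^esub> (a \<odot>\<^bsub>M\<^esub> f U) = V +>\<^bsub>M\<^esub> (a \<odot>\<^bsub>M\<^esub> f V)"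
      using s[OF UV] s[OF UV(2,2) subset_refl] by simp
  qed (use f a in auto)
  moreover have "(\<lambda>U\<in>cofinites. U +>\<^bsub>M\<^esub> (a \<odot>\<^bsub>M\<^esub> f U)) = a \<odot>\<^bsub>completion\<^esub> z"
    unfolding completion_smult by (rule restrict_ext) (rule s[OF _ _ subset_refl])
  ultimately show ?thesis by simp
qed

lemma completion_map_closed:
  assumes "m \<in> carrier M" shows "completion_map R M m \<in> carrier completion"
  unfolding completion_map_def by (rule completion_memI[OF assms refl])

lemma completion_map_add:
  assumes "m \<in> carrier M" "n \<in> carrier M"
  shows "completion_map R M (m \<oplus>\<^bsub>M\<^esub> n) = completion_map R M m \<oplus>\<^bsub>completion\<^esub> completion_map R M n"
  unfolding completion_map_def completion_add
  by (rule restrict_ext) (simp add: coset_sum[OF cofinite_submodule assms])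

lemma completion_map_smult:
  assumes "m \<in> carrier M" "a \<in> carrier R"
  shows "completion_map R M (a \<odot>\<^bsub>M\<^esub> m) = a \<odot>\<^bsub>completion\<^esub> completion_map R M m"
  unfolding completion_map_def completion_smult
  by (rule restrict_ext) (simp add: quotient_smult[OF cofinite_submodule assms])

lemma profinite_topspace: "topspace (profinite_topology R M) = carrier completion"
  unfolding profinite_topology_def profinite_completion_def by auto

text \<open>A basic open set restricts only finitely many components. They are all determined by the component at a
  cofinite submodule contained in the finitely many submodules concerned, and that component is a coset,
  so it comes from an element of \<open>M\<close>.\<close>
lemma completion_map_dense:
  assumes z: "z \<in> carrier completion" and O: "openin (profinite_topology R M) O'" "z \<in> O'"
  shows "\<exists>m \<in> carrier M. completion_map R M m \<in> O'"
proof -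
  obtain T where T: "openin (product_topology
      (\<lambda>U. discrete_topology (carrier (quotient_module M U))) cofinites) T"
    "O' = T \<inter> carrier completion"
    using O(1) unfolding profinite_topology_def openin_subtopology by blast
  obtain B where B: "z \<in> (\<Pi>\<^sub>E U\<in>cofinites. B U)"
    "finite {U. B U \<noteq> carrier (quotient_module M U)}" "(\<Pi>\<^sub>E U\<in>cofinites. B U) \<subseteq> T"
    using product_topology_open_contains_basis[OF T(1), of z] O(2) T(2) by auto
  obtain V where V: "V \<in> cofinites"
    "\<And>U. \<lbrakk>U \<in> cofinites; B U \<noteq> carrier (quotient_module M U)\<rbrakk> \<Longrightarrow> V \<subseteq> U"
    using cofinite_Inter[of "{U. B U \<noteq> carrier (quotient_module M U)} \<inter> cofinites"] B(2) by auto
  obtain m where m: "m \<in> carrier M" "\<And>U. \<lbrakk>U \<in> cofinites; V \<subseteq> U\<rbrakk> \<Longrightarrow> z U = U +>\<^bsub>M\<^esub> m"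
    using completion_rep[OF z V(1)] by blast
  have "completion_map R M m U \<in> B U" if U: "U \<in> cofinites" for U
  proof (cases "B U = carrier (quotient_module M U)")
    case True
    then show ?thesis using U m(1) unfolding completion_map_def quotient_carrier by auto
  next
    case False
    then have "completion_map R M m U = z U"
      using m(2)[OF U V(2)[OF U]] U unfolding completion_map_def by simp
    then show ?thesis using B(1) U by auto
  qed
  then have "completion_map R M m \<in> (\<Pi>\<^sub>E U\<in>cofinites. B U)"
    unfolding completion_map_def by auto
  then show ?thesis using B(3) T(2) completion_map_closed[OF m(1)] m(1) by blast
qed

end

section \<open>Completions of isomorphic modules and maps onto finite quotients\<close>

lemma module_isos_iff:
  "h \<in> module_isos R M N \<longleftrightarrow> bij_betw h (carrier M) (carrier N) \<and>
    (\<forall>x\<in>carrier M. \<forall>y\<in>carrier M. h (x \<oplus>\<^bsub>M\<^esub> y) = h x \<oplus>\<^bsub>N\<^esub> h y) \<and>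
    (\<forall>a\<in>carrier R. \<forall>x\<in>carrier M. h (a \<odot>\<^bsub>M\<^esub> x) = a \<odot>\<^bsub>N\<^esub> h x)"
  unfolding module_isos_def iso_def hom_def by (auto simp: bij_betw_def)

text \<open>Stated for a pair of mutually inverse maps and without the module axioms, so that it applies to
  modules and to their completions alike.\<close>
lemma module_isos_inverse:
  assumes h: "h \<in> module_isos R M N"
    and add: "\<And>x y. \<lbrakk>x \<in> carrier M; y \<in> carrier M\<rbrakk> \<Longrightarrow> x \<oplus>\<^bsub>M\<^esub> y \<in> carrier M"
    and smult: "\<And>a x. \<lbrakk>a \<in> carrier R; x \<in> carrier M\<rbrakk> \<Longrightarrow> a \<odot>\<^bsub>M\<^esub> x \<in> carrier M"
    and gh: "\<And>x. x \<in> carrier M \<Longrightarrow> g (h x) = x"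
    and g: "\<And>y. y \<in> carrier N \<Longrightarrow> g y \<in> carrier M"
    and hg: "\<And>y. y \<in> carrier N \<Longrightarrow> h (g y) = y"
  shows "g \<in> module_isos R N M"
proof -
  have hM: "h x \<in> carrier N" if "x \<in> carrier M" for x
    using h that unfolding module_isos_iff bij_betw_def by blast
  have "bij_betw g (carrier N) (carrier M)"
    by (rule bij_betw_byWitness[of _ h]) (use gh hg g hM in auto)
  moreover have "g (x \<oplus>\<^bsub>N\<^esub> y) = g x \<oplus>\<^bsub>M\<^esub> g y" if xy: "x \<in> carrier N" "y \<in> carrier N" for x y
  proof -
    have "h (g x \<oplus>\<^bsub>M\<^esub> g y) = x \<oplus>\<^bsub>N\<^esub> y"
      using h g[OF xy(1)] g[OF xy(2)] hg[OF xy(1)] hg[OF xy(2)] unfolding module_isos_iff by simp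
    then show ?thesis using gh[OF add[OF g[OF xy(1)] g[OF xy(2)]]] by simp
  qed
  moreover have "g (a \<odot>\<^bsub>N\<^esub> x) = a \<odot>\<^bsub>M\<^esub> g x" if ax: "a \<in> carrier R" "x \<in> carrier N" for a x
  proof -
    have "h (a \<odot>\<^bsub>M\<^esub> g x) = a \<odot>\<^bsub>N\<^esub> x"
      using h g[OF ax(2)] hg[OF ax(2)] ax(1) unfolding module_isos_iff by simp
    then show ?thesis using gh[OF smult[OF ax(1) g[OF ax(2)]]] by simp
  qed
  ultimately show ?thesis unfolding module_isos_iff by blast
qed

lemma profinite_completions_isomorphic_sym:
  assumes M: "Module.module R M" and N: "Module.module R N"
    and iso: "profinite_completions_isomorphic R M N"
  shows "profinite_completions_isomorphic R N M"
proof -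
  interpret M: Module.module R M by fact
  interpret N: Module.module R N by fact
  obtain h where h: "h \<in> module_isos R (profinite_completion R M) (profinite_completion R N)"
    and top: "homeomorphic_map (profinite_topology R M) (profinite_topology R N) h"
    using iso unfolding profinite_completions_isomorphic_def by blast
  obtain g where g: "homeomorphic_maps (profinite_topology R M) (profinite_topology R N) h g"
    using top unfolding homeomorphic_map_maps by blast
  have "homeomorphic_maps (profinite_topology R N) (profinite_topology R M) g h"
    using g homeomorphic_maps_sym by blast
  then have "homeomorphic_map (profinite_topology R N) (profinite_topology R M) g"
    unfolding homeomorphic_map_maps by blast
  moreover have "g \<in> module_isos R (profinite_completion R N) (profinite_completion R M)"
  proof (rule module_isos_inverse[OF h M.completion_add_closed M.completion_smult_closed])
    show "g (h x) = x" if "x \<in> carrier (profinite_completion R M)" for x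
      using g that unfolding homeomorphic_maps_def M.profinite_topspace by blast
    fix y assume y: "y \<in> carrier (profinite_completion R N)"
    show "h (g y) = y" using g y unfolding homeomorphic_maps_def N.profinite_topspace by blast
    have "continuous_map (profinite_topology R N) (profinite_topology R M) g"
      using g unfolding homeomorphic_maps_def by blast
    then show "g y \<in> carrier (profinite_completion R M)"
      using y continuous_map_image_subset_topspace unfolding M.profinite_topspace[symmetric]
        N.profinite_topspace[symmetric] by blast
  qed
  ultimately show ?thesis unfolding profinite_completions_isomorphic_def by blast
qed

text \<open>The map \<open>f\<close> represents an epimorphism from \<open>M\<close> onto \<open>N/W\<close>. Working with representatives in \<open>N\<close> avoids the
  quotient module.\<close>
definition epi_mod ::
  "('a, 'r) ring_scheme \<Rightarrow> ('a, 'm, 'x) module_scheme \<Rightarrow> ('a, 'n, 'y) module_scheme \<Rightarrow> 'n set \<Rightarrow> ('m \<Rightarrow> 'n) \<Rightarrow> bool"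
  where "epi_mod R M N W f \<longleftrightarrow> f \<in> carrier M \<rightarrow> carrier N \<and>
    (\<forall>x\<in>carrier M. \<forall>y\<in>carrier M. W +>\<^bsub>N\<^esub> f (x \<oplus>\<^bsub>M\<^esub> y) = W +>\<^bsub>N\<^esub> (f x \<oplus>\<^bsub>N\<^esub> f y)) \<and>
    (\<forall>a\<in>carrier R. \<forall>x\<in>carrier M. W +>\<^bsub>N\<^esub> f (a \<odot>\<^bsub>M\<^esub> x) = W +>\<^bsub>N\<^esub> (a \<odot>\<^bsub>N\<^esub> f x)) \<and>
    (\<forall>y\<in>carrier N. \<exists>x\<in>carrier M. W +>\<^bsub>N\<^esub> f x = W +>\<^bsub>N\<^esub> y)"

text \<open>The epimorphism sends \<open>m\<close> to the component at \<open>W\<close> of the image of \<open>m\<close> in the completion of \<open>N\<close>. It is onto: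
  the points of the completion of \<open>M\<close> whose image has the component \<open>W + y\<close> form an open set, nonempty because the
  isomorphism is onto, and \<open>M\<close> is dense.\<close>
lemma completion_iso_epi_mod:
  assumes M: "Module.module R M" and N: "Module.module R N"
    and iso: "profinite_completions_isomorphic R M N" and W: "W \<in> cofinite_submodules R N"
  shows "\<exists>f. epi_mod R M N W f"
proof -
  interpret M: Module.module R M by fact
  interpret N: Module.module R N by fact
  obtain h where h: "h \<in> module_isos R (profinite_completion R M) (profinite_completion R N)"
    and top: "homeomorphic_map (profinite_topology R M) (profinite_topology R N) h"
    using iso unfolding profinite_completions_isomorphic_def by blast
  have bij: "bij_betw h (carrier M.completion) (carrier N.completion)"
    and hadd: "\<And>x y. \<lbrakk>x \<in> carrier M.completion; y \<in> carrier M.completion\<rbrakk> \<Longrightarrow>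
      h (x \<oplus>\<^bsub>M.completion\<^esub> y) = h x \<oplus>\<^bsub>N.completion\<^esub> h y"
    and hsm: "\<And>a x. \<lbrakk>a \<in> carrier R; x \<in> carrier M.completion\<rbrakk> \<Longrightarrow>
      h (a \<odot>\<^bsub>M.completion\<^esub> x) = a \<odot>\<^bsub>N.completion\<^esub> h x"
    using h unfolding module_isos_iff by blast+
  let ?i = "completion_map R M"
  have Wsub: "submodule W R N" using N.cofinite_submodule[OF W] .
  have hi: "h (?i m) \<in> carrier N.completion" if "m \<in> carrier M" for m
    using bij M.completion_map_closed[OF that] unfolding bij_betw_def by blast
  have "\<forall>m\<in>carrier M. \<exists>n. n \<in> carrier N \<and> h (?i m) W = W +>\<^bsub>N\<^esub> n"
    using N.completion_rep[OF hi W] W by (metis subset_refl)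
  from bchoice[OF this] obtain f where
    f: "\<And>m. m \<in> carrier M \<Longrightarrow> f m \<in> carrier N"
      "\<And>m. m \<in> carrier M \<Longrightarrow> h (?i m) W = W +>\<^bsub>N\<^esub> f m" by blast
  have E1: "W +>\<^bsub>N\<^esub> f (x \<oplus>\<^bsub>M\<^esub> y) = W +>\<^bsub>N\<^esub> (f x \<oplus>\<^bsub>N\<^esub> f y)"
    if xy: "x \<in> carrier M" "y \<in> carrier M" for x y
  proof -
    have "W +>\<^bsub>N\<^esub> f (x \<oplus>\<^bsub>M\<^esub> y) = h (?i (x \<oplus>\<^bsub>M\<^esub> y)) W" using f(2) xy by simp
    also have "\<dots> = (h (?i x) \<oplus>\<^bsub>N.completion\<^esub> h (?i y)) W"
      unfolding M.completion_map_add[OF xy] using hadd M.completion_map_closed xy by simp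
    also have "\<dots> = (W +>\<^bsub>N\<^esub> f x) <+>\<^bsub>N\<^esub> (W +>\<^bsub>N\<^esub> f y)"
      unfolding N.completion_add using W f(2) xy by simp
    also have "\<dots> = W +>\<^bsub>N\<^esub> (f x \<oplus>\<^bsub>N\<^esub> f y)" using N.coset_sum[OF Wsub] f(1) xy by blast
    finally show ?thesis .
  qed
  have E2: "W +>\<^bsub>N\<^esub> f (a \<odot>\<^bsub>M\<^esub> x) = W +>\<^bsub>N\<^esub> (a \<odot>\<^bsub>N\<^esub> f x)"
    if ax: "a \<in> carrier R" "x \<in> carrier M" for a x
  proof -
    have "W +>\<^bsub>N\<^esub> f (a \<odot>\<^bsub>M\<^esub> x) = h (?i (a \<odot>\<^bsub>M\<^esub> x)) W" using f(2) ax by simp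
    also have "\<dots> = (a \<odot>\<^bsub>N.completion\<^esub> h (?i x)) W"
      unfolding M.completion_map_smult[OF ax(2,1)] using hsm M.completion_map_closed ax by simp
    also have "\<dots> = a \<odot>\<^bsub>quotient_module N W\<^esub> (W +>\<^bsub>N\<^esub> f x)"
      unfolding N.completion_smult using W f(2) ax by simp
    also have "\<dots> = W +>\<^bsub>N\<^esub> (a \<odot>\<^bsub>N\<^esub> f x)" using N.quotient_smult[OF Wsub] f(1) ax by blast
    finally show ?thesis .
  qed
  have E3: "\<exists>x\<in>carrier M. W +>\<^bsub>N\<^esub> f x = W +>\<^bsub>N\<^esub> y" if y: "y \<in> carrier N" for y
  proof -
    let ?T = "profinite_topology R M"
    have cont: "continuous_map ?T (profinite_topology R N) h"
      using top homeomorphic_imp_continuous_map by blast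
    let ?d = "\<lambda>U. discrete_topology (carrier (quotient_module N U))"
    have "continuous_map (profinite_topology R N) (?d W) (\<lambda>z. z W)"
      unfolding profinite_topology_def
      using continuous_map_product_projection[OF W, of ?d] continuous_map_from_subtopology by blast
    then have comp: "continuous_map ?T (?d W) (\<lambda>z. h z W)"
      using continuous_map_compose[OF cont] by (simp add: o_def)
    have yW: "W +>\<^bsub>N\<^esub> y \<in> carrier (quotient_module N W)" using y unfolding N.quotient_carrier by blast
    have "openin ?T {z \<in> topspace ?T. h z W \<in> {W +>\<^bsub>N\<^esub> y}}"
      using yW by (intro openin_continuous_map_preimage[OF comp]) simp
    moreover have "completion_map R N y \<in> h ` carrier M.completion"
      unfolding bij_betw_imp_surj_on[OF bij] using N.completion_map_closed[OF y] .
    then obtain z where z: "z \<in> carrier M.completion" "h z = completion_map R N y" by auto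
    moreover have "completion_map R N y W = W +>\<^bsub>N\<^esub> y" unfolding completion_map_def using W by simp
    ultimately obtain m where m: "m \<in> carrier M" "h (?i m) W = W +>\<^bsub>N\<^esub> y"
      using M.completion_map_dense[of z "{z \<in> topspace ?T. h z W \<in> {W +>\<^bsub>N\<^esub> y}}"]
        M.profinite_topspace by auto
    then show ?thesis using f(2) by auto
  qed
  have "epi_mod R M N W f"
    unfolding epi_mod_def by (intro conjI ballI funcsetI f(1) E1 E2 E3)
  then show ?thesis by blast
qed

text \<open>The component of the image at \<open>V\<close> comes from the component at the preimage of \<open>V\<close>, which is cofinite when \<open>f\<close> is
  an isomorphism.\<close>
definition induced ::
  "('a, 'r) ring_scheme \<Rightarrow> ('a, 'm, 'x) module_scheme \<Rightarrow> ('a, 'n, 'y) module_scheme \<Rightarrow> ('m \<Rightarrow> 'n) \<Rightarrow>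
    ('m set \<Rightarrow> 'm set) \<Rightarrow> 'n set \<Rightarrow> 'n set"
  where "induced R M N f z = (\<lambda>V \<in> cofinite_submodules R N. f ` z {x \<in> carrier M. f x \<in> V})"

locale module_iso = M: Module.module R M + N: Module.module R N for R M N +
  fixes f assumes f: "f \<in> module_isos R M N"
begin

abbreviation "pre V \<equiv> {x \<in> carrier M. f x \<in> V}"

lemma f_bij: "bij_betw f (carrier M) (carrier N)"
  and f_add: "\<lbrakk>x \<in> carrier M; y \<in> carrier M\<rbrakk> \<Longrightarrow> f (x \<oplus>\<^bsub>M\<^esub> y) = f x \<oplus>\<^bsub>N\<^esub> f y"
  and f_smult: "\<lbrakk>a \<in> carrier R; x \<in> carrier M\<rbrakk> \<Longrightarrow> f (a \<odot>\<^bsub>M\<^esub> x) = a \<odot>\<^bsub>N\<^esub> f x"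
  using f unfolding module_isos_iff by blast+

lemma f_closed: "x \<in> carrier M \<Longrightarrow> f x \<in> carrier N"
  using f_bij unfolding bij_betw_def by blast

lemma f_surj: assumes "y \<in> carrier N" shows "\<exists>x \<in> carrier M. f x = y"
  using f_bij assms unfolding bij_betw_def by (metis imageE)

lemma f_minus: assumes x: "x \<in> carrier M" and y: "y \<in> carrier M" shows "f (x \<ominus>\<^bsub>M\<^esub> y) = f x \<ominus>\<^bsub>N\<^esub> f y"
proof -
  have m1: "\<ominus>\<^bsub>R\<^esub> \<one>\<^bsub>R\<^esub> \<in> carrier R" by simp
  have "\<ominus>\<^bsub>M\<^esub> y = (\<ominus>\<^bsub>R\<^esub> \<one>\<^bsub>R\<^esub>) \<odot>\<^bsub>M\<^esub> y" using M.smult_l_minus[OF _ y, of "\<one>\<^bsub>R\<^esub>"] y by simp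
  moreover have "\<ominus>\<^bsub>N\<^esub> f y = (\<ominus>\<^bsub>R\<^esub> \<one>\<^bsub>R\<^esub>) \<odot>\<^bsub>N\<^esub> f y"
    using N.smult_l_minus[OF _ f_closed[OF y], of "\<one>\<^bsub>R\<^esub>"] f_closed[OF y] by simp
  ultimately show ?thesis
    unfolding a_minus_def using f_add[OF x M.smult_closed[OF m1 y]] f_smult[OF m1 y] by simp
qed

lemma pre_submodule: assumes V: "submodule V R N" shows "submodule (pre V) R M"
proof (rule M.submoduleI)
  note VE = N.submoduleE[OF V]
  have z: "f \<zero>\<^bsub>M\<^esub> = \<zero>\<^bsub>N\<^esub>"
    using f_smult[of "\<zero>\<^bsub>R\<^esub>" "\<zero>\<^bsub>M\<^esub>"] f_closed[of "\<zero>\<^bsub>M\<^esub>"] by simp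
  show "\<zero>\<^bsub>M\<^esub> \<in> pre V" using z N.submodule_zero[OF V] by simp
  show "\<ominus>\<^bsub>M\<^esub> x \<in> pre V" if x: "x \<in> pre V" for x
  proof -
    have "f (\<zero>\<^bsub>M\<^esub> \<ominus>\<^bsub>M\<^esub> x) = \<ominus>\<^bsub>N\<^esub> f x" using f_minus[of "\<zero>\<^bsub>M\<^esub>" x] z x f_closed by (simp add: a_minus_def)
    then show ?thesis using x VE(3) by (simp add: a_minus_def)
  qed
qed (use f_add f_smult N.submoduleE(4,5)[OF V] in auto)

lemma pre_coset_eq_iff:
  assumes V: "submodule V R N" and x: "x \<in> carrier M" and y: "y \<in> carrier M"
  shows "pre V +>\<^bsub>M\<^esub> x = pre V +>\<^bsub>M\<^esub> y \<longleftrightarrow> V +>\<^bsub>N\<^esub> f x = V +>\<^bsub>N\<^esub> f y"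
  unfolding M.coset_eq_iff[OF pre_submodule[OF V] x y] N.coset_eq_iff[OF V f_closed[OF x] f_closed[OF y]]
  using f_minus[OF x y] x y by auto

lemma pre_cofinite: assumes V: "V \<in> cofinite_submodules R N" shows "pre V \<in> cofinite_submodules R M"
proof -
  have Vs: "submodule V R N" using N.cofinite_submodule[OF V] .
  let ?c = "\<lambda>y. V +>\<^bsub>N\<^esub> y" and ?p = "\<lambda>x. pre V +>\<^bsub>M\<^esub> x"
  have "finite ((\<lambda>x. ?c (f x)) ` carrier M)"
    by (rule finite_subset[of _ "?c ` carrier N"]) (use f_closed V N.cofinite_iff in auto)
  then obtain D where D: "D \<subseteq> carrier M" "finite D" "(\<lambda>x. ?c (f x)) ` carrier M = (\<lambda>x. ?c (f x)) ` D"
    by (meson finite_subset_image subset_refl)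
  have "?p x \<in> ?p ` D" if x: "x \<in> carrier M" for x
  proof -
    obtain d where d: "d \<in> D" "?c (f x) = ?c (f d)" using D(3) x by blast
    have "d \<in> carrier M" using d D by blast
    then have "?p x = ?p d" using pre_coset_eq_iff[OF Vs x] d(2) by simp
    then show ?thesis using d(1) by blast
  qed
  then have "?p ` carrier M \<subseteq> ?p ` D" by (rule image_subsetI)
  then have "finite (?p ` carrier M)" using finite_imageI[OF D(2)] by (rule finite_subset)
  then show ?thesis using pre_submodule[OF Vs] M.cofinite_iff by simp
qed

lemma image_coset:
  assumes V: "submodule V R N" and x: "x \<in> carrier M"
  shows "f ` (pre V +>\<^bsub>M\<^esub> x) = V +>\<^bsub>N\<^esub> f x"
proof
  show "f ` (pre V +>\<^bsub>M\<^esub> x) \<subseteq> V +>\<^bsub>N\<^esub> f x"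
    using f_add x unfolding a_r_coset_def' by auto
  show "V +>\<^bsub>N\<^esub> f x \<subseteq> f ` (pre V +>\<^bsub>M\<^esub> x)"
  proof
    fix w assume "w \<in> V +>\<^bsub>N\<^esub> f x"
    then obtain v where v: "v \<in> V" "w = v \<oplus>\<^bsub>N\<^esub> f x" unfolding a_r_coset_def' by blast
    obtain u where u: "u \<in> carrier M" "f u = v" using v(1) f_surj N.submoduleE(1)[OF V] by blast
    have "w = f (u \<oplus>\<^bsub>M\<^esub> x)" using f_add u x v(2) by simp
    then show "w \<in> f ` (pre V +>\<^bsub>M\<^esub> x)" using u v(1) unfolding a_r_coset_def' by blast
  qed
qed

abbreviation "F \<equiv> induced R M N f"

lemma induced_eval:
  assumes V: "V \<in> cofinite_submodules R N" and x: "x \<in> carrier M" and z: "z (pre V) = pre V +>\<^bsub>M\<^esub> x"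
  shows "F z V = V +>\<^bsub>N\<^esub> f x"
  unfolding induced_def using image_coset[OF N.cofinite_submodule[OF V] x] V z by simp

lemma rep_at:
  assumes "z \<in> carrier M.completion" "V \<in> cofinite_submodules R N"
  obtains x where "x \<in> carrier M" "z (pre V) = pre V +>\<^bsub>M\<^esub> x"
  using M.completion_rep[OF assms(1) pre_cofinite[OF assms(2)]] pre_cofinite[OF assms(2)]
  by (metis (no_types, lifting) subset_refl)

lemma induced_closed: assumes z: "z \<in> carrier M.completion" shows "F z \<in> carrier N.completion"
proof -
  have "\<forall>V\<in>cofinite_submodules R N. \<exists>m. m \<in> carrier M \<and>
      (\<forall>V'\<in>cofinite_submodules R N. V \<subseteq> V' \<longrightarrow> z (pre V') = pre V' +>\<^bsub>M\<^esub> m)"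
  proof
    fix V assume V: "V \<in> cofinite_submodules R N"
    obtain m where m: "m \<in> carrier M"
      "\<And>U. \<lbrakk>U \<in> cofinite_submodules R M; pre V \<subseteq> U\<rbrakk> \<Longrightarrow> z U = U +>\<^bsub>M\<^esub> m"
      using M.completion_rep[OF z pre_cofinite[OF V]] by blast
    have "z (pre V') = pre V' +>\<^bsub>M\<^esub> m" if "V' \<in> cofinite_submodules R N" "V \<subseteq> V'" for V'
      using that by (intro m(2) pre_cofinite) auto
    then show "\<exists>m. m \<in> carrier M \<and>
      (\<forall>V'\<in>cofinite_submodules R N. V \<subseteq> V' \<longrightarrow> z (pre V') = pre V' +>\<^bsub>M\<^esub> m)" using m(1) by blast
  qed
  from bchoice[OF this] obtain m where
    m: "\<And>V. V \<in> cofinite_submodules R N \<Longrightarrow> m V \<in> carrier M"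
      "\<And>V V'. \<lbrakk>V \<in> cofinite_submodules R N; V' \<in> cofinite_submodules R N; V \<subseteq> V'\<rbrakk> \<Longrightarrow>
        z (pre V') = pre V' +>\<^bsub>M\<^esub> m V" by blast
  have "(\<lambda>V\<in>cofinite_submodules R N. V +>\<^bsub>N\<^esub> f (m V)) \<in> carrier N.completion"
  proof (rule N.completion_memI)
    show "f (m V) \<in> carrier N" if "V \<in> cofinite_submodules R N" for V using f_closed m(1) that by blast
    fix V V' assume V: "V \<in> cofinite_submodules R N" "V' \<in> cofinite_submodules R N" "V \<subseteq> V'"
    show "V' +>\<^bsub>N\<^esub> f (m V) = V' +>\<^bsub>N\<^esub> f (m V')"
      using pre_coset_eq_iff[OF N.cofinite_submodule[OF V(2)] m(1)[OF V(1)] m(1)[OF V(2)]]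
        m(2)[OF V] m(2)[OF V(2,2) subset_refl] by simp
  qed
  moreover have "(\<lambda>V\<in>cofinite_submodules R N. V +>\<^bsub>N\<^esub> f (m V)) = F z"
  proof (rule ext)
    fix V show "(\<lambda>V\<in>cofinite_submodules R N. V +>\<^bsub>N\<^esub> f (m V)) V = F z V"
    proof (cases "V \<in> cofinite_submodules R N")
      case True
      then show ?thesis using induced_eval[where z = z, OF True m(1)[OF True] m(2)[OF True True subset_refl]] by simp
    qed (simp add: induced_def)
  qed
  ultimately show ?thesis by simp
qed

lemma induced_add:
  assumes z: "z \<in> carrier M.completion" and w: "w \<in> carrier M.completion"
  shows "F (z \<oplus>\<^bsub>M.completion\<^esub> w) = F z \<oplus>\<^bsub>N.completion\<^esub> F w"
proof (rule ext)
  fix V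
  show "F (z \<oplus>\<^bsub>M.completion\<^esub> w) V = (F z \<oplus>\<^bsub>N.completion\<^esub> F w) V"
  proof (cases "V \<in> cofinite_submodules R N")
    case True
    note Vs = N.cofinite_submodule[OF True]
    obtain x where x: "x \<in> carrier M" "z (pre V) = pre V +>\<^bsub>M\<^esub> x" using rep_at[OF z True] .
    obtain y where y: "y \<in> carrier M" "w (pre V) = pre V +>\<^bsub>M\<^esub> y" using rep_at[OF w True] .
    have "(z \<oplus>\<^bsub>M.completion\<^esub> w) (pre V) = pre V +>\<^bsub>M\<^esub> (x \<oplus>\<^bsub>M\<^esub> y)"
      unfolding M.completion_add
      using pre_cofinite[OF True] x y M.coset_sum[OF pre_submodule[OF Vs] x(1) y(1)] by simp
    then have "F (z \<oplus>\<^bsub>M.completion\<^esub> w) V = V +>\<^bsub>N\<^esub> (f x \<oplus>\<^bsub>N\<^esub> f y)"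
      using induced_eval[OF True, of "x \<oplus>\<^bsub>M\<^esub> y"] x y f_add by simp
    also have "\<dots> = F z V <+>\<^bsub>N\<^esub> F w V"
      using induced_eval[where z = z, OF True x] induced_eval[where z = w, OF True y]
        N.coset_sum[OF Vs f_closed[OF x(1)] f_closed[OF y(1)]] by simp
    finally show ?thesis unfolding N.completion_add using True by simp
  qed (simp add: induced_def N.completion_add)
qed

lemma induced_smult:
  assumes z: "z \<in> carrier M.completion" and a: "a \<in> carrier R"
  shows "F (a \<odot>\<^bsub>M.completion\<^esub> z) = a \<odot>\<^bsub>N.completion\<^esub> F z"
proof (rule ext)
  fix V
  show "F (a \<odot>\<^bsub>M.completion\<^esub> z) V = (a \<odot>\<^bsub>N.completion\<^esub> F z) V"
  proof (cases "V \<in> cofinite_submodules R N")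
    case True
    note Vs = N.cofinite_submodule[OF True]
    obtain x where x: "x \<in> carrier M" "z (pre V) = pre V +>\<^bsub>M\<^esub> x" using rep_at[OF z True] .
    have "(a \<odot>\<^bsub>M.completion\<^esub> z) (pre V) = pre V +>\<^bsub>M\<^esub> (a \<odot>\<^bsub>M\<^esub> x)"
      unfolding M.completion_smult
      using pre_cofinite[OF True] x M.quotient_smult[OF pre_submodule[OF Vs] x(1) a] by simp
    then have "F (a \<odot>\<^bsub>M.completion\<^esub> z) V = V +>\<^bsub>N\<^esub> (a \<odot>\<^bsub>N\<^esub> f x)"
      using induced_eval[OF True, of "a \<odot>\<^bsub>M\<^esub> x"] x a f_smult by simp
    also have "\<dots> = a \<odot>\<^bsub>quotient_module N V\<^esub> F z V"
      using induced_eval[where z = z, OF True x] N.quotient_smult[OF Vs f_closed[OF x(1)] a] by simp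
    finally show ?thesis unfolding N.completion_smult using True by simp
  qed (simp add: induced_def N.completion_smult)
qed

lemma induced_continuous: "continuous_map (profinite_topology R M) (profinite_topology R N) F"
proof -
  let ?d = "\<lambda>U. discrete_topology (carrier (quotient_module M U))"
  let ?e = "\<lambda>V. discrete_topology (carrier (quotient_module N V))"
  let ?T = "profinite_topology R M"
  have coord: "continuous_map ?T (?e V) (\<lambda>z. F z V)" if V: "V \<in> cofinite_submodules R N" for V
  proof -
    have "continuous_map ?T (?d (pre V)) (\<lambda>z. z (pre V))"
      unfolding profinite_topology_def
      using continuous_map_product_projection[OF pre_cofinite[OF V], of ?d]
        continuous_map_from_subtopology by blast
    moreover have "continuous_map (?d (pre V)) (?e V) (\<lambda>A. f ` A)"
      using image_coset[OF N.cofinite_submodule[OF V]] f_closed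
      by (auto simp: continuous_map_from_discrete_topology M.quotient_carrier N.quotient_carrier)
    ultimately have "continuous_map ?T (?e V) ((\<lambda>A. f ` A) \<circ> (\<lambda>z. z (pre V)))"
      by (rule continuous_map_compose)
    then show ?thesis using V by (simp add: o_def induced_def)
  qed
  have "F z \<in> extensional (cofinite_submodules R N)" for z unfolding induced_def by simp
  then have "continuous_map ?T (product_topology ?e (cofinite_submodules R N)) F"
    unfolding continuous_map_componentwise using coord by blast
  moreover have "F \<in> topspace ?T \<rightarrow> carrier N.completion"
    unfolding M.profinite_topspace using induced_closed by blast
  ultimately show ?thesis
    unfolding profinite_topology_def[of R N] continuous_map_in_subtopology by blast
qed

end

lemma (in module_iso) induced_inverse:
  assumes g: "g \<in> module_isos R N M" and gf: "\<And>x. x \<in> carrier M \<Longrightarrow> g (f x) = x"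
    and z: "z \<in> carrier M.completion"
  shows "induced R N M g (F z) = z"
proof -
  interpret g: module_iso R N M g using g by unfold_locales
  show ?thesis
  proof (rule M.completion_eqI[OF g.induced_closed[OF induced_closed[OF z]] z])
    fix U assume U: "U \<in> cofinite_submodules R M"
    have Uc: "U \<subseteq> carrier M" using M.submoduleE(1)[OF M.cofinite_submodule[OF U]] .
    have pp: "pre (g.pre U) = U"
    proof
      show "pre (g.pre U) \<subseteq> U" using gf by force
      show "U \<subseteq> pre (g.pre U)"
      proof
        fix x assume x: "x \<in> U"
        then have "x \<in> carrier M" using Uc by blast
        then show "x \<in> pre (g.pre U)" using f_closed gf x by simp
      qed
    qed
    obtain m where m1: "m \<in> carrier M" and "\<And>V. \<lbrakk>V \<in> cofinite_submodules R M; U \<subseteq> V\<rbrakk> \<Longrightarrow> z V = V +>\<^bsub>M\<^esub> m"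
      using M.completion_rep[OF z U] by blast
    then have m: "m \<in> carrier M" "z U = U +>\<^bsub>M\<^esub> m" using U by simp_all
    have "F z (g.pre U) = g.pre U +>\<^bsub>N\<^esub> f m"
      using induced_eval[OF g.pre_cofinite[OF U] m(1)] m(2) unfolding pp by simp
    then have "induced R N M g (F z) U = U +>\<^bsub>M\<^esub> g (f m)"
      using g.induced_eval[OF U f_closed[OF m(1)]] by simp
    then show "induced R N M g (F z) U = z U" using m gf by simp
  qed
qed

lemma module_iso_imp_completions_iso:
  assumes M: "Module.module R M" and N: "Module.module R N" and iso: "module_isomorphic R M N"
  shows "profinite_completions_isomorphic R M N"
proof -
  interpret M: Module.module R M by fact
  interpret N: Module.module R N by fact
  obtain f where f: "f \<in> module_isos R M N" using iso unfolding module_isomorphic_def by blast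
  let ?g = "inv_into (carrier M) f"
  have bij: "bij_betw f (carrier M) (carrier N)" using f unfolding module_isos_iff by blast
  have gf: "?g (f x) = x" if "x \<in> carrier M" for x
    using bij that by (simp add: bij_betw_def)
  have fg: "f (?g y) = y" if "y \<in> carrier N" for y
    using bij that by (simp add: bij_betw_def f_inv_into_f)
  have gc: "?g y \<in> carrier M" if "y \<in> carrier N" for y
    using bij that by (metis bij_betw_def inv_into_into)
  have g: "?g \<in> module_isos R N M"
    using module_isos_inverse[OF f _ _ gf gc fg] by simp
  interpret f: module_iso R M N f using f by unfold_locales
  interpret g: module_iso R N M ?g using g by unfold_locales
  have maps: "homeomorphic_maps (profinite_topology R M) (profinite_topology R N) f.F g.F"
    unfolding homeomorphic_maps_def M.profinite_topspace N.profinite_topspace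
    using f.induced_continuous g.induced_continuous f.induced_inverse[OF g gf] g.induced_inverse[OF f fg]
    by blast
  have "bij_betw f.F (carrier M.completion) (carrier N.completion)"
    by (rule bij_betw_byWitness[of _ g.F])
      (use f.induced_closed g.induced_closed f.induced_inverse[OF g gf] g.induced_inverse[OF f fg] in auto)
  then have "f.F \<in> module_isos R M.completion N.completion"
    unfolding module_isos_iff using f.induced_add f.induced_smult by blast
  moreover have "homeomorphic_map (profinite_topology R M) (profinite_topology R N) f.F"
    using maps unfolding homeomorphic_map_maps by blast
  ultimately show ?thesis unfolding profinite_completions_isomorphic_def by blast
qed

section \<open>Splitting off the torsion and residual finiteness\<close>

lemma (in abelian_group) minus_eq_zeroD:
  assumes "x \<in> carrier G" "y \<in> carrier G" "x \<ominus> y = \<zero>" shows "x = y"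
proof -
  have "x = (x \<ominus> y) \<oplus> y" unfolding a_minus_def using assms(1,2) by (simp add: a_assoc l_neg)
  then show ?thesis using assms by simp
qed

lemma (in abelian_group) add_diff_cancel:
  assumes "x \<in> carrier G" "y \<in> carrier G" shows "x \<oplus> y \<ominus> x = y"
proof -
  have "x \<oplus> y \<ominus> x = y \<oplus> (x \<oplus> \<ominus> x)" unfolding a_minus_def using assms by (simp add: a_ac)
  then show ?thesis using assms by (simp add: r_neg)
qed

definition (in module) multiples
  where "multiples a = (\<lambda>m. a \<odot>\<^bsub>M\<^esub> m) ` carrier M"

context module
begin

lemma multiples_submodule:
  assumes a: "a \<in> carrier R" shows "submodule (multiples a) R M"
proof (rule submoduleI)
  show "multiples a \<subseteq> carrier M" unfolding multiples_def using a by auto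
  show "\<zero>\<^bsub>M\<^esub> \<in> multiples a"
    unfolding multiples_def using smult_r_null[OF a] by (metis M.zero_closed image_eqI)
  fix u assume "u \<in> multiples a"
  then obtain m where m: "m \<in> carrier M" "u = a \<odot>\<^bsub>M\<^esub> m" unfolding multiples_def by blast
  have "\<ominus>\<^bsub>M\<^esub> u = a \<odot>\<^bsub>M\<^esub> (\<ominus>\<^bsub>M\<^esub> m)" using smult_r_minus[OF a m(1)] m(2) by simp
  then show "\<ominus>\<^bsub>M\<^esub> u \<in> multiples a" unfolding multiples_def using m(1) by blast
  show "r \<odot>\<^bsub>M\<^esub> u \<in> multiples a" if r: "r \<in> carrier R" for r
  proof -
    have "r \<odot>\<^bsub>M\<^esub> u = a \<odot>\<^bsub>M\<^esub> (r \<odot>\<^bsub>M\<^esub> m)"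
      unfolding m(2) using a r m(1) by (simp add: smult_assoc1[symmetric] m_comm)
    then show ?thesis unfolding multiples_def using m(1) r by blast
  qed
  fix v assume "v \<in> multiples a"
  then obtain n where n: "n \<in> carrier M" "v = a \<odot>\<^bsub>M\<^esub> n" unfolding multiples_def by blast
  have "u \<oplus>\<^bsub>M\<^esub> v = a \<odot>\<^bsub>M\<^esub> (m \<oplus>\<^bsub>M\<^esub> n)" using smult_r_distr[OF a m(1) n(1)] m(2) n(2) by simp
  then show "u \<oplus>\<^bsub>M\<^esub> v \<in> multiples a" unfolding multiples_def using m(1) n(1) by blast
qed

lemma zero_submodule: "submodule {\<zero>\<^bsub>M\<^esub>} R M"
  by (rule submoduleI) auto

lemma finitely_generated_family:
  assumes "finitely_generated_module R M"
  obtains I :: "nat set" and x where "finite I" "x \<in> I \<rightarrow> carrier M"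
    "\<And>U. \<lbrakk>submodule U R M; x ` I \<subseteq> U\<rbrakk> \<Longrightarrow> carrier M \<subseteq> U"
proof -
  obtain S where S: "finite S" "S \<subseteq> carrier M" "(\<lambda>U. submodule U R M) hull S = carrier M"
    using assms unfolding finitely_generated_module_def by blast
  obtain x where x: "bij_betw x {0..<card S} S" using ex_bij_betw_nat_finite[OF S(1)] by blast
  then have im: "x ` {0..<card S} = S" by (rule bij_betw_imp_surj_on)
  show thesis
  proof (rule that[of "{0..<card S}" x])
    show "x \<in> {0..<card S} \<rightarrow> carrier M" using im S(2) by blast
    show "carrier M \<subseteq> U" if "submodule U R M" "x ` {0..<card S} \<subseteq> U" for U
      using hull_minimal[of S U "\<lambda>U. submodule U R M"] that S(3) im by simp
  qed simp
qed

text \<open>Dividing every coefficient by \<open>a\<close> with a remainder in \<open>D\<close>.\<close>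
lemma comb_residue:
  assumes I: "finite I" and x: "x \<in> I \<rightarrow> carrier M" and a: "a \<in> carrier R" and D: "D \<subseteq> carrier R"
    and cover: "\<And>r. r \<in> carrier R \<Longrightarrow> \<exists>d \<in> D. \<exists>y \<in> carrier R. r = d \<oplus> a \<otimes> y"
    and b: "b \<in> I \<rightarrow> carrier R"
  obtains d y where "d \<in> I \<rightarrow>\<^sub>E D" "y \<in> I \<rightarrow> carrier R"
    "comb I x b = comb I x d \<oplus>\<^bsub>M\<^esub> a \<odot>\<^bsub>M\<^esub> comb I x y"
proof -
  have "\<forall>i\<in>I. \<exists>p. fst p \<in> D \<and> snd p \<in> carrier R \<and> b i = fst p \<oplus> a \<otimes> snd p"
  proof
    fix i assume "i \<in> I"
    then obtain d y where "d \<in> D" "y \<in> carrier R" "b i = d \<oplus> a \<otimes> y" using cover b by blast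
    then show "\<exists>p. fst p \<in> D \<and> snd p \<in> carrier R \<and> b i = fst p \<oplus> a \<otimes> snd p"
      by (intro exI[of _ "(d, y)"]) simp
  qed
  from bchoice[OF this] obtain p where
    p: "\<And>i. i \<in> I \<Longrightarrow> fst (p i) \<in> D \<and> snd (p i) \<in> carrier R \<and> b i = fst (p i) \<oplus> a \<otimes> snd (p i)" by blast
  let ?d = "\<lambda>i\<in>I. fst (p i)" and ?y = "\<lambda>i. snd (p i)"
  have d: "?d \<in> I \<rightarrow>\<^sub>E D" and y: "?y \<in> I \<rightarrow> carrier R" using p by auto
  have dR: "?d \<in> I \<rightarrow> carrier R" using p D by auto
  have ay: "(\<lambda>i. a \<otimes> ?y i) \<in> I \<rightarrow> carrier R" using y a by auto
  have sum: "(\<lambda>i. ?d i \<oplus> a \<otimes> ?y i) \<in> I \<rightarrow> carrier R"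
    using funcset_mem[OF dR] funcset_mem[OF ay] by (intro funcsetI R.add.m_closed) blast+
  have "comb I x b = comb I x (\<lambda>i. ?d i \<oplus> a \<otimes> ?y i)"
    by (rule comb_cong[OF x sum]) (simp_all add: p)
  then show thesis
    using that[OF d y] unfolding comb_smult[OF I x y a] comb_add[OF x dR ay] by blast
qed

text \<open>Modulo \<open>aM\<close> the coefficients with respect to a finite generating family may be taken from a finite set.\<close>
lemma multiples_cofinite:
  assumes fg: "finitely_generated_module R M" and a: "a \<in> carrier R" and res: "finite_residues R a"
  shows "multiples a \<in> cofinites"
proof -
  obtain I :: "nat set" and x where I: "finite I" and x: "x \<in> I \<rightarrow> carrier M"
    and gen: "\<And>U. \<lbrakk>submodule U R M; x ` I \<subseteq> U\<rbrakk> \<Longrightarrow> carrier M \<subseteq> U"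
    using finitely_generated_family[OF fg] by blast
  have all: "carrier M \<subseteq> span_over {\<zero>\<^bsub>M\<^esub>} I x"
    using gen[OF span_over_submodule[OF zero_submodule I x] span_over_incl(1)[OF zero_submodule I x]] .
  obtain D where D: "finite D" "D \<subseteq> carrier R"
    "\<And>r. r \<in> carrier R \<Longrightarrow> \<exists>d \<in> D. \<exists>y \<in> carrier R. r = d \<oplus> a \<otimes> y"
    using res unfolding finite_residues_def by blast
  note U = multiples_submodule[OF a]
  let ?c = "\<lambda>m. multiples a +>\<^bsub>M\<^esub> m"
  have "?c m \<in> (\<lambda>d. ?c (comb I x d)) ` (I \<rightarrow>\<^sub>E D)" if m: "m \<in> carrier M" for m
  proof -
    obtain b where b: "b \<in> I \<rightarrow> carrier R" "m = comb I x b \<oplus>\<^bsub>M\<^esub> \<zero>\<^bsub>M\<^esub>"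
      using all m unfolding span_over_def by blast
    then have mb: "m = comb I x b" using comb_closed[OF x b(1)] by simp
    obtain d y where d: "d \<in> I \<rightarrow>\<^sub>E D" "y \<in> I \<rightarrow> carrier R"
      and e: "m = comb I x d \<oplus>\<^bsub>M\<^esub> a \<odot>\<^bsub>M\<^esub> comb I x y"
      unfolding mb using comb_residue[OF I x a D(2,3) b(1)] by blast
    have dR: "d \<in> I \<rightarrow> carrier R" using d(1) D(2) by auto
    have c: "comb I x d \<in> carrier M" "comb I x y \<in> carrier M"
      using comb_closed[OF x dR] comb_closed[OF x d(2)] by auto
    have "m \<ominus>\<^bsub>M\<^esub> comb I x d = a \<odot>\<^bsub>M\<^esub> comb I x y"
      unfolding e by (rule M.add_diff_cancel[OF c(1) smult_closed[OF a c(2)]])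
    then have "m \<ominus>\<^bsub>M\<^esub> comb I x d \<in> multiples a" unfolding multiples_def using c(2) by blast
    then have "?c m = ?c (comb I x d)" using coset_eq_iff[OF U m c(1)] by simp
    then show ?thesis using d(1) by blast
  qed
  then have "?c ` carrier M \<subseteq> (\<lambda>d. ?c (comb I x d)) ` (I \<rightarrow>\<^sub>E D)" by (rule image_subsetI)
  moreover have "finite (I \<rightarrow>\<^sub>E D)" by (rule finite_PiE[OF I D(1)])
  ultimately have "finite (?c ` carrier M)" by (rule finite_subset[OF _ finite_imageI])
  then show ?thesis using U unfolding cofinite_iff by simp
qed

lemma residually_finiteI:
  assumes "\<And>x. x \<in> carrier M - {\<zero>\<^bsub>M\<^esub>} \<Longrightarrow> \<exists>U \<in> cofinites. x \<notin> U"
  shows "residually_finite_module R M"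
  unfolding residually_finite_module_def
proof (rule inj_onI)
  fix x y assume x: "x \<in> carrier M" and y: "y \<in> carrier M"
    and eq: "completion_map R M x = completion_map R M y"
  have "x \<ominus>\<^bsub>M\<^esub> y \<in> U" if U: "U \<in> cofinites" for U
  proof -
    have "completion_map R M x U = completion_map R M y U" using eq by simp
    then have "U +>\<^bsub>M\<^esub> x = U +>\<^bsub>M\<^esub> y" unfolding completion_map_def using U by simp
    then show ?thesis using coset_eq_iff[OF cofinite_submodule[OF U] x y] by simp
  qed
  then have "x \<ominus>\<^bsub>M\<^esub> y = \<zero>\<^bsub>M\<^esub>" using assms[of "x \<ominus>\<^bsub>M\<^esub> y"] x y by blast
  then show "x = y" by (rule M.minus_eq_zeroD[OF x y])
qed

end

context pid_module
begin

text \<open>\<open>M\<close> is the direct sum of a free module with basis \<open>x\<close> and its torsion, and \<open>t\<close> kills the torsion.\<close>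
definition splitting
  where "splitting I x t \<longleftrightarrow> finite I \<and> x \<in> I \<rightarrow> carrier M \<and> span_over torsion I x = carrier M \<and>
    (\<forall>a \<in> I \<rightarrow> carrier R. comb I x a \<in> torsion \<longrightarrow> (\<forall>i\<in>I. a i = \<zero>)) \<and>
    t \<in> carrier R - {\<zero>} \<and> (\<forall>\<tau>\<in>torsion. t \<odot>\<^bsub>M\<^esub> \<tau> = \<zero>\<^bsub>M\<^esub>)"

lemma common_annihilator:
  assumes "finite J" "z \<in> J \<rightarrow> torsion"
  shows "\<exists>t \<in> carrier R - {\<zero>}. \<forall>j\<in>J. t \<odot>\<^bsub>M\<^esub> z j = \<zero>\<^bsub>M\<^esub>"
  using assms
proof (induct J)
  case empty
  have "\<one> \<in> carrier R - {\<zero>}" by simp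
  then show ?case by blast
next
  case (insert j J)
  then obtain t where t: "t \<in> carrier R - {\<zero>}" "\<forall>j\<in>J. t \<odot>\<^bsub>M\<^esub> z j = \<zero>\<^bsub>M\<^esub>" by auto
  obtain s where s: "s \<in> carrier R - {\<zero>}" "s \<odot>\<^bsub>M\<^esub> z j = \<zero>\<^bsub>M\<^esub>"
    using insert(4) unfolding torsion_def by auto
  have z: "z i \<in> carrier M" if "i \<in> insert j J" for i using insert(4) that torsion_carrier by blast
  have "s \<otimes> t \<in> carrier R - {\<zero>}" using s t integral[of s t] by auto
  moreover have "(s \<otimes> t) \<odot>\<^bsub>M\<^esub> z i = \<zero>\<^bsub>M\<^esub>" if i: "i \<in> insert j J" for i
  proof (cases "i \<in> J")
    case True
    then have "s \<odot>\<^bsub>M\<^esub> (t \<odot>\<^bsub>M\<^esub> z i) = \<zero>\<^bsub>M\<^esub>" using t s by simp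
    then show ?thesis using smult_assoc1 s t z[OF i] by simp
  next
    case False
    then have "t \<odot>\<^bsub>M\<^esub> (s \<odot>\<^bsub>M\<^esub> z i) = \<zero>\<^bsub>M\<^esub>" using t s i by simp
    then show ?thesis using smult_assoc1[of t s "z i"] s t z[OF i] m_comm[of s t] by simp
  qed
  ultimately show ?case by blast
qed

text \<open>A family of least size generating \<open>M\<close> modulo torsion is a basis of a complement of the torsion. Each of
  finitely many generators of \<open>M\<close> has a torsion component, and a common annihilator \<open>t\<close> of these components
  kills all torsion: the elements whose torsion component is killed by \<open>t\<close> form a submodule.\<close>
lemma splitting_exists:
  assumes fg: "finitely_generated_module R M"
  shows "\<exists>(I :: nat set) x t. splitting I x t"
proof -
  obtain J :: "nat set" and z where J: "finite J" and z: "z \<in> J \<rightarrow> carrier M"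
    and gen: "\<And>U. \<lbrakk>submodule U R M; z ` J \<subseteq> U\<rbrakk> \<Longrightarrow> carrier M \<subseteq> U"
    using finitely_generated_family[OF fg] by blast
  define P where "P n \<longleftrightarrow> (\<exists>(I :: nat set) x. finite I \<and> card I = n \<and> x \<in> I \<rightarrow> carrier M \<and>
    span_over torsion I x = carrier M)" for n
  note sub = span_over_submodule[OF torsion_submodule]
  have "span_over torsion J z = carrier M"
    using gen[OF sub[OF J z] span_over_incl(1)[OF torsion_submodule J z]] submoduleE(1)[OF sub[OF J z]]
    by blast
  then have "P (card J)" unfolding P_def using J z by blast
  then have "P (LEAST n. P n)" by (rule LeastI)
  then obtain I :: "nat set" and x where I: "finite I" "card I = (LEAST n. P n)"
    and x: "x \<in> I \<rightarrow> carrier M" and span: "span_over torsion I x = carrier M"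
    unfolding P_def[of "LEAST n. P n"] by blast
  have min: "card I \<le> card K" if "finite K" "y \<in> K \<rightarrow> carrier M" "span_over torsion K y = carrier M"
    for K :: "nat set" and y
  proof -
    have "P (card K)" unfolding P_def using that by blast
    then show ?thesis unfolding I(2) by (rule Least_le)
  qed
  have indep: "\<forall>a \<in> I \<rightarrow> carrier R. comb I x a \<in> torsion \<longrightarrow> (\<forall>i\<in>I. a i = \<zero>)"
  proof (intro ballI impI)
    fix a i assume "a \<in> I \<rightarrow> carrier R" "comb I x a \<in> torsion" "i \<in> I"
    then show "a i = \<zero>" using minimal_family_independent[OF I(1) _ x span] min by blast
  qed
  have "\<forall>j\<in>J. \<exists>\<tau>. \<tau> \<in> torsion \<and> (\<exists>b \<in> I \<rightarrow> carrier R. z j = comb I x b \<oplus>\<^bsub>M\<^esub> \<tau>)"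
    using z span unfolding span_over_def by blast
  from bchoice[OF this] obtain \<tau> where \<tau>: "\<And>j. j \<in> J \<Longrightarrow> \<tau> j \<in> torsion"
    "\<And>j. j \<in> J \<Longrightarrow> \<exists>b \<in> I \<rightarrow> carrier R. z j = comb I x b \<oplus>\<^bsub>M\<^esub> \<tau> j" by blast
  have "\<tau> \<in> J \<rightarrow> torsion" using \<tau>(1) by (rule funcsetI)
  from common_annihilator[OF J this] obtain t
    where t: "t \<in> carrier R - {\<zero>}" "\<forall>j\<in>J. t \<odot>\<^bsub>M\<^esub> \<tau> j = \<zero>\<^bsub>M\<^esub>" ..
  have tR: "t \<in> carrier R" using t by simp
  let ?S = "{\<sigma> \<in> torsion. t \<odot>\<^bsub>M\<^esub> \<sigma> = \<zero>\<^bsub>M\<^esub>}"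
  have tc: "\<sigma> \<in> carrier M" if "\<sigma> \<in> torsion" for \<sigma> using that torsion_carrier by blast
  have S: "submodule ?S R M"
  proof (rule submoduleI)
    show "?S \<subseteq> carrier M" using tc by blast
    show "\<zero>\<^bsub>M\<^esub> \<in> ?S" using submodule_zero[OF torsion_submodule] tR by simp
    fix u assume u: "u \<in> ?S"
    then show "\<ominus>\<^bsub>M\<^esub> u \<in> ?S" using torsionE(3) tc tR by (auto simp: smult_r_minus)
    show "r \<odot>\<^bsub>M\<^esub> u \<in> ?S" if r: "r \<in> carrier R" for r
    proof -
      have "t \<odot>\<^bsub>M\<^esub> (r \<odot>\<^bsub>M\<^esub> u) = r \<odot>\<^bsub>M\<^esub> (t \<odot>\<^bsub>M\<^esub> u)"
      proof -
        have uc: "u \<in> carrier M" using tc u by blast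
        show ?thesis
          unfolding smult_assoc1[OF tR r uc, symmetric] smult_assoc1[OF r tR uc, symmetric] m_comm[OF tR r] ..
      qed
      then show ?thesis using torsionE(4) u r by simp
    qed
    fix v assume v: "v \<in> ?S"
    then show "u \<oplus>\<^bsub>M\<^esub> v \<in> ?S" using u torsionE(5) tc tR by (simp add: smult_r_distr)
  qed
  have "z ` J \<subseteq> span_over ?S I x"
  proof (rule image_subsetI)
    fix j assume j: "j \<in> J"
    have "\<tau> j \<in> ?S" using \<tau>(1) t(2) j by blast
    then show "z j \<in> span_over ?S I x" using \<tau>(2)[OF j] unfolding span_over_def by blast
  qed
  then have all: "carrier M \<subseteq> span_over ?S I x" using gen[OF span_over_submodule[OF S I(1) x]] by blast
  have "t \<odot>\<^bsub>M\<^esub> \<sigma> = \<zero>\<^bsub>M\<^esub>" if s: "\<sigma> \<in> torsion" for \<sigma>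
  proof -
    obtain b \<rho> where b: "b \<in> I \<rightarrow> carrier R" "\<rho> \<in> ?S" "\<sigma> = comb I x b \<oplus>\<^bsub>M\<^esub> \<rho>"
      using all tc[OF s] unfolding span_over_def by blast
    have c: "comb I x b \<in> carrier M" "\<rho> \<in> carrier M" using comb_closed[OF x b(1)] b(2) tc by auto
    have "comb I x b = \<sigma> \<oplus>\<^bsub>M\<^esub> \<ominus>\<^bsub>M\<^esub> \<rho>" unfolding b(3) using c by (simp add: M.a_assoc M.r_neg)
    then have "comb I x b \<in> torsion" using torsionE(3,5) s b(2) by simp
    then have "\<forall>i\<in>I. b i = \<zero>" using indep b(1) by blast
    then have "comb I x b = comb I x (\<lambda>i. \<zero>)" using x by (intro comb_cong) auto
    then have "comb I x b = \<zero>\<^bsub>M\<^esub>" using comb_zero[OF x] by simp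
    then have "\<sigma> = \<rho>" using b(3) c by simp
    then show ?thesis using b(2) by simp
  qed
  then have "splitting I x t" unfolding splitting_def using I(1) x span indep t(1) by simp
  then show ?thesis by blast
qed

lemma torsion_multiple_zero:
  assumes a: "a \<in> carrier R - {\<zero>}" "\<And>\<tau>. \<tau> \<in> torsion \<Longrightarrow> a \<odot>\<^bsub>M\<^esub> \<tau> = \<zero>\<^bsub>M\<^esub>"
    and u: "u \<in> multiples a" "u \<in> torsion"
  shows "u = \<zero>\<^bsub>M\<^esub>"
proof -
  obtain m where m: "m \<in> carrier M" "u = a \<odot>\<^bsub>M\<^esub> m" using u(1) unfolding multiples_def by blast
  then have "m \<in> torsion" using torsion_cancel[OF a(1) m(1)] u(2) by simp
  then show ?thesis using a(2) m(2) by simp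
qed

lemma splitting_rep:
  assumes "splitting I x t" "m \<in> carrier M"
  obtains b \<tau> where "b \<in> I \<rightarrow> carrier R" "\<tau> \<in> torsion" "m = comb I x b \<oplus>\<^bsub>M\<^esub> \<tau>"
proof -
  have "m \<in> span_over torsion I x" using assms unfolding splitting_def by simp
  then show thesis using that unfolding span_over_def by blast
qed

lemma splitting_unique:
  assumes s: "splitting I x t" and b: "b \<in> I \<rightarrow> carrier R" "\<tau> \<in> torsion"
    and c: "c \<in> I \<rightarrow> carrier R" "\<sigma> \<in> torsion"
    and eq: "comb I x b \<oplus>\<^bsub>M\<^esub> \<tau> = comb I x c \<oplus>\<^bsub>M\<^esub> \<sigma>"
  shows "\<And>i. i \<in> I \<Longrightarrow> b i = c i" "\<tau> = \<sigma>"
proof -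
  have I: "finite I" and x: "x \<in> I \<rightarrow> carrier M"
    and indep: "\<And>a. \<lbrakk>a \<in> I \<rightarrow> carrier R; comb I x a \<in> torsion\<rbrakk> \<Longrightarrow> \<forall>i\<in>I. a i = \<zero>"
    using s unfolding splitting_def by blast+
  have cc: "comb I x b \<in> carrier M" "comb I x c \<in> carrier M" "\<tau> \<in> carrier M" "\<sigma> \<in> carrier M"
    using comb_closed[OF x] b c torsion_carrier by blast+
  have "comb I x b = (comb I x c \<oplus>\<^bsub>M\<^esub> \<sigma>) \<oplus>\<^bsub>M\<^esub> \<ominus>\<^bsub>M\<^esub> \<tau>"
    unfolding eq[symmetric] using cc by (simp add: M.a_assoc M.r_neg)
  then have "comb I x b \<ominus>\<^bsub>M\<^esub> comb I x c = \<sigma> \<oplus>\<^bsub>M\<^esub> \<ominus>\<^bsub>M\<^esub> \<tau>"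
    unfolding a_minus_def using cc by (simp add: M.a_ac M.r_neg M.r_neg1)
  then have "comb I x (\<lambda>i. b i \<ominus> c i) \<in> torsion"
    using comb_minus[OF I x b(1) c(1)] torsionE(3,5) b(2) c(2) by simp
  then have z: "\<forall>i\<in>I. b i \<ominus> c i = \<zero>" using indep[of "\<lambda>i. b i \<ominus> c i"] b(1) c(1) by blast
  show eqi: "b i = c i" if i: "i \<in> I" for i
    using z i r_right_minus_eq[OF funcset_mem[OF b(1) i] funcset_mem[OF c(1) i]] by blast
  have "comb I x b = comb I x c" using x c(1) eqi by (intro comb_cong) auto
  then show "\<tau> = \<sigma>" using eq cc by simp
qed

lemma multiples_rep:
  assumes s: "splitting I x t" and a: "a \<in> carrier R" "\<And>\<tau>. \<tau> \<in> torsion \<Longrightarrow> a \<odot>\<^bsub>M\<^esub> \<tau> = \<zero>\<^bsub>M\<^esub>"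
    and u: "u \<in> multiples a"
  obtains c where "c \<in> I \<rightarrow> carrier R" "u = comb I x (\<lambda>i. a \<otimes> c i)"
proof -
  have I: "finite I" and x: "x \<in> I \<rightarrow> carrier M" using s unfolding splitting_def by blast+
  obtain m where m: "m \<in> carrier M" "u = a \<odot>\<^bsub>M\<^esub> m" using u unfolding multiples_def by blast
  obtain c \<tau> where c: "c \<in> I \<rightarrow> carrier R" "\<tau> \<in> torsion" "m = comb I x c \<oplus>\<^bsub>M\<^esub> \<tau>"
    using splitting_rep[OF s m(1)] .
  have cc: "comb I x c \<in> carrier M" "\<tau> \<in> carrier M" using comb_closed[OF x c(1)] c(2) torsion_carrier by auto
  have "u = a \<odot>\<^bsub>M\<^esub> comb I x c"
    unfolding m(2) c(3) smult_r_distr[OF a(1) cc] a(2)[OF c(2)] using cc a(1) by simp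
  then show thesis using that[OF c(1)] comb_smult[OF I x c(1) a(1)] by simp
qed

text \<open>The multiples of \<open>t q\<^sup>k\<close>, where \<open>t\<close> kills the torsion and \<open>q\<close> is a nonzero nonunit, are cofinite. They contain no
  nonzero torsion element, and their elements have coefficients divisible by \<open>q\<^sup>k\<close>, so an element with a
  nonzero coefficient is avoided for large \<open>k\<close>.\<close>
lemma residually_finite:
  assumes fgR: "finitely_generated_ring R" and fg: "finitely_generated_module R M"
  shows "residually_finite_module R M"
proof (rule residually_finiteI)
  fix m assume m: "m \<in> carrier M - {\<zero>\<^bsub>M\<^esub>}"
  show "\<exists>U\<in>cofinites. m \<notin> U"
  proof (cases "finite (carrier R)")
    case True
    \<comment> \<open>\<open>R/0R\<close> is finite, so \<open>0M = 0\<close> is cofinite.\<close>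
    have "finite_residues R \<zero>"
      unfolding finite_residues_def using True by (intro exI[of _ "carrier R"]) force
    then have "multiples \<zero> \<in> cofinites" using multiples_cofinite[OF fg] by simp
    moreover have "multiples \<zero> \<subseteq> {\<zero>\<^bsub>M\<^esub>}" unfolding multiples_def by auto
    ultimately show ?thesis using m by blast
  next
    case False
    obtain q where q: "q \<in> carrier R - Units R" "q \<noteq> \<zero>" using nonzero_nonunit_exists[OF fgR False] by blast
    obtain I :: "nat set" and x t where s: "splitting I x t" using splitting_exists[OF fg] by blast
    have I: "finite I" and x: "x \<in> I \<rightarrow> carrier M" and t: "t \<in> carrier R - {\<zero>}"
      and tt: "\<And>\<tau>. \<tau> \<in> torsion \<Longrightarrow> t \<odot>\<^bsub>M\<^esub> \<tau> = \<zero>\<^bsub>M\<^esub>" using s unfolding splitting_def by blast+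
    have qc: "q \<in> carrier R" and tc: "t \<in> carrier R" using q t by auto
    have qk: "q [^] (k::nat) \<in> carrier R - {\<zero>}" for k
    proof (induct k)
      case (Suc k)
      then show ?case using q qc integral[of "q [^] k" q] by auto
    qed simp
    have a: "t \<otimes> q [^] (k::nat) \<in> carrier R - {\<zero>}" for k using t qk[of k] integral[of t "q [^] k"] by auto
    have at: "(t \<otimes> q [^] (k::nat)) \<odot>\<^bsub>M\<^esub> \<tau> = \<zero>\<^bsub>M\<^esub>" if "\<tau> \<in> torsion" for k \<tau>
    proof -
      have "\<tau> \<in> carrier M" using that torsion_carrier by blast
      then have "(q [^] k \<otimes> t) \<odot>\<^bsub>M\<^esub> \<tau> = q [^] k \<odot>\<^bsub>M\<^esub> (t \<odot>\<^bsub>M\<^esub> \<tau>)" using smult_assoc1 qc tc by simp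
      then show ?thesis using tt[OF that] qc tc m_comm[of t "q [^] k"] by simp
    qed
    have cof: "multiples (t \<otimes> q [^] (k::nat)) \<in> cofinites" for k
      using multiples_cofinite[OF fg _ finite_residues_nonzero[OF fgR a]] a by blast
    have "\<exists>k::nat. m \<notin> multiples (t \<otimes> q [^] k)"
    proof (cases "m \<in> torsion")
      case True
      then have "m \<notin> multiples (t \<otimes> q [^] (0::nat))" using torsion_multiple_zero[OF a at] m by blast
      then show ?thesis by blast
    next
      case False
      obtain b \<tau> where b: "b \<in> I \<rightarrow> carrier R" "\<tau> \<in> torsion" "m = comb I x b \<oplus>\<^bsub>M\<^esub> \<tau>"
        using splitting_rep[OF s, of m] m by blast
      have "\<exists>i\<in>I. b i \<noteq> \<zero>"
      proof (rule ccontr)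
        assume "\<not> ?thesis"
        then have "comb I x b = comb I x (\<lambda>i. \<zero>)" using x by (intro comb_cong) auto
        then have "m = \<tau>" using b(2,3) comb_zero[OF x] torsion_carrier by auto
        then show False using b(2) False by simp
      qed
      then obtain i where i: "i \<in> I" "b i \<noteq> \<zero>" by blast
      then have "b i \<in> carrier R - {\<zero>}" using b(1) by blast
      then obtain k :: nat where k: "\<not> q [^] k divides b i" using power_not_divides[OF q(1)] by blast
      have "m \<notin> multiples (t \<otimes> q [^] k)"
      proof
        assume "m \<in> multiples (t \<otimes> q [^] k)"
        then obtain c where c: "c \<in> I \<rightarrow> carrier R" "m = comb I x (\<lambda>i. (t \<otimes> q [^] k) \<otimes> c i)"
          using multiples_rep[OF s _ at] a by blast
        have cc: "(\<lambda>i. (t \<otimes> q [^] k) \<otimes> c i) \<in> I \<rightarrow> carrier R" using c(1) a by blast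
        have "comb I x b \<oplus>\<^bsub>M\<^esub> \<tau> = comb I x (\<lambda>i. (t \<otimes> q [^] k) \<otimes> c i) \<oplus>\<^bsub>M\<^esub> \<zero>\<^bsub>M\<^esub>"
          using b(3) c(2) comb_closed[OF x cc] by simp
        then have e: "b i = (t \<otimes> q [^] k) \<otimes> c i"
          using splitting_unique(1)[OF s b(1,2) cc submodule_zero[OF torsion_submodule]] i(1) by blast
        have ci: "c i \<in> carrier R" using c(1) i(1) by blast
        have qkc: "q [^] k \<in> carrier R" using qc by simp
        have "b i = q [^] k \<otimes> (t \<otimes> c i)" unfolding e using ci qkc tc by algebra
        then have "q [^] k divides b i" unfolding factor_def using ci tc by blast
        then show False using k by simp
      qed
      then show ?thesis by blast
    qed
    then show ?thesis using cof by blast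
  qed
qed

end

section \<open>Comparing two modules modulo multiples\<close>

text \<open>If \<open>q\<close> factors through \<open>p\<close> and takes at least as many values, then \<open>p\<close> and \<open>q\<close> have the same fibres.\<close>
lemma card_image_factor:
  assumes fin: "finite (p ` A)" and well: "\<And>x y. \<lbrakk>x \<in> A; y \<in> A; p x = p y\<rbrakk> \<Longrightarrow> q x = q y"
  shows "card (q ` A) \<le> card (p ` A)"
    and "\<lbrakk>card (p ` A) \<le> card (q ` A); x \<in> A; y \<in> A; q x = q y\<rbrakk> \<Longrightarrow> p x = p y"
proof -
  let ?f = "\<lambda>b. q (inv_into A p b)"
  have f: "?f (p x) = q x" if "x \<in> A" for x
    using that by (intro well) (auto simp: inv_into_into f_inv_into_f)
  have im: "?f ` (p ` A) = q ` A" using f by (auto simp: image_image cong: image_cong)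
  show le: "card (q ` A) \<le> card (p ` A)" using card_image_le[OF fin, of ?f] unfolding im .
  assume "card (p ` A) \<le> card (q ` A)" and xy: "x \<in> A" "y \<in> A" "q x = q y"
  then have "card (?f ` (p ` A)) = card (p ` A)" using le unfolding im by simp
  then have "inj_on ?f (p ` A)" by (rule eq_card_imp_inj_on[OF fin])
  then show "p x = p y" using inj_onD[of ?f "p ` A" "p x" "p y"] xy f by simp
qed

context module
begin

lemma coset_add_cong:
  assumes U: "submodule U R M" and c: "x \<in> carrier M" "x' \<in> carrier M" "y \<in> carrier M" "y' \<in> carrier M"
    and "U +>\<^bsub>M\<^esub> x = U +>\<^bsub>M\<^esub> x'" "U +>\<^bsub>M\<^esub> y = U +>\<^bsub>M\<^esub> y'"
  shows "U +>\<^bsub>M\<^esub> (x \<oplus>\<^bsub>M\<^esub> y) = U +>\<^bsub>M\<^esub> (x' \<oplus>\<^bsub>M\<^esub> y')"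
  unfolding coset_sum[OF U c(1,3), symmetric] coset_sum[OF U c(2,4), symmetric] assms(6,7) ..

lemma coset_smult_cong:
  assumes U: "submodule U R M" and c: "x \<in> carrier M" "x' \<in> carrier M" "a \<in> carrier R"
    and eq: "U +>\<^bsub>M\<^esub> x = U +>\<^bsub>M\<^esub> x'"
  shows "U +>\<^bsub>M\<^esub> (a \<odot>\<^bsub>M\<^esub> x) = U +>\<^bsub>M\<^esub> (a \<odot>\<^bsub>M\<^esub> x')"
  unfolding quotient_smult[OF U c(1,3), symmetric] quotient_smult[OF U c(2,3), symmetric] eq ..

lemma coset_mono:
  assumes U: "submodule U R M" and V: "submodule V R M" and UV: "U \<subseteq> V"
    and c: "x \<in> carrier M" "y \<in> carrier M" and eq: "U +>\<^bsub>M\<^esub> x = U +>\<^bsub>M\<^esub> y"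
  shows "V +>\<^bsub>M\<^esub> x = V +>\<^bsub>M\<^esub> y"
  using eq UV unfolding coset_eq_iff[OF U c] coset_eq_iff[OF V c] by blast

lemma coset_absorb:
  assumes U: "submodule U R M" and x: "x \<in> carrier M" and u: "u \<in> U"
  shows "U +>\<^bsub>M\<^esub> (x \<oplus>\<^bsub>M\<^esub> u) = U +>\<^bsub>M\<^esub> x"
proof -
  have uc: "u \<in> carrier M" using u submoduleE(1)[OF U] by blast
  show ?thesis using coset_eq_iff[OF U _ x, of "x \<oplus>\<^bsub>M\<^esub> u"] M.add_diff_cancel[OF x uc] x uc u by simp
qed

lemma diff_eqE:
  assumes "x \<in> carrier M" "y \<in> carrier M" shows "x = y \<oplus>\<^bsub>M\<^esub> (x \<ominus>\<^bsub>M\<^esub> y)"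
  unfolding a_minus_def using assms by (simp add: M.a_ac M.r_neg1 M.r_neg)

end

lemma epi_mod_multiples_cong:
  assumes M: "Module.module R M" and N: "Module.module R N" and a: "a \<in> carrier R"
    and epi: "epi_mod R M N (module.multiples N a) f"
    and c: "x \<in> carrier M" "y \<in> carrier M"
    and eq: "module.multiples M a +>\<^bsub>M\<^esub> x = module.multiples M a +>\<^bsub>M\<^esub> y"
  shows "module.multiples N a +>\<^bsub>N\<^esub> f x = module.multiples N a +>\<^bsub>N\<^esub> f y"
proof -
  interpret M: Module.module R M by fact
  interpret N: Module.module R N by fact
  note UM = M.multiples_submodule[OF a] and UN = N.multiples_submodule[OF a]
  have f: "f m \<in> carrier N" if "m \<in> carrier M" for m using epi that unfolding epi_mod_def by blast
  have "x \<ominus>\<^bsub>M\<^esub> y \<in> M.multiples a" using eq M.coset_eq_iff[OF UM c] by simp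
  then obtain z where z: "z \<in> carrier M" "x \<ominus>\<^bsub>M\<^esub> y = a \<odot>\<^bsub>M\<^esub> z" unfolding M.multiples_def by blast
  have x: "x = y \<oplus>\<^bsub>M\<^esub> a \<odot>\<^bsub>M\<^esub> z" using M.diff_eqE[OF c] z(2) by simp
  have az: "a \<odot>\<^bsub>M\<^esub> z \<in> carrier M" using a z by simp
  have fz: "a \<odot>\<^bsub>N\<^esub> f z \<in> N.multiples a" unfolding N.multiples_def using f[OF z(1)] by blast
  have "N.multiples a +>\<^bsub>N\<^esub> f x = N.multiples a +>\<^bsub>N\<^esub> (f y \<oplus>\<^bsub>N\<^esub> f (a \<odot>\<^bsub>M\<^esub> z))"
    unfolding x using epi c(2) az unfolding epi_mod_def by blast
  also have "\<dots> = N.multiples a +>\<^bsub>N\<^esub> (f y \<oplus>\<^bsub>N\<^esub> a \<odot>\<^bsub>N\<^esub> f z)"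
  proof (rule N.coset_add_cong[OF UN f[OF c(2)] f[OF c(2)] f[OF az] _ refl])
    show "a \<odot>\<^bsub>N\<^esub> f z \<in> carrier N" using a f[OF z(1)] by simp
    show "N.multiples a +>\<^bsub>N\<^esub> f (a \<odot>\<^bsub>M\<^esub> z) = N.multiples a +>\<^bsub>N\<^esub> (a \<odot>\<^bsub>N\<^esub> f z)"
      using epi a z(1) unfolding epi_mod_def by blast
  qed
  also have "\<dots> = N.multiples a +>\<^bsub>N\<^esub> f y" by (rule N.coset_absorb[OF UN f[OF c(2)] fz])
  finally show ?thesis .
qed

lemma epi_mod_image:
  assumes "epi_mod R M N W f"
  shows "(\<lambda>x. W +>\<^bsub>N\<^esub> f x) ` carrier M = (\<lambda>y. W +>\<^bsub>N\<^esub> y) ` carrier N"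
proof
  show "(\<lambda>x. W +>\<^bsub>N\<^esub> f x) ` carrier M \<subseteq> (\<lambda>y. W +>\<^bsub>N\<^esub> y) ` carrier N"
    using assms unfolding epi_mod_def by blast
  show "(\<lambda>y. W +>\<^bsub>N\<^esub> y) ` carrier N \<subseteq> (\<lambda>x. W +>\<^bsub>N\<^esub> f x) ` carrier M"
  proof (rule image_subsetI)
    fix y assume "y \<in> carrier N"
    then obtain x where "x \<in> carrier M" "W +>\<^bsub>N\<^esub> f x = W +>\<^bsub>N\<^esub> y"
      using assms unfolding epi_mod_def by blast
    then show "W +>\<^bsub>N\<^esub> y \<in> (\<lambda>x. W +>\<^bsub>N\<^esub> f x) ` carrier M" by force
  qed
qed

text \<open>Epimorphisms \<open>M/aM \<rightarrow> N/aN\<close> and \<open>N/aN \<rightarrow> M/aM\<close> between finite sets are bijective.\<close>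
lemma mutual_epi_mod:
  assumes M: "Module.module R M" and N: "Module.module R N" and a: "a \<in> carrier R"
    and epi: "epi_mod R M N (module.multiples N a) f" "epi_mod R N M (module.multiples M a) g"
    and fin: "module.multiples M a \<in> cofinite_submodules R M" "module.multiples N a \<in> cofinite_submodules R N"
  shows "card ((\<lambda>x. module.multiples M a +>\<^bsub>M\<^esub> x) ` carrier M) =
      card ((\<lambda>y. module.multiples N a +>\<^bsub>N\<^esub> y) ` carrier N)"
    and "\<And>x y. \<lbrakk>x \<in> carrier M; y \<in> carrier M;
      module.multiples N a +>\<^bsub>N\<^esub> f x = module.multiples N a +>\<^bsub>N\<^esub> f y\<rbrakk> \<Longrightarrow>
      module.multiples M a +>\<^bsub>M\<^esub> x = module.multiples M a +>\<^bsub>M\<^esub> y"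
proof -
  interpret M: Module.module R M by fact
  interpret N: Module.module R N by fact
  let ?p = "\<lambda>x. M.multiples a +>\<^bsub>M\<^esub> x" and ?q = "\<lambda>y. N.multiples a +>\<^bsub>N\<^esub> y"
  have finM: "finite (?p ` carrier M)" and finN: "finite (?q ` carrier N)"
    using fin M.cofinite_iff N.cofinite_iff by blast+
  have cF: "?q (f x) = ?q (f y)" if "x \<in> carrier M" "y \<in> carrier M" "?p x = ?p y" for x y
    using epi_mod_multiples_cong[OF M N a epi(1) that] .
  have cG: "?p (g x) = ?p (g y)" if "x \<in> carrier N" "y \<in> carrier N" "?q x = ?q y" for x y
    using epi_mod_multiples_cong[OF N M a epi(2) that] .
  have F: "card ((\<lambda>x. ?q (f x)) ` carrier M) \<le> card (?p ` carrier M)"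
    by (rule card_image_factor(1)[OF finM cF])
  have G: "card ((\<lambda>y. ?p (g y)) ` carrier N) \<le> card (?q ` carrier N)"
    by (rule card_image_factor(1)[OF finN cG])
  have le: "card (?q ` carrier N) \<le> card (?p ` carrier M)" using F unfolding epi_mod_image[OF epi(1)] .
  have ge: "card (?p ` carrier M) \<le> card (?q ` carrier N)" using G unfolding epi_mod_image[OF epi(2)] .
  show "card (?p ` carrier M) = card (?q ` carrier N)" using le ge by simp
  show "?p x = ?p y" if "x \<in> carrier M" "y \<in> carrier M" "?q (f x) = ?q (f y)" for x y
  proof (rule card_image_factor(2)[OF finM cF _ that])
    show "card (?p ` carrier M) \<le> card ((\<lambda>x. ?q (f x)) ` carrier M)"
      unfolding epi_mod_image[OF epi(1)] by (rule ge)
  qed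
qed

context cring
begin

definition transversal
  where "transversal a D \<longleftrightarrow> finite D \<and> D \<subseteq> carrier R \<and>
    (\<forall>r \<in> carrier R. \<exists>!d. d \<in> D \<and> (\<exists>y \<in> carrier R. r = d \<oplus> a \<otimes> y))"

text \<open>A finite set of representatives of least size contains no two congruent elements.\<close>
lemma transversal_exists:
  assumes a: "a \<in> carrier R" and fin: "finite_residues R a"
  shows "\<exists>D. transversal a D"
proof -
  let ?P = "\<lambda>D. finite D \<and> D \<subseteq> carrier R \<and>
    (\<forall>x \<in> carrier R. \<exists>d \<in> D. \<exists>y \<in> carrier R. x = d \<oplus> a \<otimes> y)"
  obtain D0 where "?P D0" using fin unfolding finite_residues_def by blast
  from ex_has_least_nat[of ?P, OF this, of card] obtain D where
    D: "finite D" "D \<subseteq> carrier R" and cover: "\<forall>x \<in> carrier R. \<exists>d \<in> D. \<exists>y \<in> carrier R. x = d \<oplus> a \<otimes> y"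
    and min: "\<And>E. ?P E \<Longrightarrow> card D \<le> card E" by blast
  have uniq: "d = d'" if d: "d \<in> D" "y \<in> carrier R" "r = d \<oplus> a \<otimes> y"
    and d': "d' \<in> D" "y' \<in> carrier R" "r = d' \<oplus> a \<otimes> y'" for r d d' y y'
  proof (rule ccontr)
    assume ne: "d \<noteq> d'"
    have c: "d \<in> carrier R" "d' \<in> carrier R" using d d' D by auto
    have eq: "d' = d \<oplus> a \<otimes> (y \<ominus> y')"
    proof -
      have "d' = (d' \<oplus> a \<otimes> y') \<oplus> \<ominus> (a \<otimes> y')" using c a d'(2) by algebra
      also have "\<dots> = (d \<oplus> a \<otimes> y) \<oplus> \<ominus> (a \<otimes> y')" using d(3) d'(3) by simp
      also have "\<dots> = d \<oplus> a \<otimes> (y \<ominus> y')" using c a d(2) d'(2) by algebra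
      finally show ?thesis .
    qed
    have "\<exists>e \<in> D - {d'}. \<exists>z \<in> carrier R. s = e \<oplus> a \<otimes> z" if s: "s \<in> carrier R" for s
    proof -
      obtain e z where e: "e \<in> D" "z \<in> carrier R" "s = e \<oplus> a \<otimes> z" using cover s by blast
      show ?thesis
      proof (cases "e = d'")
        case True
        have "s = d \<oplus> a \<otimes> ((y \<ominus> y') \<oplus> z)"
          unfolding e(3) True using c a d(2) d'(2) e(2) by (subst eq) algebra
        moreover have "(y \<ominus> y') \<oplus> z \<in> carrier R" using d(2) d'(2) e(2) by simp
        ultimately show ?thesis using d(1) ne by blast
      next
        case False
        then show ?thesis using e by blast
      qed
    qed
    then have "card D \<le> card (D - {d'})" using D by (intro min) auto
    then show False using card_Diff1_less[OF D(1) d'(1)] by simp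
  qed
  have "transversal a D"
    unfolding transversal_def
  proof (intro conjI ballI)
    show "finite D" "D \<subseteq> carrier R" by fact+
    fix r assume "r \<in> carrier R"
    then obtain d y where "d \<in> D" "y \<in> carrier R" "r = d \<oplus> a \<otimes> y" using cover by blast
    then show "\<exists>!d. d \<in> D \<and> (\<exists>y \<in> carrier R. r = d \<oplus> a \<otimes> y)" using uniq by (intro ex1I[of _ d]) blast+
  qed
  then show ?thesis by blast
qed

text \<open>\<open>0\<close> and \<open>1\<close> are not congruent modulo a nonunit.\<close>
lemma transversal_card:
  assumes a: "a \<in> carrier R" "a \<notin> Units R" and D: "transversal a D"
  shows "2 \<le> card D"
proof -
  obtain d y where d: "d \<in> D" "y \<in> carrier R" "\<zero> = d \<oplus> a \<otimes> y"
    using D unfolding transversal_def by (metis zero_closed)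
  obtain e z where e: "e \<in> D" "z \<in> carrier R" "\<one> = e \<oplus> a \<otimes> z"
    using D unfolding transversal_def by (metis one_closed)
  have c: "d \<in> carrier R" "e \<in> carrier R" using d e D unfolding transversal_def by auto
  have "d \<noteq> e"
  proof
    assume "d = e"
    have "\<one> = (e \<oplus> a \<otimes> z) \<ominus> (d \<oplus> a \<otimes> y)" unfolding d(3)[symmetric] e(3)[symmetric] by (simp add: a_minus_def)
    also have "\<dots> = a \<otimes> (z \<ominus> y)" unfolding \<open>d = e\<close> using a(1) d(2) e(2) c by algebra
    finally have "a divides \<one>" unfolding factor_def using d(2) e(2) by blast
    then show False using divides_one[OF a(1)] a(2) by simp
  qed
  then have "card {d, e} = 2" by simp
  moreover have "card {d, e} \<le> card D" using d(1) e(1) D unfolding transversal_def by (intro card_mono) auto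
  ultimately show ?thesis by simp
qed

end

context pid_module
begin

text \<open>\<open>aM = aF\<close> when \<open>a\<close> kills the torsion, so \<open>M/aM\<close> is the product of \<open>F/aF\<close> and the torsion.\<close>
lemma card_cosets_multiples:
  assumes s: "splitting I x t" and a: "a \<in> carrier R" "\<And>\<tau>. \<tau> \<in> torsion \<Longrightarrow> a \<odot>\<^bsub>M\<^esub> \<tau> = \<zero>\<^bsub>M\<^esub>"
    and D: "transversal a D"
  shows "card ((\<lambda>m. multiples a +>\<^bsub>M\<^esub> m) ` carrier M) = card D ^ card I * card torsion"
proof -
  have I: "finite I" and x: "x \<in> I \<rightarrow> carrier M" using s unfolding splitting_def by blast+
  note U = multiples_submodule[OF a(1)]
  let ?c = "\<lambda>m. multiples a +>\<^bsub>M\<^esub> m"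
  let ?f = "\<lambda>(d, \<tau>). ?c (comb I x d \<oplus>\<^bsub>M\<^esub> \<tau>)"
  have Dc: "D \<subseteq> carrier R" using D unfolding transversal_def by blast
  have dR: "d \<in> I \<rightarrow> carrier R" if "d \<in> I \<rightarrow>\<^sub>E D" for d using that Dc by auto
  have tc: "\<tau> \<in> carrier M" if "\<tau> \<in> torsion" for \<tau> using that torsion_carrier by blast
  have inj: "inj_on ?f ((I \<rightarrow>\<^sub>E D) \<times> torsion)"
  proof (rule inj_onI, clarsimp simp only: mem_Times_iff split_paired_all fst_conv snd_conv prod.case)
    fix d \<tau> e \<sigma> assume d: "d \<in> I \<rightarrow>\<^sub>E D" "\<tau> \<in> torsion" and e: "e \<in> I \<rightarrow>\<^sub>E D" "\<sigma> \<in> torsion"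
      and eq: "?c (comb I x d \<oplus>\<^bsub>M\<^esub> \<tau>) = ?c (comb I x e \<oplus>\<^bsub>M\<^esub> \<sigma>)"
    have cc: "comb I x d \<in> carrier M" "comb I x e \<in> carrier M" using comb_closed[OF x dR] d e by auto
    have dm: "comb I x d \<oplus>\<^bsub>M\<^esub> \<tau> \<in> carrier M" "comb I x e \<oplus>\<^bsub>M\<^esub> \<sigma> \<in> carrier M"
      using cc tc d(2) e(2) by auto
    have "(comb I x d \<oplus>\<^bsub>M\<^esub> \<tau>) \<ominus>\<^bsub>M\<^esub> (comb I x e \<oplus>\<^bsub>M\<^esub> \<sigma>) \<in> multiples a"
      using eq coset_eq_iff[OF U dm] by simp
    then obtain c where c: "c \<in> I \<rightarrow> carrier R"
      "(comb I x d \<oplus>\<^bsub>M\<^esub> \<tau>) \<ominus>\<^bsub>M\<^esub> (comb I x e \<oplus>\<^bsub>M\<^esub> \<sigma>) = comb I x (\<lambda>i. a \<otimes> c i)"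
      using multiples_rep[OF s a] by blast
    have ac: "(\<lambda>i. a \<otimes> c i) \<in> I \<rightarrow> carrier R" using c(1) a(1) by auto
    have sum: "(\<lambda>i. e i \<oplus> a \<otimes> c i) \<in> I \<rightarrow> carrier R" using ac dR[OF e(1)] by auto
    have "comb I x d \<oplus>\<^bsub>M\<^esub> \<tau> = (comb I x e \<oplus>\<^bsub>M\<^esub> \<sigma>) \<oplus>\<^bsub>M\<^esub> comb I x (\<lambda>i. a \<otimes> c i)"
      using diff_eqE[OF dm] c(2) by simp
    also have "\<dots> = comb I x (\<lambda>i. e i \<oplus> a \<otimes> c i) \<oplus>\<^bsub>M\<^esub> \<sigma>"
      unfolding comb_add[OF x dR[OF e(1)] ac, symmetric]
      using cc tc[OF e(2)] comb_closed[OF x ac] by (simp add: M.a_ac)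
    finally have eq2: "comb I x d \<oplus>\<^bsub>M\<^esub> \<tau> = comb I x (\<lambda>i. e i \<oplus> a \<otimes> c i) \<oplus>\<^bsub>M\<^esub> \<sigma>" .
    note u = splitting_unique[OF s dR[OF d(1)] d(2) sum e(2) eq2]
    have "d i = e i" if i: "i \<in> I" for i
    proof -
      have di: "d i \<in> D" "e i \<in> D" "c i \<in> carrier R" using d(1) e(1) c(1) i by auto
      have dc: "d i \<in> carrier R" using di(1) Dc by blast
      have "d i = d i \<oplus> a \<otimes> \<zero>" using dc a(1) by simp
      moreover have "d i = e i \<oplus> a \<otimes> c i" using u(1)[OF i] .
      ultimately show ?thesis using D di dc zero_closed unfolding transversal_def by blast
    qed
    then have "d = e" using PiE_ext[OF d(1) e(1)] by blast
    then show "d = e \<and> \<tau> = \<sigma>" using u(2) by simp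
  qed
  have "?f ` ((I \<rightarrow>\<^sub>E D) \<times> torsion) = ?c ` carrier M"
  proof
    show "?f ` ((I \<rightarrow>\<^sub>E D) \<times> torsion) \<subseteq> ?c ` carrier M"
      using comb_closed[OF x dR] tc by auto
    show "?c ` carrier M \<subseteq> ?f ` ((I \<rightarrow>\<^sub>E D) \<times> torsion)"
    proof (rule image_subsetI)
      fix m assume "m \<in> carrier M"
      then obtain b \<tau> where b: "b \<in> I \<rightarrow> carrier R" "\<tau> \<in> torsion" "m = comb I x b \<oplus>\<^bsub>M\<^esub> \<tau>"
        using splitting_rep[OF s] by blast
      have cover: "\<exists>d \<in> D. \<exists>y \<in> carrier R. r = d \<oplus> a \<otimes> y" if "r \<in> carrier R" for r
        using D that unfolding transversal_def by blast
      obtain d y where d: "d \<in> I \<rightarrow>\<^sub>E D" "y \<in> I \<rightarrow> carrier R"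
        and e: "comb I x b = comb I x d \<oplus>\<^bsub>M\<^esub> a \<odot>\<^bsub>M\<^esub> comb I x y"
        using comb_residue[OF I x a(1) Dc cover b(1)] by blast
      have c: "comb I x d \<in> carrier M" "comb I x y \<in> carrier M" "\<tau> \<in> carrier M"
        using comb_closed[OF x dR[OF d(1)]] comb_closed[OF x d(2)] tc[OF b(2)] by auto
      have "m = (comb I x d \<oplus>\<^bsub>M\<^esub> \<tau>) \<oplus>\<^bsub>M\<^esub> a \<odot>\<^bsub>M\<^esub> comb I x y"
        unfolding b(3) e using c a(1) by (simp add: M.a_ac)
      moreover have "a \<odot>\<^bsub>M\<^esub> comb I x y \<in> multiples a" unfolding multiples_def using c(2) by blast
      ultimately have "?c m = ?c (comb I x d \<oplus>\<^bsub>M\<^esub> \<tau>)" using coset_absorb[OF U] c by simp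
      then show "?c m \<in> ?f ` ((I \<rightarrow>\<^sub>E D) \<times> torsion)"
        using d(1) b(2) by (intro image_eqI[of _ _ "(d, \<tau>)"]) auto
    qed
  qed
  then have "card (?c ` carrier M) = card ((I \<rightarrow>\<^sub>E D) \<times> torsion)" using card_image[OF inj] by simp
  then show ?thesis using card_PiE[OF I, of "\<lambda>_. D"] by (simp add: card_cartesian_product)
qed

lemma torsion_finite:
  assumes a: "a \<in> carrier R - {\<zero>}" "\<And>\<tau>. \<tau> \<in> torsion \<Longrightarrow> a \<odot>\<^bsub>M\<^esub> \<tau> = \<zero>\<^bsub>M\<^esub>"
    and cof: "multiples a \<in> cofinites"
  shows "finite torsion"
proof -
  have U: "submodule (multiples a) R M" and fin: "finite ((\<lambda>m. multiples a +>\<^bsub>M\<^esub> m) ` carrier M)"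
    using cof unfolding cofinite_iff by auto
  have "inj_on (\<lambda>m. multiples a +>\<^bsub>M\<^esub> m) torsion"
  proof (rule inj_onI)
    fix \<tau> \<sigma> assume t: "\<tau> \<in> torsion" "\<sigma> \<in> torsion" and eq: "multiples a +>\<^bsub>M\<^esub> \<tau> = multiples a +>\<^bsub>M\<^esub> \<sigma>"
    have c: "\<tau> \<in> carrier M" "\<sigma> \<in> carrier M" using t torsion_carrier by auto
    have "\<tau> \<ominus>\<^bsub>M\<^esub> \<sigma> \<in> multiples a" using eq coset_eq_iff[OF U c] by simp
    moreover have "\<tau> \<ominus>\<^bsub>M\<^esub> \<sigma> \<in> torsion" unfolding a_minus_def using torsionE(3,5) t by blast
    ultimately have "\<tau> \<ominus>\<^bsub>M\<^esub> \<sigma> = \<zero>\<^bsub>M\<^esub>" using torsion_multiple_zero[OF a] by blast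
    then show "\<tau> = \<sigma>" by (rule M.minus_eq_zeroD[OF c])
  qed
  moreover have "finite ((\<lambda>m. multiples a +>\<^bsub>M\<^esub> m) ` torsion)"
    using torsion_carrier by (intro finite_subset[OF _ fin] image_mono)
  ultimately show ?thesis using finite_imageD by blast
qed

end

lemma (in abelian_group) diff_diff_cancel:
  assumes "x \<in> carrier G" "y \<in> carrier G" shows "x \<ominus> (x \<ominus> y) = y"
  unfolding a_minus_def using assms by (simp add: minus_add r_neg2)

text \<open>For a torsion element \<open>\<tau>\<close> of \<open>M\<close>, \<open>t f(\<tau>)\<close> lies in \<open>t\<^sup>2N\<close>, say \<open>t f(\<tau>) = t\<^sup>2z\<close>, so \<open>f(\<tau>) - tz\<close> is torsion. It is the
  only torsion element congruent to \<open>f(\<tau>)\<close> modulo \<open>tN\<close>, since a torsion element of \<open>tN\<close> is \<open>0\<close>; uniqueness makes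
  the assignment linear. The square is needed because division by \<open>t\<close> turns congruence modulo \<open>t\<^sup>2N\<close>
  into congruence modulo \<open>tN\<close>.\<close>
lemma torsion_embedding:
  assumes M: "pid_module R M" and N: "pid_module R N"
    and t: "t \<in> carrier R - {\<zero>\<^bsub>R\<^esub>}"
    and tM: "\<And>\<tau>. \<tau> \<in> module.torsion R M \<Longrightarrow> t \<odot>\<^bsub>M\<^esub> \<tau> = \<zero>\<^bsub>M\<^esub>"
    and tN: "\<And>\<tau>. \<tau> \<in> module.torsion R N \<Longrightarrow> t \<odot>\<^bsub>N\<^esub> \<tau> = \<zero>\<^bsub>N\<^esub>"
    and epi: "epi_mod R M N (module.multiples N (t \<otimes>\<^bsub>R\<^esub> t)) f"
    and inj: "\<And>x y. \<lbrakk>x \<in> carrier M; y \<in> carrier M;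
      module.multiples N (t \<otimes>\<^bsub>R\<^esub> t) +>\<^bsub>N\<^esub> f x = module.multiples N (t \<otimes>\<^bsub>R\<^esub> t) +>\<^bsub>N\<^esub> f y\<rbrakk> \<Longrightarrow>
      module.multiples M (t \<otimes>\<^bsub>R\<^esub> t) +>\<^bsub>M\<^esub> x = module.multiples M (t \<otimes>\<^bsub>R\<^esub> t) +>\<^bsub>M\<^esub> y"
  shows "\<exists>\<phi>. \<phi> \<in> module.torsion R M \<rightarrow> module.torsion R N \<and>
    (\<forall>\<tau>\<in>module.torsion R M. \<forall>\<sigma>\<in>module.torsion R M. \<phi> (\<tau> \<oplus>\<^bsub>M\<^esub> \<sigma>) = \<phi> \<tau> \<oplus>\<^bsub>N\<^esub> \<phi> \<sigma>) \<and>
    (\<forall>r\<in>carrier R. \<forall>\<tau>\<in>module.torsion R M. \<phi> (r \<odot>\<^bsub>M\<^esub> \<tau>) = r \<odot>\<^bsub>N\<^esub> \<phi> \<tau>) \<and>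
    inj_on \<phi> (module.torsion R M)"
proof -
  interpret M: pid_module R M by fact
  interpret N: pid_module R N by fact
  let ?a = "t \<otimes>\<^bsub>R\<^esub> t"
  have tR: "t \<in> carrier R" and aR: "?a \<in> carrier R" using t by auto
  note UN = N.multiples_submodule[OF aR] and VN = N.multiples_submodule[OF tR]
    and UM = M.multiples_submodule[OF aR] and VM = M.multiples_submodule[OF tR]
  have subN: "N.multiples ?a \<subseteq> N.multiples t"
    unfolding N.multiples_def using tR N.smult_assoc1[OF tR tR] N.smult_closed[OF tR] by auto
  have subM: "M.multiples ?a \<subseteq> M.multiples t"
    unfolding M.multiples_def using tR M.smult_assoc1[OF tR tR] M.smult_closed[OF tR] by auto
  have Mc: "\<tau> \<in> carrier M" if "\<tau> \<in> M.torsion" for \<tau> using that M.torsion_carrier by blast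
  have Nc: "\<tau> \<in> carrier N" if "\<tau> \<in> N.torsion" for \<tau> using that N.torsion_carrier by blast
  have fc: "f x \<in> carrier N" if "x \<in> carrier M" for x using epi that unfolding epi_mod_def by blast
  have f_add: "N.multiples ?a +>\<^bsub>N\<^esub> f (x \<oplus>\<^bsub>M\<^esub> y) = N.multiples ?a +>\<^bsub>N\<^esub> (f x \<oplus>\<^bsub>N\<^esub> f y)"
    if "x \<in> carrier M" "y \<in> carrier M" for x y using epi that unfolding epi_mod_def by blast
  have f_smult: "N.multiples ?a +>\<^bsub>N\<^esub> f (r \<odot>\<^bsub>M\<^esub> x) = N.multiples ?a +>\<^bsub>N\<^esub> (r \<odot>\<^bsub>N\<^esub> f x)"
    if "r \<in> carrier R" "x \<in> carrier M" for x r using epi that unfolding epi_mod_def by blast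
  have f_surj: "\<exists>x\<in>carrier M. N.multiples ?a +>\<^bsub>N\<^esub> f x = N.multiples ?a +>\<^bsub>N\<^esub> y"
    if "y \<in> carrier N" for y using epi that unfolding epi_mod_def by blast
  let ?V = "\<lambda>y. N.multiples t +>\<^bsub>N\<^esub> y"
  have ex: "\<exists>\<sigma>. \<sigma> \<in> N.torsion \<and> ?V \<sigma> = ?V (f \<tau>)" if \<tau>: "\<tau> \<in> M.torsion" for \<tau>
  proof -
    have c: "\<tau> \<in> carrier M" "f \<tau> \<in> carrier N" using Mc[OF \<tau>] fc by auto
    have "N.multiples ?a +>\<^bsub>N\<^esub> (t \<odot>\<^bsub>N\<^esub> f \<tau>) = N.multiples ?a +>\<^bsub>N\<^esub> f (t \<odot>\<^bsub>M\<^esub> \<tau>)"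
      using f_smult[OF tR c(1)] ..
    also have "\<dots> = N.multiples ?a +>\<^bsub>N\<^esub> f (\<zero>\<^bsub>R\<^esub> \<odot>\<^bsub>M\<^esub> \<tau>)" using tM[OF \<tau>] c by simp
    also have "\<dots> = N.multiples ?a +>\<^bsub>N\<^esub> (\<zero>\<^bsub>R\<^esub> \<odot>\<^bsub>N\<^esub> f \<tau>)" using f_smult[OF _ c(1)] by simp
    also have "\<dots> = N.multiples ?a" using N.coset_zero[OF UN] c by simp
    finally have "t \<odot>\<^bsub>N\<^esub> f \<tau> \<in> N.multiples ?a" using N.coset_self[OF UN, of "t \<odot>\<^bsub>N\<^esub> f \<tau>"] tR c by simp
    then obtain z where z: "z \<in> carrier N" "t \<odot>\<^bsub>N\<^esub> f \<tau> = ?a \<odot>\<^bsub>N\<^esub> z" unfolding N.multiples_def by blast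
    let ?s = "f \<tau> \<ominus>\<^bsub>N\<^esub> t \<odot>\<^bsub>N\<^esub> z"
    have tz: "t \<odot>\<^bsub>N\<^esub> z \<in> carrier N" using tR z by simp
    have "t \<odot>\<^bsub>N\<^esub> ?s = t \<odot>\<^bsub>N\<^esub> f \<tau> \<ominus>\<^bsub>N\<^esub> t \<odot>\<^bsub>N\<^esub> (t \<odot>\<^bsub>N\<^esub> z)" by (rule N.smult_minus[OF tR c(2) tz])
    also have "\<dots> = \<zero>\<^bsub>N\<^esub>" unfolding z(2) N.smult_assoc1[OF tR tR z(1)] a_minus_def
      using tR tz by (simp add: N.M.r_neg)
    finally have s: "?s \<in> N.torsion" unfolding N.torsion_def using t c(2) tz by auto
    have "t \<odot>\<^bsub>N\<^esub> z \<in> N.multiples t" unfolding N.multiples_def using z(1) by blast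
    then have "f \<tau> \<ominus>\<^bsub>N\<^esub> ?s \<in> N.multiples t"
    proof -
      have "f \<tau> \<ominus>\<^bsub>N\<^esub> ?s = t \<odot>\<^bsub>N\<^esub> z"
        by (rule N.M.diff_diff_cancel[OF c(2) tz])
      then show ?thesis using \<open>t \<odot>\<^bsub>N\<^esub> z \<in> N.multiples t\<close> by simp
    qed
    then have "?V (f \<tau>) = ?V ?s" using N.coset_eq_iff[OF VN c(2) Nc[OF s]] by simp
    then show ?thesis using s by auto
  qed
  have uniq: "\<sigma> = \<sigma>'" if s: "\<sigma> \<in> N.torsion" "\<sigma>' \<in> N.torsion" "?V \<sigma> = ?V \<sigma>'" for \<sigma> \<sigma>'
  proof -
    have "\<sigma> \<ominus>\<^bsub>N\<^esub> \<sigma>' \<in> N.multiples t" using N.coset_eq_iff[OF VN Nc[OF s(1)] Nc[OF s(2)]] s(3) by simp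
    moreover have "\<sigma> \<ominus>\<^bsub>N\<^esub> \<sigma>' \<in> N.torsion" unfolding a_minus_def using N.torsionE(3,5) s by blast
    ultimately have "\<sigma> \<ominus>\<^bsub>N\<^esub> \<sigma>' = \<zero>\<^bsub>N\<^esub>" using N.torsion_multiple_zero[OF t tN] by blast
    then show ?thesis by (rule N.M.minus_eq_zeroD[OF Nc[OF s(1)] Nc[OF s(2)]])
  qed
  have "\<forall>\<tau>\<in>M.torsion. \<exists>\<sigma>. \<sigma> \<in> N.torsion \<and> ?V \<sigma> = ?V (f \<tau>)" using ex by blast
  from bchoice[OF this] obtain \<phi> where \<phi>: "\<And>\<tau>. \<tau> \<in> M.torsion \<Longrightarrow> \<phi> \<tau> \<in> N.torsion"
    "\<And>\<tau>. \<tau> \<in> M.torsion \<Longrightarrow> ?V (\<phi> \<tau>) = ?V (f \<tau>)" by blast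
  have "\<phi> (\<tau> \<oplus>\<^bsub>M\<^esub> \<sigma>) = \<phi> \<tau> \<oplus>\<^bsub>N\<^esub> \<phi> \<sigma>" if s: "\<tau> \<in> M.torsion" "\<sigma> \<in> M.torsion" for \<tau> \<sigma>
  proof (rule uniq)
    have sum: "\<tau> \<oplus>\<^bsub>M\<^esub> \<sigma> \<in> M.torsion" using M.torsionE(5)[OF s] .
    note c = Mc[OF s(1)] Mc[OF s(2)] Mc[OF sum] Nc[OF \<phi>(1)[OF s(1)]] Nc[OF \<phi>(1)[OF s(2)]]
    show "\<phi> (\<tau> \<oplus>\<^bsub>M\<^esub> \<sigma>) \<in> N.torsion" "\<phi> \<tau> \<oplus>\<^bsub>N\<^esub> \<phi> \<sigma> \<in> N.torsion"
      using \<phi>(1) sum s N.torsionE(5) by blast+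
    have "?V (\<phi> (\<tau> \<oplus>\<^bsub>M\<^esub> \<sigma>)) = ?V (f (\<tau> \<oplus>\<^bsub>M\<^esub> \<sigma>))" using \<phi>(2)[OF sum] .
    also have "\<dots> = ?V (f \<tau> \<oplus>\<^bsub>N\<^esub> f \<sigma>)"
      using N.coset_mono[OF UN VN subN fc[OF c(3)] _ f_add[OF c(1,2)]] fc c(1,2) by simp
    also have "\<dots> = ?V (\<phi> \<tau> \<oplus>\<^bsub>N\<^esub> \<phi> \<sigma>)"
      using N.coset_add_cong[OF VN fc[OF c(1)] c(4) fc[OF c(2)] c(5)] \<phi>(2)[OF s(1)] \<phi>(2)[OF s(2)] by simp
    finally show "?V (\<phi> (\<tau> \<oplus>\<^bsub>M\<^esub> \<sigma>)) = ?V (\<phi> \<tau> \<oplus>\<^bsub>N\<^esub> \<phi> \<sigma>)" .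
  qed
  moreover have "\<phi> (r \<odot>\<^bsub>M\<^esub> \<tau>) = r \<odot>\<^bsub>N\<^esub> \<phi> \<tau>" if r: "r \<in> carrier R" and s: "\<tau> \<in> M.torsion" for r \<tau>
  proof (rule uniq)
    have rt: "r \<odot>\<^bsub>M\<^esub> \<tau> \<in> M.torsion" using M.torsionE(4)[OF r s] .
    note c = Mc[OF s] Mc[OF rt] Nc[OF \<phi>(1)[OF s]]
    show "\<phi> (r \<odot>\<^bsub>M\<^esub> \<tau>) \<in> N.torsion" "r \<odot>\<^bsub>N\<^esub> \<phi> \<tau> \<in> N.torsion"
      using \<phi>(1) rt s r N.torsionE(4) by blast+
    have "?V (\<phi> (r \<odot>\<^bsub>M\<^esub> \<tau>)) = ?V (f (r \<odot>\<^bsub>M\<^esub> \<tau>))" using \<phi>(2)[OF rt] .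
    also have "\<dots> = ?V (r \<odot>\<^bsub>N\<^esub> f \<tau>)"
      using N.coset_mono[OF UN VN subN fc[OF c(2)] _ f_smult[OF r c(1)]] fc[OF c(1)] r by simp
    also have "\<dots> = ?V (r \<odot>\<^bsub>N\<^esub> \<phi> \<tau>)"
      using N.coset_smult_cong[OF VN fc[OF c(1)] c(3) r] \<phi>(2)[OF s] by simp
    finally show "?V (\<phi> (r \<odot>\<^bsub>M\<^esub> \<tau>)) = ?V (r \<odot>\<^bsub>N\<^esub> \<phi> \<tau>)" .
  qed
  moreover have "inj_on \<phi> M.torsion"
  proof (rule inj_onI)
    fix \<tau> \<sigma> assume s: "\<tau> \<in> M.torsion" "\<sigma> \<in> M.torsion" and eq: "\<phi> \<tau> = \<phi> \<sigma>"
    have c: "\<tau> \<in> carrier M" "\<sigma> \<in> carrier M" "f \<tau> \<in> carrier N" "f \<sigma> \<in> carrier N"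
      using s Mc fc by auto
    have "?V (f \<tau>) = ?V (f \<sigma>)" using \<phi>(2)[OF s(1)] \<phi>(2)[OF s(2)] eq by simp
    then have "f \<tau> \<ominus>\<^bsub>N\<^esub> f \<sigma> \<in> N.multiples t" using N.coset_eq_iff[OF VN c(3,4)] by simp
    then obtain w where w: "w \<in> carrier N" "f \<tau> \<ominus>\<^bsub>N\<^esub> f \<sigma> = t \<odot>\<^bsub>N\<^esub> w" unfolding N.multiples_def by blast
    obtain m where m: "m \<in> carrier M" "N.multiples ?a +>\<^bsub>N\<^esub> f m = N.multiples ?a +>\<^bsub>N\<^esub> w"
      using f_surj[OF w(1)] by blast
    have tm: "t \<odot>\<^bsub>M\<^esub> m \<in> carrier M" and tw: "t \<odot>\<^bsub>N\<^esub> w \<in> carrier N" using tR m w by auto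
    have "N.multiples ?a +>\<^bsub>N\<^esub> f (t \<odot>\<^bsub>M\<^esub> m) = N.multiples ?a +>\<^bsub>N\<^esub> (t \<odot>\<^bsub>N\<^esub> w)"
      using f_smult[OF tR m(1)] N.coset_smult_cong[OF UN fc[OF m(1)] w(1) tR m(2)] by simp
    then have "N.multiples ?a +>\<^bsub>N\<^esub> (f \<sigma> \<oplus>\<^bsub>N\<^esub> f (t \<odot>\<^bsub>M\<^esub> m)) = N.multiples ?a +>\<^bsub>N\<^esub> (f \<sigma> \<oplus>\<^bsub>N\<^esub> t \<odot>\<^bsub>N\<^esub> w)"
      using N.coset_add_cong[OF UN c(4,4) fc[OF tm] tw refl] by simp
    then have "N.multiples ?a +>\<^bsub>N\<^esub> f (\<sigma> \<oplus>\<^bsub>M\<^esub> t \<odot>\<^bsub>M\<^esub> m) = N.multiples ?a +>\<^bsub>N\<^esub> f \<tau>"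
      using f_add[OF c(2) tm] N.diff_eqE[OF c(3,4)] w(2) by simp
    then have "M.multiples ?a +>\<^bsub>M\<^esub> (\<sigma> \<oplus>\<^bsub>M\<^esub> t \<odot>\<^bsub>M\<^esub> m) = M.multiples ?a +>\<^bsub>M\<^esub> \<tau>"
      by (rule inj[OF M.M.a_closed[OF c(2) tm] c(1)])
    then have e: "M.multiples t +>\<^bsub>M\<^esub> (\<sigma> \<oplus>\<^bsub>M\<^esub> t \<odot>\<^bsub>M\<^esub> m) = M.multiples t +>\<^bsub>M\<^esub> \<tau>"
      by (rule M.coset_mono[OF UM VM subM M.M.a_closed[OF c(2) tm] c(1)])
    have "t \<odot>\<^bsub>M\<^esub> m \<in> M.multiples t" unfolding M.multiples_def using m(1) by blast
    then have "M.multiples t +>\<^bsub>M\<^esub> \<sigma> = M.multiples t +>\<^bsub>M\<^esub> \<tau>" using M.coset_absorb[OF VM c(2)] e by simp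
    then have "\<sigma> \<ominus>\<^bsub>M\<^esub> \<tau> \<in> M.multiples t" using M.coset_eq_iff[OF VM c(2,1)] by simp
    moreover have "\<sigma> \<ominus>\<^bsub>M\<^esub> \<tau> \<in> M.torsion" unfolding a_minus_def using M.torsionE(3,5) s by blast
    ultimately have "\<sigma> \<ominus>\<^bsub>M\<^esub> \<tau> = \<zero>\<^bsub>M\<^esub>" using M.torsion_multiple_zero[OF t tM] by blast
    then show "\<tau> = \<sigma>" using M.M.minus_eq_zeroD[OF c(2,1)] by blast
  qed
  moreover have "\<phi> \<in> M.torsion \<rightarrow> N.torsion" using \<phi>(1) by (rule funcsetI)
  ultimately show ?thesis by (intro exI[of _ \<phi>]) simp
qed

text \<open>The coordinates of \<open>m\<close> are copied along \<open>\<rho>\<close> and its torsion component is moved by \<open>\<phi>\<close>. That this is well defined,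
  linear and bijective is uniqueness of coordinates in both modules.\<close>
lemma module_iso_of_splittings:
  assumes M: "pid_module R M" and N: "pid_module R N"
    and sM: "pid_module.splitting R M I x s" and sN: "pid_module.splitting R N J y t"
    and \<rho>: "bij_betw \<rho> J I"
    and \<phi>: "bij_betw \<phi> (module.torsion R M) (module.torsion R N)"
    and \<phi>_add: "\<And>\<tau> \<sigma>. \<lbrakk>\<tau> \<in> module.torsion R M; \<sigma> \<in> module.torsion R M\<rbrakk> \<Longrightarrow> \<phi> (\<tau> \<oplus>\<^bsub>M\<^esub> \<sigma>) = \<phi> \<tau> \<oplus>\<^bsub>N\<^esub> \<phi> \<sigma>"
    and \<phi>_smult: "\<And>r \<tau>. \<lbrakk>r \<in> carrier R; \<tau> \<in> module.torsion R M\<rbrakk> \<Longrightarrow> \<phi> (r \<odot>\<^bsub>M\<^esub> \<tau>) = r \<odot>\<^bsub>N\<^esub> \<phi> \<tau>"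
  shows "module_isomorphic R M N"
proof -
  interpret M: pid_module R M by fact
  interpret N: pid_module R N by fact
  have I: "finite I" and x: "x \<in> I \<rightarrow> carrier M" using sM unfolding M.splitting_def by blast+
  have J: "finite J" and y: "y \<in> J \<rightarrow> carrier N" using sN unfolding N.splitting_def by blast+
  have \<rho>I: "\<rho> j \<in> I" if "j \<in> J" for j using \<rho> that unfolding bij_betw_def by blast
  have \<phi>T: "\<phi> \<tau> \<in> N.torsion" if "\<tau> \<in> M.torsion" for \<tau> using \<phi> that unfolding bij_betw_def by blast
  have Nc: "\<tau> \<in> carrier N" if "\<tau> \<in> N.torsion" for \<tau> using that N.torsion_carrier by blast
  have Mc: "\<tau> \<in> carrier M" if "\<tau> \<in> M.torsion" for \<tau> using that M.torsion_carrier by blast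
  have "\<forall>m\<in>carrier M. \<exists>p. fst p \<in> I \<rightarrow> carrier R \<and> snd p \<in> M.torsion \<and> m = M.comb I x (fst p) \<oplus>\<^bsub>M\<^esub> snd p"
    using M.splitting_rep[OF sM] by (metis fst_conv snd_conv)
  from bchoice[OF this] obtain p where
    p: "\<forall>m\<in>carrier M. fst (p m) \<in> I \<rightarrow> carrier R \<and> snd (p m) \<in> M.torsion \<and>
      m = M.comb I x (fst (p m)) \<oplus>\<^bsub>M\<^esub> snd (p m)" by blast
  define B T where "B m = fst (p m)" and "T m = snd (p m)" for m
  have B: "B m \<in> I \<rightarrow> carrier R" and T: "T m \<in> M.torsion" and rep: "M.comb I x (B m) \<oplus>\<^bsub>M\<^esub> T m = m"
    if "m \<in> carrier M" for m using p that unfolding B_def T_def by auto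
  have uniq: "(\<forall>i\<in>I. B m i = b i) \<and> T m = \<tau>"
    if "m \<in> carrier M" "b \<in> I \<rightarrow> carrier R" "\<tau> \<in> M.torsion" "m = M.comb I x b \<oplus>\<^bsub>M\<^esub> \<tau>" for m b \<tau>
    using M.splitting_unique[OF sM B[OF that(1)] T[OF that(1)] that(2,3) trans[OF rep[OF that(1)] that(4)]]
    by blast
  define h where "h m = N.comb J y (\<lambda>j. B m (\<rho> j)) \<oplus>\<^bsub>N\<^esub> \<phi> (T m)" for m
  have BJ: "(\<lambda>j. B m (\<rho> j)) \<in> J \<rightarrow> carrier R" if "m \<in> carrier M" for m
    using funcset_mem[OF B[OF that] \<rho>I] by blast
  note yc = N.comb_closed[OF y BJ]
  have hc: "h m \<in> carrier N" if "m \<in> carrier M" for m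
    unfolding h_def using yc[OF that] Nc[OF \<phi>T[OF T[OF that]]] by simp
  have "h (m \<oplus>\<^bsub>M\<^esub> n) = h m \<oplus>\<^bsub>N\<^esub> h n" if mn: "m \<in> carrier M" "n \<in> carrier M" for m n
  proof -
    have bc: "(\<lambda>i. B m i \<oplus>\<^bsub>R\<^esub> B n i) \<in> I \<rightarrow> carrier R" using B[OF mn(1)] B[OF mn(2)] by auto
    have TT: "T m \<oplus>\<^bsub>M\<^esub> T n \<in> M.torsion" using M.torsionE(5)[OF T[OF mn(1)] T[OF mn(2)]] .
    have "m \<oplus>\<^bsub>M\<^esub> n = (M.comb I x (B m) \<oplus>\<^bsub>M\<^esub> T m) \<oplus>\<^bsub>M\<^esub> (M.comb I x (B n) \<oplus>\<^bsub>M\<^esub> T n)"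
      using rep mn by simp
    also have "\<dots> = M.comb I x (\<lambda>i. B m i \<oplus>\<^bsub>R\<^esub> B n i) \<oplus>\<^bsub>M\<^esub> (T m \<oplus>\<^bsub>M\<^esub> T n)"
      unfolding M.comb_add[OF x B[OF mn(1)] B[OF mn(2)], symmetric]
      using M.comb_closed[OF x B[OF mn(1)]] M.comb_closed[OF x B[OF mn(2)]] Mc[OF T[OF mn(1)]] Mc[OF T[OF mn(2)]]
      by (simp add: M.M.a_ac)
    finally have u: "(\<forall>i\<in>I. B (m \<oplus>\<^bsub>M\<^esub> n) i = B m i \<oplus>\<^bsub>R\<^esub> B n i) \<and> T (m \<oplus>\<^bsub>M\<^esub> n) = T m \<oplus>\<^bsub>M\<^esub> T n"
      by (rule uniq[OF M.M.a_closed[OF mn] bc TT])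
    have BB: "(\<lambda>j. B m (\<rho> j) \<oplus>\<^bsub>R\<^esub> B n (\<rho> j)) \<in> J \<rightarrow> carrier R" using BJ[OF mn(1)] BJ[OF mn(2)] by auto
    have "N.comb J y (\<lambda>j. B (m \<oplus>\<^bsub>M\<^esub> n) (\<rho> j)) = N.comb J y (\<lambda>j. B m (\<rho> j) \<oplus>\<^bsub>R\<^esub> B n (\<rho> j))"
      by (rule N.comb_cong[OF y BB]) (use u \<rho>I in auto)
    then have "h (m \<oplus>\<^bsub>M\<^esub> n) = (N.comb J y (\<lambda>j. B m (\<rho> j)) \<oplus>\<^bsub>N\<^esub> N.comb J y (\<lambda>j. B n (\<rho> j))) \<oplus>\<^bsub>N\<^esub> (\<phi> (T m) \<oplus>\<^bsub>N\<^esub> \<phi> (T n))"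
      unfolding h_def N.comb_add[OF y BJ[OF mn(1)] BJ[OF mn(2)]] using u \<phi>_add[OF T[OF mn(1)] T[OF mn(2)]] by simp
    then show ?thesis
      unfolding h_def using yc[OF mn(1)] yc[OF mn(2)] Nc[OF \<phi>T[OF T[OF mn(1)]]] Nc[OF \<phi>T[OF T[OF mn(2)]]]
      by (simp add: N.M.a_ac)
  qed
  moreover have "h (r \<odot>\<^bsub>M\<^esub> m) = r \<odot>\<^bsub>N\<^esub> h m" if r: "r \<in> carrier R" and m: "m \<in> carrier M" for r m
  proof -
    have bc: "(\<lambda>i. r \<otimes>\<^bsub>R\<^esub> B m i) \<in> I \<rightarrow> carrier R" using B[OF m] r by auto
    have TT: "r \<odot>\<^bsub>M\<^esub> T m \<in> M.torsion" using M.torsionE(4)[OF r T[OF m]] .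
    have "r \<odot>\<^bsub>M\<^esub> m = r \<odot>\<^bsub>M\<^esub> (M.comb I x (B m) \<oplus>\<^bsub>M\<^esub> T m)" using rep m by simp
    also have "\<dots> = M.comb I x (\<lambda>i. r \<otimes>\<^bsub>R\<^esub> B m i) \<oplus>\<^bsub>M\<^esub> r \<odot>\<^bsub>M\<^esub> T m"
      unfolding M.comb_smult[OF I x B[OF m] r, symmetric]
      by (rule M.smult_r_distr[OF r M.comb_closed[OF x B[OF m]] Mc[OF T[OF m]]])
    finally have u: "(\<forall>i\<in>I. B (r \<odot>\<^bsub>M\<^esub> m) i = r \<otimes>\<^bsub>R\<^esub> B m i) \<and> T (r \<odot>\<^bsub>M\<^esub> m) = r \<odot>\<^bsub>M\<^esub> T m"
      by (rule uniq[OF M.smult_closed[OF r m] bc TT])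
    have BB: "(\<lambda>j. r \<otimes>\<^bsub>R\<^esub> B m (\<rho> j)) \<in> J \<rightarrow> carrier R" using BJ[OF m] r by auto
    have "N.comb J y (\<lambda>j. B (r \<odot>\<^bsub>M\<^esub> m) (\<rho> j)) = N.comb J y (\<lambda>j. r \<otimes>\<^bsub>R\<^esub> B m (\<rho> j))"
      by (rule N.comb_cong[OF y BB]) (use u \<rho>I in auto)
    then have "h (r \<odot>\<^bsub>M\<^esub> m) = r \<odot>\<^bsub>N\<^esub> N.comb J y (\<lambda>j. B m (\<rho> j)) \<oplus>\<^bsub>N\<^esub> r \<odot>\<^bsub>N\<^esub> \<phi> (T m)"
      unfolding h_def N.comb_smult[OF J y BJ[OF m] r] using u \<phi>_smult[OF r T[OF m]] by simp
    then show ?thesis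
      unfolding h_def using N.smult_r_distr[OF r yc[OF m] Nc[OF \<phi>T[OF T[OF m]]]] by simp
  qed
  moreover have "bij_betw h (carrier M) (carrier N)"
  proof (rule bij_betw_imageI)
    show "inj_on h (carrier M)"
    proof (rule inj_onI)
      fix m n assume mn: "m \<in> carrier M" "n \<in> carrier M" and eq: "h m = h n"
      note u = N.splitting_unique[OF sN BJ[OF mn(1)] \<phi>T[OF T[OF mn(1)]] BJ[OF mn(2)] \<phi>T[OF T[OF mn(2)]]
        eq[unfolded h_def]]
      have "B m i = B n i" if "i \<in> I" for i
      proof -
        have "i \<in> \<rho> ` J" using that \<rho> unfolding bij_betw_def by simp
        then obtain j where "j \<in> J" "i = \<rho> j" by blast
        then show ?thesis using u(1)[of j] by simp
      qed
      then have "M.comb I x (B m) = M.comb I x (B n)" using x B[OF mn(2)] by (intro M.comb_cong) auto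
      moreover have "T m = T n" using u(2) \<phi> T mn unfolding bij_betw_def inj_on_def by blast
      ultimately have "M.comb I x (B m) \<oplus>\<^bsub>M\<^esub> T m = M.comb I x (B n) \<oplus>\<^bsub>M\<^esub> T n" by simp
      then show "m = n" unfolding rep[OF mn(1)] rep[OF mn(2)] .
    qed
    show "h ` carrier M = carrier N"
    proof
      show "h ` carrier M \<subseteq> carrier N" using hc by blast
      show "carrier N \<subseteq> h ` carrier M"
      proof
        fix n assume "n \<in> carrier N"
        then obtain c \<sigma> where c: "c \<in> J \<rightarrow> carrier R" "\<sigma> \<in> N.torsion" "n = N.comb J y c \<oplus>\<^bsub>N\<^esub> \<sigma>"
          using N.splitting_rep[OF sN] by blast
        have "\<sigma> \<in> \<phi> ` M.torsion" using c(2) \<phi> unfolding bij_betw_def by simp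
        then obtain \<tau> where \<tau>: "\<tau> \<in> M.torsion" "\<sigma> = \<phi> \<tau>" by blast
        let ?b = "\<lambda>i. c (inv_into J \<rho> i)"
        have im: "\<rho> ` J = I" and inj: "inj_on \<rho> J" using \<rho> unfolding bij_betw_def by auto
        have b: "?b \<in> I \<rightarrow> carrier R"
        proof (rule funcsetI)
          fix i assume "i \<in> I"
          then have "inv_into J \<rho> i \<in> J" using im inv_into_into by metis
          then show "?b i \<in> carrier R" using c(1) by blast
        qed
        let ?m = "M.comb I x ?b \<oplus>\<^bsub>M\<^esub> \<tau>"
        have m: "?m \<in> carrier M" using M.comb_closed[OF x b] Mc[OF \<tau>(1)] by simp
        have u: "(\<forall>i\<in>I. B ?m i = ?b i) \<and> T ?m = \<tau>" using uniq[OF m b \<tau>(1) refl] .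
        have "N.comb J y (\<lambda>j. B ?m (\<rho> j)) = N.comb J y c"
          by (rule N.comb_cong[OF y c(1)]) (use u \<rho>I inj in auto)
        then have "h ?m = n" unfolding h_def c(3) \<tau>(2) using u by simp
        then show "n \<in> h ` carrier M" using m by blast
      qed
    qed
  qed
  ultimately have "h \<in> module_isos R M N" unfolding module_isos_iff by blast
  then show ?thesis unfolding module_isomorphic_def by blast
qed

section \<open>Profinite rigidity\<close>

lemma epi_mod_zero_imp_isomorphic:
  assumes M: "Module.module R M" and N: "Module.module R N"
    and epi: "epi_mod R M N {\<zero>\<^bsub>N\<^esub>} f"
    and inj: "\<And>x y. \<lbrakk>x \<in> carrier M; y \<in> carrier M; f x = f y\<rbrakk> \<Longrightarrow> x = y"
  shows "module_isomorphic R M N"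
proof -
  interpret M: Module.module R M by fact
  interpret N: Module.module R N by fact
  have eq: "x = y" if "x \<in> carrier N" "y \<in> carrier N" "{\<zero>\<^bsub>N\<^esub>} +>\<^bsub>N\<^esub> x = {\<zero>\<^bsub>N\<^esub>} +>\<^bsub>N\<^esub> y" for x y
    using N.coset_eq_iff[OF N.zero_submodule that(1,2)] that(3) N.M.minus_eq_zeroD[OF that(1,2)] by simp
  have fc: "f x \<in> carrier N" if "x \<in> carrier M" for x using epi that unfolding epi_mod_def by blast
  have "f (x \<oplus>\<^bsub>M\<^esub> y) = f x \<oplus>\<^bsub>N\<^esub> f y" if xy: "x \<in> carrier M" "y \<in> carrier M" for x y
    using epi xy fc unfolding epi_mod_def by (intro eq) auto
  moreover have "f (a \<odot>\<^bsub>M\<^esub> x) = a \<odot>\<^bsub>N\<^esub> f x" if ax: "a \<in> carrier R" "x \<in> carrier M" for a x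
    using epi ax fc unfolding epi_mod_def by (intro eq) auto
  moreover have "bij_betw f (carrier M) (carrier N)"
  proof (rule bij_betw_imageI)
    show "inj_on f (carrier M)" using inj by (rule inj_onI)
    have "y \<in> f ` carrier M" if y: "y \<in> carrier N" for y
    proof -
      obtain x where x: "x \<in> carrier M" "{\<zero>\<^bsub>N\<^esub>} +>\<^bsub>N\<^esub> f x = {\<zero>\<^bsub>N\<^esub>} +>\<^bsub>N\<^esub> y"
        using epi y unfolding epi_mod_def by blast
      have "f x = y" by (rule eq[OF fc[OF x(1)] y x(2)])
      then show ?thesis using x(1) by blast
    qed
    then show "f ` carrier M = carrier N" using fc by blast
  qed
  ultimately have "f \<in> module_isos R M N" unfolding module_isos_iff by blast
  then show ?thesis unfolding module_isomorphic_def by blast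
qed

text \<open>For infinite \<open>R\<close> the modulus is \<open>t\<^sup>2\<close>, where \<open>t\<close> is the product of annihilators of the two torsion modules with a
  nonzero nonunit \<open>q\<close>. The factor \<open>q\<close> ensures that \<open>R/t\<^sup>2R\<close> has at least two elements, so that its powers
  determine the rank.\<close>
lemma completions_isomorphic_imp_isomorphic:
  assumes R: "principal_domain R" and fgR: "finitely_generated_ring R"
    and M: "Module.module R M" "finitely_generated_module R M"
    and N: "Module.module R N" "finitely_generated_module R N"
    and iso: "profinite_completions_isomorphic R M N"
  shows "module_isomorphic R M N"
proof -
  interpret principal_domain R by fact
  interpret M: pid_module R M using R M(1) by (rule pid_module.intro)
  interpret N: pid_module R N using R N(1) by (rule pid_module.intro)
  note isoN = profinite_completions_isomorphic_sym[OF M(1) N(1) iso]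
  have transfer: "\<exists>f g. epi_mod R M N (N.multiples a) f \<and> epi_mod R N M (M.multiples a) g \<and>
      M.multiples a \<in> cofinite_submodules R M \<and> N.multiples a \<in> cofinite_submodules R N"
    if "a \<in> carrier R" "finite_residues R a" for a
  proof -
    note cM = M.multiples_cofinite[OF M(2) that] and cN = N.multiples_cofinite[OF N(2) that]
    show ?thesis
      using completion_iso_epi_mod[OF M(1) N(1) iso cN] completion_iso_epi_mod[OF N(1) M(1) isoN cM] cM cN
      by blast
  qed
  show ?thesis
  proof (cases "finite (carrier R)")
    case True
    have "finite_residues R \<zero>\<^bsub>R\<^esub>"
      unfolding finite_residues_def using True by (intro exI[of _ "carrier R"]) force
    then obtain f g where fg: "epi_mod R M N (N.multiples \<zero>\<^bsub>R\<^esub>) f" "epi_mod R N M (M.multiples \<zero>\<^bsub>R\<^esub>) g"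
      and cof: "M.multiples \<zero>\<^bsub>R\<^esub> \<in> cofinite_submodules R M" "N.multiples \<zero>\<^bsub>R\<^esub> \<in> cofinite_submodules R N"
      using transfer[OF zero_closed] by blast
    have zM: "M.multiples \<zero>\<^bsub>R\<^esub> = {\<zero>\<^bsub>M\<^esub>}" unfolding M.multiples_def using M.M.zero_closed by force
    have zN: "N.multiples \<zero>\<^bsub>R\<^esub> = {\<zero>\<^bsub>N\<^esub>}" unfolding N.multiples_def using N.M.zero_closed by force
    note inj = mutual_epi_mod(2)[OF M(1) N(1) zero_closed fg cof]
    show ?thesis
    proof (rule epi_mod_zero_imp_isomorphic[OF M(1) N(1) fg(1)[unfolded zN]])
      fix x y assume xy: "x \<in> carrier M" "y \<in> carrier M" "f x = f y"
      then have "{\<zero>\<^bsub>M\<^esub>} +>\<^bsub>M\<^esub> x = {\<zero>\<^bsub>M\<^esub>} +>\<^bsub>M\<^esub> y" using inj[OF xy(1,2)] unfolding zM by simp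
      then show "x = y"
        using M.coset_eq_iff[OF M.zero_submodule xy(1,2)] M.M.minus_eq_zeroD[OF xy(1,2)] by simp
    qed
  next
    case False
    obtain q where q: "q \<in> carrier R - Units R" "q \<noteq> \<zero>\<^bsub>R\<^esub>" using nonzero_nonunit_exists[OF fgR False] by blast
    obtain I :: "nat set" and x s where sM: "M.splitting I x s" using M.splitting_exists[OF M(2)] by blast
    obtain J :: "nat set" and y u where sN: "N.splitting J y u" using N.splitting_exists[OF N(2)] by blast
    have s: "s \<in> carrier R - {\<zero>\<^bsub>R\<^esub>}" "\<And>\<tau>. \<tau> \<in> M.torsion \<Longrightarrow> s \<odot>\<^bsub>M\<^esub> \<tau> = \<zero>\<^bsub>M\<^esub>" and I: "finite I"
      using sM unfolding M.splitting_def by blast+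
    have u: "u \<in> carrier R - {\<zero>\<^bsub>R\<^esub>}" "\<And>\<tau>. \<tau> \<in> N.torsion \<Longrightarrow> u \<odot>\<^bsub>N\<^esub> \<tau> = \<zero>\<^bsub>N\<^esub>" and J: "finite J"
      using sN unfolding N.splitting_def by blast+
    have c: "q \<in> carrier R" "s \<in> carrier R" "u \<in> carrier R" using q s u by auto
    define t where "t = q \<otimes>\<^bsub>R\<^esub> (s \<otimes>\<^bsub>R\<^esub> u)"
    have su: "s \<otimes>\<^bsub>R\<^esub> u \<in> carrier R - {\<zero>\<^bsub>R\<^esub>}" using integral[of s u] s u c by auto
    have t: "t \<in> carrier R - {\<zero>\<^bsub>R\<^esub>}" unfolding t_def using integral[of q "s \<otimes>\<^bsub>R\<^esub> u"] su q c by auto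
    have tR: "t \<in> carrier R" using t by simp
    have tM: "t \<odot>\<^bsub>M\<^esub> \<tau> = \<zero>\<^bsub>M\<^esub>" if "\<tau> \<in> M.torsion" for \<tau>
    proof -
      have tc: "\<tau> \<in> carrier M" using that M.torsion_carrier by blast
      have "t = (q \<otimes>\<^bsub>R\<^esub> u) \<otimes>\<^bsub>R\<^esub> s" unfolding t_def using c by algebra
      then show ?thesis using M.smult_assoc1[of "q \<otimes>\<^bsub>R\<^esub> u" s \<tau>] c tc s(2)[OF that] by simp
    qed
    have tN: "t \<odot>\<^bsub>N\<^esub> \<tau> = \<zero>\<^bsub>N\<^esub>" if "\<tau> \<in> N.torsion" for \<tau>
    proof -
      have tc: "\<tau> \<in> carrier N" using that N.torsion_carrier by blast
      have "t = (q \<otimes>\<^bsub>R\<^esub> s) \<otimes>\<^bsub>R\<^esub> u" unfolding t_def using c by algebra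
      then show ?thesis using N.smult_assoc1[of "q \<otimes>\<^bsub>R\<^esub> s" u \<tau>] c tc u(2)[OF that] by simp
    qed
    let ?a = "t \<otimes>\<^bsub>R\<^esub> t"
    have a: "?a \<in> carrier R - {\<zero>\<^bsub>R\<^esub>}" using integral[of t t] t by auto
    have aR: "?a \<in> carrier R" using a by simp
    have aM: "?a \<odot>\<^bsub>M\<^esub> \<tau> = \<zero>\<^bsub>M\<^esub>" if "\<tau> \<in> M.torsion" for \<tau>
      using M.smult_assoc1[OF tR tR, of \<tau>] tM[OF that] that M.torsion_carrier tR by auto
    have aN: "?a \<odot>\<^bsub>N\<^esub> \<tau> = \<zero>\<^bsub>N\<^esub>" if "\<tau> \<in> N.torsion" for \<tau>
      using N.smult_assoc1[OF tR tR, of \<tau>] tN[OF that] that N.torsion_carrier tR by auto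
    have anu: "?a \<notin> Units R"
    proof
      assume "?a \<in> Units R"
      then have "?a divides\<^bsub>R\<^esub> \<one>\<^bsub>R\<^esub>" using divides_one[OF aR] by simp
      then obtain w where w: "w \<in> carrier R" "\<one>\<^bsub>R\<^esub> = ?a \<otimes>\<^bsub>R\<^esub> w" unfolding factor_def by blast
      have "?a \<otimes>\<^bsub>R\<^esub> w = q \<otimes>\<^bsub>R\<^esub> ((s \<otimes>\<^bsub>R\<^esub> u) \<otimes>\<^bsub>R\<^esub> t \<otimes>\<^bsub>R\<^esub> w)"
        using c w(1) tR unfolding t_def by algebra
      then have "q divides\<^bsub>R\<^esub> \<one>\<^bsub>R\<^esub>" unfolding factor_def w(2) using c tR w(1) by blast
      then show False using divides_one[OF c(1)] q by simp
    qed
    note res = finite_residues_nonzero[OF fgR a]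
    obtain f g where fg: "epi_mod R M N (N.multiples ?a) f" "epi_mod R N M (M.multiples ?a) g"
      and cof: "M.multiples ?a \<in> cofinite_submodules R M" "N.multiples ?a \<in> cofinite_submodules R N"
      using transfer[OF aR res] by blast
    note MN = mutual_epi_mod[OF M(1) N(1) aR fg cof]
    note NM = mutual_epi_mod(2)[OF N(1) M(1) aR fg(2,1) cof(2,1)]
    have finM: "finite M.torsion" by (rule M.torsion_finite[OF a aM cof(1)])
    have finN: "finite N.torsion" by (rule N.torsion_finite[OF a aN cof(2)])
    obtain \<phi> where \<phi>: "\<phi> \<in> M.torsion \<rightarrow> N.torsion" "inj_on \<phi> M.torsion"
      and \<phi>_add: "\<forall>\<tau>\<in>M.torsion. \<forall>\<sigma>\<in>M.torsion. \<phi> (\<tau> \<oplus>\<^bsub>M\<^esub> \<sigma>) = \<phi> \<tau> \<oplus>\<^bsub>N\<^esub> \<phi> \<sigma>"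
      and \<phi>_smult: "\<forall>r\<in>carrier R. \<forall>\<tau>\<in>M.torsion. \<phi> (r \<odot>\<^bsub>M\<^esub> \<tau>) = r \<odot>\<^bsub>N\<^esub> \<phi> \<tau>"
      using torsion_embedding[OF M.pid_module_axioms N.pid_module_axioms t tM tN fg(1) MN(2)] by blast
    obtain \<psi> where \<psi>: "\<psi> \<in> N.torsion \<rightarrow> M.torsion" "inj_on \<psi> N.torsion"
      using torsion_embedding[OF N.pid_module_axioms M.pid_module_axioms t tN tM fg(2) NM] by blast
    have le: "card M.torsion \<le> card N.torsion" using card_inj_on_le[OF \<phi>(2) _ finN] \<phi>(1) by blast
    have ge: "card N.torsion \<le> card M.torsion" using card_inj_on_le[OF \<psi>(2) _ finM] \<psi>(1) by blast
    have im: "\<phi> ` M.torsion = N.torsion"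
      using card_subset_eq[OF finN, of "\<phi> ` M.torsion"] card_image[OF \<phi>(2)] \<phi>(1) le ge by fastforce
    have bij: "bij_betw \<phi> M.torsion N.torsion" using \<phi>(2) im by (rule bij_betw_imageI)
    obtain D where D: "transversal ?a D" using transversal_exists[OF aR res] by blast
    have "card D ^ card I * card M.torsion = card D ^ card J * card N.torsion"
      using MN(1) M.card_cosets_multiples[OF sM aR aM D] N.card_cosets_multiples[OF sN aR aN D] by simp
    moreover have "card M.torsion = card N.torsion" using le ge by simp
    moreover have "card N.torsion > 0"
      using finN N.submodule_zero[OF N.torsion_submodule] card_gt_0_iff by blast
    ultimately have "card D ^ card I = card D ^ card J" by simp
    then have "card I = card J" using transversal_card[OF aR anu D] by simp
    then obtain \<rho> where "bij_betw \<rho> J I" using finite_same_card_bij[OF J I] by auto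
    then show ?thesis
      using module_iso_of_splittings[OF M.pid_module_axioms N.pid_module_axioms sM sN _ bij] \<phi>_add \<phi>_smult
      by blast
  qed
qed

theorem corollaryE:
  fixes R :: "('a, 'r) ring_scheme" and M :: "('a, 'm, 'x) module_scheme"
  assumes "principal_domain R" and "finitely_generated_ring R"
    and "Module.module R M" and "finitely_generated_module R M"
  shows "profinitely_rigid TYPE('n) R M"
proof -
  interpret M: pid_module R M using assms(1,3) by (rule pid_module.intro)
  have "profinite_completions_isomorphic R M N \<longleftrightarrow> module_isomorphic R M N"
    if "Module.module R N" "finitely_generated_module R N" for N :: "('a, 'n) module"
    using completions_isomorphic_imp_isomorphic[OF assms that] module_iso_imp_completions_iso[OF assms(3) that(1)]
    by blast
  then show ?thesis
    unfolding profinitely_rigid_def using assms(3,4) M.residually_finite[OF assms(2,4)] by blast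
qed

end
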